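(* We have $\pi^s(\overline{\mathbb{T}},\ast)=1$, while no universal covering projection over $\overline{\mathbb{T}}$ exists.
   Context: For each $m\in\mathbb{N}=\{1,2,3,\dots\}$ let $C_m\subseteq\mathbb{R}^2$ be the circle of radius $\frac1m$ centered at $(\frac1m,0)$; let $\mathbb{E}=\bigcup_{m\in\mathbb{N}}C_m\subseteq\mathbb{R}^2$ (subspace topology) with basepoint $\ast=(0,0)$. Let $\ell_m:[0,1]\to C_m$ be the loop $\ell_m(t)=\left(\frac1m(1-\cos 2\pi t),\frac1m\sin 2\pi t\right)$. Let $f:\mathbb{E}\to\mathbb{E}$ be the unique continuous map with $f\circ\ell_m=\ell_{m+1}$ for all $m\in\mathbb{N}$. For each $i\in\mathbb{Z}$ let $X_i$ be a copy of $\mathbb{E}$ and let $f_i=f:X_i\to X_{i+1}$. Let $\overline{\mathbb{T}}$ be the mapping telescope of the bi-infinite sequence $\cdots\to X_{-1}\to X_0\to X_1\to\cdots$ with maps $f_i$, i.e. the quotient of the disjoint union $\sum_{i\in\mathbb{Z}}X_i\times[0,1]$ by $(x,1)\sim(f_i(x),0)$ for all $i\in\mathbb{Z}$, $x\in X_i$ (where $(x,1)\in X_i\times[0,1]$ and $(f_i(x),0)\in X_{i+1}\times[0,1]$), with quotient map $\overline{h}$. Identify $X_i$ with $\overline{h}(X_i\times\{0\})$; the basepoint of $\overline{\mathbb{T}}$ is $\ast\in X_0$. A covering projection $u:\overline{X}\to X$ with connected total space is called universal (in the categorical sense; $\overline{X}$ is not required to be simply connected) if, with basepoint $\overline{x}\in\overline{X}$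 and $x=u(\overline{x})$, for every covering projection $r:(E,e)\to(X,x)$ there is a continuous map $s:(\overline{X},\overline{x})\to(E,e)$ with $r\circ s=u$. Spanier group: for a space $X$ with $x\in X$ and an open cover $\mathcal{U}$ of $X$, let $\pi(\mathcal{U},x)$ be the subgroup of $\pi_1(X,x)$ generated by all elements $[\gamma\cdot\delta\cdot\gamma^-]$ where $\gamma:[0,1]\to X$ is a path with $\gamma(0)=x$, $\gamma^-(t)=\gamma(1-t)$, and $\delta$ is a loop based at $\gamma(1)$ whose image lies in some $U\in\mathcal{U}$. The Spanier group is $\pi^s(X,x)=\bigcap_{\mathcal{U}}\pi(\mathcal{U},x)$, the intersection over all open covers $\mathcal{U}$ of $X$. *)

theory Defs
  imports "HOL-Analysis.Analysis" "HOL-Algebra.Generated_Groups"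
begin

section \<open>Fundamental group and Spanier group\<close>

text \<open>
  The path operations and the path homotopy relation of HOL-Analysis require a type of class
  \<^class>\<open>topological_space\<close>. The telescope below is a quotient and hence only available as a
  value of type \<^typ>\<open>'a topology\<close>, so the notions are restated for abstract topologies,
  with the same formulas.
\<close>

definition path_join :: "(real \<Rightarrow> 'a) \<Rightarrow> (real \<Rightarrow> 'a) \<Rightarrow> real \<Rightarrow> 'a" where
  "path_join p q = (\<lambda>t. if t \<le> 1/2 then p (2 * t) else q (2 * t - 1))"

definition path_reverse :: "(real \<Rightarrow> 'a) \<Rightarrow> real \<Rightarrow> 'a" where
  "path_reverse p = (\<lambda>t. p (1 - t))"

definition loopin :: "'a topology \<Rightarrow> 'a \<Rightarrow> (real \<Rightarrow> 'a) \<Rightarrow> bool" where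
  "loopin X x p \<longleftrightarrow> pathin X p \<and> p 0 = x \<and> p 1 = x"

definition path_homotopic :: "'a topology \<Rightarrow> (real \<Rightarrow> 'a) \<Rightarrow> (real \<Rightarrow> 'a) \<Rightarrow> bool" where
  "path_homotopic X p q \<longleftrightarrow>
     homotopic_with (\<lambda>r. r 0 = p 0 \<and> r 1 = p 1) (top_of_set {0..1}) X p q"

definition path_class :: "'a topology \<Rightarrow> (real \<Rightarrow> 'a) \<Rightarrow> (real \<Rightarrow> 'a) set" where
  "path_class X p = {q. path_homotopic X p q}"

text \<open>The product of two classes is the class of the concatenation of any two representatives;
  it is written as a union over all representatives to avoid a choice.\<close>

definition fundamental_group :: "'a topology \<Rightarrow> 'a \<Rightarrow> (real \<Rightarrow> 'a) set monoid" where
  "fundamental_group X x =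
     \<lparr>carrier = path_class X ` {p. loopin X x p},
      monoid.mult = (\<lambda>A B. \<Union>p\<in>A. \<Union>q\<in>B. path_class X (path_join p q)),
      one = path_class X (\<lambda>_. x)\<rparr>"

definition open_cover :: "'a topology \<Rightarrow> 'a set set \<Rightarrow> bool" where
  "open_cover X \<U> \<longleftrightarrow> (\<forall>U\<in>\<U>. openin X U) \<and> \<Union>\<U> = topspace X"

definition spanier_cover_group ::
    "'a topology \<Rightarrow> 'a set set \<Rightarrow> 'a \<Rightarrow> (real \<Rightarrow> 'a) set set" where
  "spanier_cover_group X \<U> x =
     generate (fundamental_group X x)
       {path_class X (path_join (path_join \<gamma> \<delta>) (path_reverse \<gamma>)) | \<gamma> \<delta>.
          pathin X \<gamma> \<and> \<gamma> 0 = x \<and> loopin X (\<gamma> 1) \<delta> \<and> (\<exists>U\<in>\<U>. \<delta> ` {0..1} \<subseteq> U)}"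

definition spanier_group :: "'a topology \<Rightarrow> 'a \<Rightarrow> (real \<Rightarrow> 'a) set set" where
  "spanier_group X x = (\<Inter>\<U>\<in>{\<U>. open_cover X \<U>}. spanier_cover_group X \<U> x)"


section \<open>Covering projections\<close>

text \<open>The abstract-topology version of \<^const>\<open>covering_space\<close>.\<close>

definition covering_projection :: "'c topology \<Rightarrow> 'a topology \<Rightarrow> ('c \<Rightarrow> 'a) \<Rightarrow> bool" where
  "covering_projection E X r \<longleftrightarrow>
     continuous_map E X r \<and> r ` topspace E = topspace X \<and>
     (\<forall>x\<in>topspace X. \<exists>T. x \<in> T \<and> openin X T \<and>
        (\<exists>\<V>. \<Union>\<V> = {e \<in> topspace E. r e \<in> T} \<and>
             (\<forall>V\<in>\<V>. openin E V) \<and>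
             pairwise disjnt \<V> \<and>
             (\<forall>V\<in>\<V>. homeomorphic_map (subtopology E V) (subtopology X T) r)))"

text \<open>
  Universality in the categorical sense. A formula cannot quantify over all types that could
  carry the total space \<open>E\<close>, so the total spaces range over all topologies on the type
  \<^typ>\<open>(real \<Rightarrow> 'a) set\<close>, that of sets of paths in \<open>X\<close>. If \<open>X\<close> is path connected and locally
  path connected, no generality is lost: \<open>s\<close> maps into the path component of \<open>e\<close>, which
  covers \<open>X\<close>, and a path connected covering space of \<open>X\<close> is homeomorphic to one whose points
  are equivalence classes of paths in \<open>X\<close> starting at \<open>r e\<close>. For arbitrary \<open>X\<close> the condition
  is implied by the one with unrestricted \<open>E\<close>, so a nonexistence statement only becomes
  stronger. The type of \<open>Y\<close> is arbitrary.
\<close>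

definition universal_covering_projection ::
    "'c topology \<Rightarrow> 'c \<Rightarrow> 'a topology \<Rightarrow> ('c \<Rightarrow> 'a) \<Rightarrow> bool" where
  "universal_covering_projection Y y X u \<longleftrightarrow>
     covering_projection Y X u \<and> connected_space Y \<and> y \<in> topspace Y \<and>
     (\<forall>(E :: (real \<Rightarrow> 'a) set topology) e r.
        covering_projection E X r \<and> e \<in> topspace E \<and> r e = u y \<longrightarrow>
        (\<exists>s. continuous_map Y E s \<and> s y = e \<and> (\<forall>z\<in>topspace Y. r (s z) = u z)))"


section \<open>Quotients and bi-infinite mapping telescopes\<close>

definition quotient_topology :: "'a topology \<Rightarrow> ('a \<times> 'a) set \<Rightarrow> 'a set topology" where
  "quotient_topology X R =
     topology (\<lambda>U. U \<subseteq> topspace X // R \<and> openin X {x \<in> topspace X. R `` {x} \<in> U})"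

lemma openin_quotient_topology:
  "openin (quotient_topology X R) U \<longleftrightarrow>
     U \<subseteq> topspace X // R \<and> openin X {x \<in> topspace X. R `` {x} \<in> U}"
proof -
  have 1: "{x \<in> topspace X. R `` {x} \<in> S \<inter> T} =
      {x \<in> topspace X. R `` {x} \<in> S} \<inter> {x \<in> topspace X. R `` {x} \<in> T}" for S T
    by auto
  have 2: "{x \<in> topspace X. R `` {x} \<in> \<Union>\<K>} =
      (\<Union>K\<in>\<K>. {x \<in> topspace X. R `` {x} \<in> K})" for \<K>
    by auto
  have "istopology
      (\<lambda>U. U \<subseteq> topspace X // R \<and> openin X {x \<in> topspace X. R `` {x} \<in> U})"
    unfolding istopology_def 1 2 by blast
  then show ?thesis
    by (simp add: quotient_topology_def)
qed

lemma topspace_quotient_topology [simp]: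
  "topspace (quotient_topology X R) = topspace X // R"
proof (rule antisym)
  show "topspace (quotient_topology X R) \<subseteq> topspace X // R"
    using openin_quotient_topology[of X R "topspace (quotient_topology X R)"] by simp
  have "{x \<in> topspace X. R `` {x} \<in> topspace X // R} = topspace X"
    by (auto intro: quotientI)
  then have "openin (quotient_topology X R) (topspace X // R)"
    by (simp add: openin_quotient_topology)
  then show "topspace X // R \<subseteq> topspace (quotient_topology X R)"
    by (rule openin_subset)
qed

lemma quotient_map_quotient_topology:
  "quotient_map X (quotient_topology X R) (\<lambda>x. R `` {x})"
  by (auto simp: quotient_map_def openin_quotient_topology quotient_def)

definition telescope_sum :: "(int \<Rightarrow> 'a topology) \<Rightarrow> (int \<times> 'a \<times> real) topology" where
  "telescope_sum X = sum_topology (\<lambda>i. prod_topology (X i) (top_of_set {0..1})) UNIV"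

definition telescope_glue ::
    "(int \<Rightarrow> 'a topology) \<Rightarrow> (int \<Rightarrow> 'a \<Rightarrow> 'a) \<Rightarrow> int \<times> 'a \<times> real \<Rightarrow> int \<times> 'a \<times> real \<Rightarrow> bool" where
  "telescope_glue X f a b \<longleftrightarrow>
     (\<exists>i. \<exists>x\<in>topspace (X i). a = (i, x, 1) \<and> b = (i + 1, f i x, 0))"

definition telescope_rel ::
    "(int \<Rightarrow> 'a topology) \<Rightarrow> (int \<Rightarrow> 'a \<Rightarrow> 'a) \<Rightarrow> ((int \<times> 'a \<times> real) \<times> (int \<times> 'a \<times> real)) set" where
  "telescope_rel X f =
     {(a, b). a \<in> topspace (telescope_sum X) \<and> b \<in> topspace (telescope_sum X) \<and>
              equivclp (telescope_glue X f) a b}"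

lemma equiv_telescope_rel: "equiv (topspace (telescope_sum X)) (telescope_rel X f)"
  unfolding telescope_rel_def
  by (intro equivI refl_onI symI transI)
     (auto intro: equivclp_sym equivclp_trans)

definition mapping_telescope ::
    "(int \<Rightarrow> 'a topology) \<Rightarrow> (int \<Rightarrow> 'a \<Rightarrow> 'a) \<Rightarrow> (int \<times> 'a \<times> real) set topology" where
  "mapping_telescope X f = quotient_topology (telescope_sum X) (telescope_rel X f)"

definition telescope_proj ::
    "(int \<Rightarrow> 'a topology) \<Rightarrow> (int \<Rightarrow> 'a \<Rightarrow> 'a) \<Rightarrow> int \<times> 'a \<times> real \<Rightarrow> (int \<times> 'a \<times> real) set" where
  "telescope_proj X f a = telescope_rel X f `` {a}"


section \<open>The earring and its telescope\<close>

definition earring :: "(real \<times> real) set" where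
  "earring = (\<Union>m\<in>{1::nat..}. sphere (1 / real m, 0) (1 / real m))"

abbreviation earring_top :: "(real \<times> real) topology" where
  "earring_top \<equiv> top_of_set earring"

definition earring_loop :: "nat \<Rightarrow> real \<Rightarrow> real \<times> real" where
  "earring_loop m t = (1 / real m * (1 - cos (2 * pi * t)), 1 / real m * sin (2 * pi * t))"

definition is_earring_shift :: "(real \<times> real \<Rightarrow> real \<times> real) \<Rightarrow> bool" where
  "is_earring_shift g \<longleftrightarrow>
     continuous_map earring_top earring_top g \<and>
     (\<forall>m\<ge>1. \<forall>t\<in>{0..1}. g (earring_loop m t) = earring_loop (m + 1) t)"

text \<open>Uniqueness of the map refers to its values on the earring, hence \<^const>\<open>extensional\<close>.\<close>

definition earring_shift :: "real \<times> real \<Rightarrow> real \<times> real" where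
  "earring_shift = (THE g. g \<in> extensional earring \<and> is_earring_shift g)"

lemma mem_earring_circle:
  "m \<ge> 1 \<Longrightarrow> (x, y) \<in> sphere (1 / real m, 0) (1 / real m) \<longleftrightarrow> x\<^sup>2 + y\<^sup>2 = 2 * x / real m"
proof -
  assume m: "m \<ge> 1"
  have expand: "(d - x)\<^sup>2 + y\<^sup>2 = d\<^sup>2 + (x\<^sup>2 + y\<^sup>2 - 2 * x * d)" for d :: real
    by (simp add: power2_eq_square algebra_simps)
  have "(x, y) \<in> sphere (1 / real m, 0) (1 / real m) \<longleftrightarrow>
      sqrt ((1 / real m - x)\<^sup>2 + y\<^sup>2) = 1 / real m"
    by (simp add: dist_prod_def dist_real_def)
  also have "\<dots> \<longleftrightarrow> (1 / real m - x)\<^sup>2 + y\<^sup>2 = (1 / real m)\<^sup>2"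
  proof -
    have "1 / real m = sqrt ((1 / real m)\<^sup>2)"
      by simp
    then show ?thesis
      by (metis real_sqrt_eq_iff)
  qed
  also have "(1 / real m - x)\<^sup>2 + y\<^sup>2 = (1 / real m)\<^sup>2 + (x\<^sup>2 + y\<^sup>2 - 2 * x / real m)"
    using expand[of "1 / real m"] by simp
  also have "\<dots> = (1 / real m)\<^sup>2 \<longleftrightarrow> x\<^sup>2 + y\<^sup>2 = 2 * x / real m"
    by auto
  finally show ?thesis .
qed

lemma earring_loop_surj:
  assumes "p \<in> earring"
  obtains m t where "m \<ge> 1" "t \<in> {0..1}" "p = earring_loop m t"
proof -
  obtain m where m: "m \<ge> 1" and q: "p \<in> sphere (1 / real m, 0) (1 / real m)"
    using assms unfolding earring_def by blast
  obtain x y where p: "p = (x, y)"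
    by (cases p)
  have c: "(x, y) \<in> sphere (1 / real m, 0) (1 / real m)"
    using q p by simp
  have eq: "x\<^sup>2 + y\<^sup>2 = 2 * x / real m"
    using c m mem_earring_circle by blast
  have m0: "real m > 0" using m by simp
  have "(1 - real m * x)\<^sup>2 + (real m * y)\<^sup>2 = 1 + (real m)\<^sup>2 * (x\<^sup>2 + y\<^sup>2) - 2 * real m * x"
    by (simp add: power2_eq_square algebra_simps)
  also have "\<dots> = 1"
    unfolding eq using m0 by (simp add: power2_eq_square)
  finally obtain s where s: "0 \<le> s" "s < 2 * pi" "1 - real m * x = cos s" "real m * y = sin s"
    using sincos_total_2pi by metis
  have "p = earring_loop m (s / (2 * pi))"
    using s(3,4) m0 p by (auto simp: earring_loop_def field_simps)
  moreover have "s / (2 * pi) \<in> {0..1}"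
    using s by (auto simp: field_simps)
  ultimately show ?thesis
    using m that by blast
qed

lemma earring_loop_circle:
  "(1 / real m * (1 - cos a))\<^sup>2 + (1 / real m * sin a)\<^sup>2 = 2 * (1 / real m * (1 - cos a)) / real m"
proof -
  have "(d * (1 - cos a))\<^sup>2 + (d * sin a)\<^sup>2 = 2 * (d * (1 - cos a)) * d" for d :: real
    unfolding power_mult_distrib sin_squared_eq by (simp add: power2_eq_square algebra_simps)
  from this[of "1 / real m"] show ?thesis
    by simp
qed

lemma earring_loop_in: "m \<ge> 1 \<Longrightarrow> earring_loop m t \<in> earring"
proof -
  assume m: "m \<ge> 1"
  have "earring_loop m t \<in> sphere (1 / real m, 0) (1 / real m)"
    unfolding earring_loop_def mem_earring_circle[OF m] by (rule earring_loop_circle)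
  then show ?thesis
    using m unfolding earring_def by fastforce
qed

text \<open>On the circle of radius \<open>r = 1/m\<close> one has \<open>r = (x\<^sup>2 + y\<^sup>2) / (2 x)\<close> away from the origin,
  and the shift is multiplication by \<open>m / (m + 1) = 1 / (1 + r)\<close>.\<close>

lemma earring_shift_exists: "\<exists>g. is_earring_shift g"
proof -
  define k :: "real \<times> real \<Rightarrow> real" where
    "k = (\<lambda>p. 1 / (1 + ((fst p)\<^sup>2 + (snd p)\<^sup>2) / (2 * fst p)))"
  define g where "g = (\<lambda>p. k p *\<^sub>R p)"
  have fst_pos: "fst p > 0" if pE: "p \<in> earring" and p0: "p \<noteq> 0" for p
  proof -
    obtain m where m: "m \<ge> 1" and q: "p \<in> sphere (1 / real m, 0) (1 / real m)"
      using pE unfolding earring_def by blast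
    obtain x y where p: "p = (x, y)"
      by (cases p)
    have c: "(x, y) \<in> sphere (1 / real m, 0) (1 / real m)"
      using q p by simp
    have "x\<^sup>2 + y\<^sup>2 = 2 * x / real m"
      using c m mem_earring_circle by blast
    moreover have "x\<^sup>2 + y\<^sup>2 > 0"
      using p0 p by (auto simp: sum_power2_gt_zero_iff zero_prod_def)
    ultimately show ?thesis
      using p m by (auto simp: zero_less_divide_iff)
  qed
  have shift: "g (earring_loop m t) = earring_loop (m + 1) t" if m: "m \<ge> 1" for m t
  proof (cases "cos (2 * pi * t) = 1")
    case True
    then have "sin (2 * pi * t) = 0"
      by (metis cos_one_sin_zero)
    with True show ?thesis
      by (simp add: earring_loop_def g_def)
  next
    case False
    define c s where "c = cos (2 * pi * t)" and "s = sin (2 * pi * t)"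
    have c1: "1 - c \<noteq> 0"
      using False by (simp add: c_def)
    have "(1 / real m * (1 - c))\<^sup>2 + (1 / real m * s)\<^sup>2 = 2 * (1 / real m * (1 - c)) / real m"
      unfolding c_def s_def by (rule earring_loop_circle)
    then have "k (earring_loop m t) =
        1 / (1 + (2 * (1 / real m * (1 - c)) / real m) / (2 * (1 / real m * (1 - c))))"
      unfolding k_def earring_loop_def fst_conv snd_conv c_def s_def by presburger
    also have "(2 * (1 / real m * (1 - c)) / real m) / (2 * (1 / real m * (1 - c))) = 1 / real m"
      using m c1 by simp
    finally have k: "k (earring_loop m t) = 1 / (1 + 1 / real m)" .
    have "(1 + 1 / real m) * real m = 1 + real m"
      using m by (simp add: algebra_simps)
    then show ?thesis
      unfolding g_def k by (simp add: earring_loop_def)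
  qed
  have maps: "g p \<in> earring" if p: "p \<in> earring" for p
  proof -
    obtain m t where "m \<ge> 1" "p = earring_loop m t"
      using p earring_loop_surj by metis
    then show ?thesis
      using shift earring_loop_in[of "m + 1" t] by simp
  qed
  have k_le: "norm (g p) \<le> norm p" if p: "p \<in> earring" for p
  proof (cases "p = 0")
    case False
    have "((fst p)\<^sup>2 + (snd p)\<^sup>2) / (2 * fst p) \<ge> 0"
      using fst_pos[OF p False] by simp
    then have "\<bar>k p\<bar> \<le> 1"
      unfolding k_def by (simp add: divide_le_eq_1)
    then show ?thesis
      by (simp add: g_def mult_left_le_one_le)
  qed (simp add: g_def)
  have "continuous_on earring g"
    unfolding continuous_on_eq_continuous_within
  proof
    fix p assume p: "p \<in> earring"
    show "continuous (at p within earring) g"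
    proof (cases "p = 0")
      case True
      have "((\<lambda>q. norm q) \<longlongrightarrow> 0) (at (0 :: real \<times> real) within earring)"
        using tendsto_norm[OF tendsto_ident_at, of "0 :: real \<times> real" earring] by simp
      moreover have "\<forall>\<^sub>F q in at 0 within earring. norm (g q) \<le> norm q"
        unfolding eventually_at by (intro exI[of _ 1]) (simp add: k_le)
      ultimately have "(g \<longlongrightarrow> 0) (at 0 within earring)"
        by (rule Lim_null_comparison[rotated])
      then show ?thesis
        using True by (simp add: continuous_within g_def)
    next
      case False
      have f: "fst p > 0" by (rule fst_pos[OF p False])
      then have "1 + ((fst p)\<^sup>2 + (snd p)\<^sup>2) / (2 * fst p) > 0"
        by (simp add: add_pos_nonneg)
      with f show ?thesis
        unfolding g_def k_def continuous_within
        by (intro tendsto_intros) auto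
    qed
  qed
  with maps shift have "is_earring_shift g"
    by (auto simp: is_earring_shift_def)
  then show ?thesis by blast
qed

lemma earring_shift_ex1: "\<exists>!g. g \<in> extensional earring \<and> is_earring_shift g"
proof -
  obtain g where g: "is_earring_shift g"
    using earring_shift_exists by blast
  have "is_earring_shift (restrict g earring)"
    using g earring_loop_in unfolding is_earring_shift_def
    by (auto simp: continuous_on_restrict image_subset_iff)
  moreover have "h = h'"
    if h: "h \<in> extensional earring" "is_earring_shift h"
      and h': "h' \<in> extensional earring" "is_earring_shift h'" for h h'
  proof (rule extensionalityI[OF h(1) h'(1)])
    fix p assume "p \<in> earring"
    then show "h p = h' p"
      using earring_loop_surj h(2) h'(2) unfolding is_earring_shift_def by metis
  qed
  ultimately show ?thesis
    by (metis restrict_extensional)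
qed

lemma is_earring_shift_earring_shift: "is_earring_shift earring_shift"
  using theI'[OF earring_shift_ex1] by (simp add: earring_shift_def)

definition earring_telescope :: "(int \<times> (real \<times> real) \<times> real) set topology" where
  "earring_telescope = mapping_telescope (\<lambda>_. earring_top) (\<lambda>_. earring_shift)"

definition earring_telescope_base :: "(int \<times> (real \<times> real) \<times> real) set" where
  "earring_telescope_base =
     telescope_proj (\<lambda>_. earring_top) (\<lambda>_. earring_shift) (0, (0, 0), 0)"

end

theory Submission
  imports Defs
begin

text \<open>
  The telescope is a union of half-infinite cylinders glued along a common line, one for each integer
  \<open>k\<close>, and collapsing all but one of them gives a coordinate with values in the unit circle.

  A universal covering evenly covers a neighbourhood of the base point, so all sufficiently small
  circles of \<open>X\<^sub>0\<close> lift to closed loops in it and hence in every covering. But each of them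
  is unwound by the infinite cyclic covering pulled back from \<open>exp\<close> along its coordinate.

  For the Spanier group, an open cover on whose members finitely many coordinates are almost constant
  shows that an element of the group has a trivial word in the free group on finitely many cylinders.
  A loop is compact, so it can be pushed into one earring, and it remains to see that a loop in the
  earring all of whose finite projections are trivial is null-homotopic. Cut it into finitely many
  passages through each circle and some negligible pieces. For every \<open>n\<close> the passages through
  the first \<open>n\<close> circles admit a non-crossing matching of inverse pairs; by compactness these can be
  chosen compatibly. A matched pair bounds a band in the triangle \<open>0 \<le> x \<le> y \<le> 1\<close> over
  whose diagonal the loop lives. The bands are disjoint because nothing crosses, and the map that runs
  through the circle across each band and is constant elsewhere is a null homotopy; it is continuous
  because the circles shrink.
\<close>

section \<open>The fundamental group of an abstract topology\<close>

text \<open>Visits to the base point cannot be counted: a loop may meet it in a Cantor set of times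
  and run through infinitely many circles in between. Passages through the antipode
  \<open>-1\<close> of one fixed circle can be counted, by uniform continuity. Words therefore
  record antipode passages, and they are read off finite samples, so that no general position is
  required of the path.

  Null homotopies of the finite projections alone are of no use, since those for different
  \<open>n\<close> are unrelated and need not converge. A cancellation of a word, however, is one of
  finitely many combinatorial objects at each level. It is recorded as a set of pairs
  (\<open>perfect_matching\<close>) and not as a sequence of reductions: sets of pairs restrict to
  lower levels and make sense for infinitely many events. The homotopy is built only once, from the
  limit pairing.

  Points of the earring are handled through coordinates, one per circle. In them the bonding map is
  a mere shift of the index, which is why coordinates of the telescope are indexed by
  integers.\<close>

lemma path_homotopic_iff:
  "path_homotopic X p q \<longleftrightarrow>
    (\<exists>h. continuous_map (top_of_set ({0..1::real} \<times> {0..1::real})) X h \<and>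
       (\<forall>t\<in>{0..1}. h (0, t) = p t) \<and> (\<forall>t\<in>{0..1}. h (1, t) = q t) \<and>
       (\<forall>s\<in>{0..1}. h (s, 0) = p 0 \<and> h (s, 1) = p 1))"
  unfolding path_homotopic_def by (subst homotopic_with) simp_all

lemma path_homotopic_imp:
  assumes "path_homotopic X p q"
  shows "pathin X p" "pathin X q" "q 0 = p 0" "q 1 = p 1"
  using homotopic_with_imp_continuous_maps[OF assms[unfolded path_homotopic_def]]
    homotopic_with_imp_property[OF assms[unfolded path_homotopic_def]]
  by (auto simp: pathin_def)

lemma path_homotopic_refl: "pathin X p \<Longrightarrow> path_homotopic X p p"
  unfolding path_homotopic_def pathin_def by (simp add: homotopic_with_refl)

lemma path_homotopic_sym: "path_homotopic X p q \<Longrightarrow> path_homotopic X q p"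
  using path_homotopic_imp[of X p q]
  unfolding path_homotopic_def by (simp add: homotopic_with_sym)

lemma path_homotopic_trans [trans]:
  "path_homotopic X p q \<Longrightarrow> path_homotopic X q r \<Longrightarrow> path_homotopic X p r"
  using path_homotopic_imp(3,4)[of X p q] homotopic_with_trans
  unfolding path_homotopic_def by fastforce

lemma path_homotopic_eq:
  assumes "pathin X p" "\<And>t. t \<in> {0..1} \<Longrightarrow> p t = q t"
  shows "path_homotopic X p q"
  unfolding path_homotopic_def
  by (rule homotopic_with_equal) (use assms in \<open>auto simp: pathin_def\<close>)

text \<open>The straight-line homotopy in the convex set, pushed forward by \<open>F\<close>. With
  \<open>F\<close> a path it yields the reparametrisations below; with \<open>F\<close> a map of a
  square it lets a path slide from one edge over the others.\<close>

lemma path_homotopic_convex: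
  fixes S :: "'b::real_normed_vector set"
  assumes "convex S" and F: "continuous_map (top_of_set S) X F"
    and u: "continuous_on {0..1} u" "u ` {0..1} \<subseteq> S"
    and v: "continuous_on {0..1} v" "v ` {0..1} \<subseteq> S"
    and ends: "u 0 = v 0" "u 1 = v 1"
  shows "path_homotopic X (F \<circ> u) (F \<circ> v)"
proof -
  define g where "g = (\<lambda>z. (1 - fst z) *\<^sub>R u (snd z) + fst z *\<^sub>R v (snd z))"
  have "continuous_on ({0..1} \<times> {0..1}) g"
    unfolding g_def
    by (intro continuous_intros continuous_on_compose2[OF u(1)] continuous_on_compose2[OF v(1)]) auto
  moreover have "g z \<in> S" if "z \<in> {0..1} \<times> {0..1}" for z
    using that u(2) v(2) by (auto simp: g_def intro!: convexD_alt[OF \<open>convex S\<close>])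
  ultimately have "continuous_map (top_of_set ({0..1::real} \<times> {0..1::real})) (top_of_set S) g"
    by (auto simp: image_subset_iff)
  then have 1: "continuous_map (top_of_set ({0..1::real} \<times> {0..1::real})) X (F \<circ> g)"
    using F by (rule continuous_map_compose)
  have 2: "g (0, t) = u t" "g (1, t) = v t" for t
    by (auto simp: g_def)
  have 3: "g (s, 0) = u 0" "g (s, 1) = u 1" for s
    by (auto simp: g_def simp flip: ends scaleR_add_left)
  show ?thesis
    unfolding path_homotopic_iff by (rule exI[of _ "F \<circ> g"]) (simp add: 1 2 3)
qed

lemma path_homotopic_reparam:
  assumes "pathin X p"
    and "continuous_on {0..1} u" "u ` {0..1} \<subseteq> {0..1}"
    and "continuous_on {0..1} v" "v ` {0..1} \<subseteq> {0..1}"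
    and "u 0 = v 0" "u 1 = v 1"
  shows "path_homotopic X (p \<circ> u) (p \<circ> v)"
  using assms by (intro path_homotopic_convex[of "{0..1}"]) (auto simp: pathin_def)

lemma path_join_ends [simp]: "path_join p q 0 = p 0" "path_join p q 1 = q 1"
  by (auto simp: path_join_def)

lemma path_reverse_ends [simp]: "path_reverse p 0 = p 1" "path_reverse p 1 = p 0"
  by (auto simp: path_reverse_def)

lemma pathin_reverse: "pathin X p \<Longrightarrow> pathin X (path_reverse p)"
proof -
  assume p: "pathin X p"
  have "continuous_map (top_of_set {0..1}) (top_of_set {0..1}) (\<lambda>t::real. 1 - t)"
    by (auto intro!: continuous_intros)
  from continuous_map_compose[OF this p[unfolded pathin_def]] show ?thesis
    by (simp add: pathin_def path_reverse_def o_def)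
qed

lemma path_homotopic_join:
  assumes "path_homotopic X p p'" "path_homotopic X q q'" "p 1 = q 0"
  shows "path_homotopic X (path_join p q) (path_join p' q')"
proof -
  let ?I = "{0..1::real} \<times> {0..1::real}"
  obtain h where h: "continuous_map (top_of_set ?I) X h"
    "\<And>t. t\<in>{0..1} \<Longrightarrow> h (0, t) = p t" "\<And>t. t\<in>{0..1} \<Longrightarrow> h (1, t) = p' t"
    "\<And>s. s\<in>{0..1} \<Longrightarrow> h (s, 0) = p 0 \<and> h (s, 1) = p 1"
    using assms(1) unfolding path_homotopic_iff by blast
  obtain k where k: "continuous_map (top_of_set ?I) X k"
    "\<And>t. t\<in>{0..1} \<Longrightarrow> k (0, t) = q t" "\<And>t. t\<in>{0..1} \<Longrightarrow> k (1, t) = q' t"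
    "\<And>s. s\<in>{0..1} \<Longrightarrow> k (s, 0) = q 0 \<and> k (s, 1) = q 1"
    using assms(2) unfolding path_homotopic_iff by blast
  let ?H = "\<lambda>z. if snd z \<le> 1/2 then (h \<circ> (\<lambda>z. (fst z, 2 * snd z))) z
                 else (k \<circ> (\<lambda>z. (fst z, 2 * snd z - 1))) z"
  have eq: "subtopology (top_of_set ?I) {z \<in> topspace (top_of_set ?I). P z} =
      top_of_set (?I \<inter> {z. P z})" for P
    by (auto simp: subtopology_subtopology intro!: arg_cong[where f = top_of_set])
  have "continuous_map (top_of_set ?I) X ?H"
  proof (rule continuous_map_cases_le)
    have "continuous_map (top_of_set (?I \<inter> {z. snd z \<le> 1/2})) (top_of_set ?I) (\<lambda>z. (fst z, 2 * snd z))"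
      by (auto intro!: continuous_intros)
    then show "continuous_map (subtopology (top_of_set ?I) {z \<in> topspace (top_of_set ?I). snd z \<le> 1/2})
        X (h \<circ> (\<lambda>z. (fst z, 2 * snd z)))"
      by (subst eq) (rule continuous_map_compose[OF _ h(1)])
    have "continuous_map (top_of_set (?I \<inter> {z. 1/2 \<le> snd z})) (top_of_set ?I) (\<lambda>z. (fst z, 2 * snd z - 1))"
      by (auto intro!: continuous_intros)
    then show "continuous_map (subtopology (top_of_set ?I) {z \<in> topspace (top_of_set ?I). 1/2 \<le> snd z})
        X (k \<circ> (\<lambda>z. (fst z, 2 * snd z - 1)))"
      by (subst eq) (rule continuous_map_compose[OF _ k(1)])
    show "(h \<circ> (\<lambda>z. (fst z, 2 * snd z))) z = (k \<circ> (\<lambda>z. (fst z, 2 * snd z - 1))) z"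
      if "z \<in> topspace (top_of_set ?I)" "snd z = 1/2" for z
      using that h(4)[of "fst z"] k(4)[of "fst z"] assms(3) by (cases z) (auto simp: field_simps)
  qed (auto intro!: continuous_intros)
  then show ?thesis
    unfolding path_homotopic_iff
    by (intro exI[of _ ?H]) (use h k in \<open>auto simp: path_join_def\<close>)
qed

lemma pathin_join: "pathin X p \<Longrightarrow> pathin X q \<Longrightarrow> p 1 = q 0 \<Longrightarrow> pathin X (path_join p q)"
  by (meson path_homotopic_imp(1) path_homotopic_join path_homotopic_refl)

lemma path_homotopic_assoc:
  assumes "pathin X p" "pathin X q" "pathin X r" "p 1 = q 0" "q 1 = r 0"
  shows "path_homotopic X (path_join (path_join p q) r) (path_join p (path_join q r))"
proof -
  let ?P = "path_join (path_join p q) r"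
  define u :: "real \<Rightarrow> real" where "u = (\<lambda>t. min (t / 2) (max (t - 1/4) 0)) "
  \<comment> \<open>Piecewise linear with slopes 1/2, 1, 2 on [0, 1/2], [1/2, 3/4], [3/4, 1]. The
    slopes increase, so it is the maximum of its three affine pieces, which makes continuity
    immediate.\<close>
  define v :: "real \<Rightarrow> real" where "v = (\<lambda>t. max (t / 2) (max (t - 1/4) (2 * t - 1)))"
  have v: "t \<le> 1/2 \<Longrightarrow> v t = t / 2" "1/2 \<le> t \<Longrightarrow> t \<le> 3/4 \<Longrightarrow> v t = t - 1/4"
     "3/4 \<le> t \<Longrightarrow> v t = 2 * t - 1" for t
    by (auto simp: v_def max_def)
  have v01: "v t \<in> {0..1}" if "t \<in> {0..1}" for t using that by (auto simp: v_def max_def)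
  have P: "pathin X ?P" by (intro pathin_join) (use assms in auto)
  have "continuous_on {0..1} v"
    unfolding v_def by (intro continuous_intros) auto
  then have "path_homotopic X (?P \<circ> id) (?P \<circ> v)"
    by (intro path_homotopic_reparam[OF P]) (use v01 in \<open>simp_all add: image_subset_iff v continuous_on_id'\<close>)
  moreover have "(?P \<circ> v) t = path_join p (path_join q r) t" for t
  proof -
    consider "t \<le> 1/2" | "1/2 < t" "t \<le> 3/4" | "3/4 < t" by linarith
    then show ?thesis
      by cases (auto simp: v path_join_def algebra_simps)
  qed
  ultimately show ?thesis
    by (metis comp_id ext)
qed

lemma path_homotopic_const_join:
  assumes "pathin X p"
  shows "path_homotopic X (path_join (\<lambda>_. p 0) p) p"
proof -
  have "path_homotopic X (p \<circ> (\<lambda>t. max 0 (2 * t - 1))) (p \<circ> id)"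
    by (rule path_homotopic_reparam[OF assms]) (auto intro!: continuous_intros)
  moreover have "(p \<circ> (\<lambda>t. max 0 (2 * t - 1))) t = path_join (\<lambda>_. p 0) p t" for t
  proof (cases "t = 1/2")
    case True
    show ?thesis unfolding True by (simp add: path_join_def)
  qed (auto simp: path_join_def max_def)
  ultimately show ?thesis
    by (metis comp_id ext)
qed

lemma path_homotopic_reverse_join:
  assumes "pathin X p"
  shows "path_homotopic X (path_join (path_reverse p) p) (\<lambda>_. p 1)"
proof -
  \<comment> \<open>The reparametrisation is the absolute value of \<open>2 * t - 1\<close>: it runs
    from 1 to 0 and back, and in the interval it contracts to its end point 1.\<close>
  have "path_homotopic X (p \<circ> (\<lambda>t. max (1 - 2 * t) (2 * t - 1))) (p \<circ> (\<lambda>t. 1))"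
    by (rule path_homotopic_reparam[OF assms]) (auto intro!: continuous_intros)
  moreover have "(p \<circ> (\<lambda>t. max (1 - 2 * t) (2 * t - 1))) t = path_join (path_reverse p) p t" for t
  proof (cases "t = 1/2")
    case True
    show ?thesis unfolding True by (simp add: path_join_def path_reverse_def)
  qed (auto simp: path_join_def path_reverse_def max_def)
  ultimately show ?thesis
    by (metis (no_types, lifting) comp_apply ext)
qed

lemma path_class_eq_iff: "pathin X p \<Longrightarrow> path_class X p = path_class X q \<longleftrightarrow> path_homotopic X p q"
  unfolding path_class_def
  by (auto dest: path_homotopic_trans path_homotopic_sym intro: path_homotopic_refl)

lemma loopin_join: "loopin X x p \<Longrightarrow> loopin X x q \<Longrightarrow> loopin X x (path_join p q)"
  by (auto simp: loopin_def pathin_join)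

lemma loopin_reverse: "loopin X x p \<Longrightarrow> loopin X x (path_reverse p)"
  by (auto simp: loopin_def pathin_reverse)

lemma mult_path_class:
  assumes "loopin X x p" "loopin X x q"
  shows "path_class X p \<otimes>\<^bsub>fundamental_group X x\<^esub> path_class X q = path_class X (path_join p q)"
proof -
  have "path_class X (path_join p' q') = path_class X (path_join p q)"
    if "path_homotopic X p p'" "path_homotopic X q q'" for p' q'
  proof (subst path_class_eq_iff)
    show "path_homotopic X (path_join p' q') (path_join p q)"
      using path_homotopic_join that assms path_homotopic_sym unfolding loopin_def by metis
    then show "pathin X (path_join p' q')" by (rule path_homotopic_imp)
  qed
  moreover have "path_homotopic X p p" "path_homotopic X q q"
    using assms by (auto simp: loopin_def path_homotopic_refl)
  ultimately show ?thesis
    unfolding fundamental_group_def path_class_def[of X p] path_class_def[of X q] monoid.simps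
    by blast
qed

lemma carrier_fundamental_group: "carrier (fundamental_group X x) = path_class X ` {p. loopin X x p}"
  and one_fundamental_group: "\<one>\<^bsub>fundamental_group X x\<^esub> = path_class X (\<lambda>_. x)"
  by (auto simp: fundamental_group_def)

lemma group_fundamental_group:
  assumes "x \<in> topspace X"
  shows "group (fundamental_group X x)"
proof (rule groupI)
  let ?G = "fundamental_group X x"
  note c = carrier_fundamental_group one_fundamental_group
  have loop_const: "loopin X x (\<lambda>_. x)" using assms by (simp add: loopin_def)
  show "\<one>\<^bsub>?G\<^esub> \<in> carrier ?G" using loop_const by (auto simp: c)
  show "a \<otimes>\<^bsub>?G\<^esub> b \<in> carrier ?G" if "a \<in> carrier ?G" "b \<in> carrier ?G" for a b
    using that by (auto simp: c mult_path_class loopin_join)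
  show "a \<otimes>\<^bsub>?G\<^esub> b \<otimes>\<^bsub>?G\<^esub> d = a \<otimes>\<^bsub>?G\<^esub> (b \<otimes>\<^bsub>?G\<^esub> d)"
    if abd: "a \<in> carrier ?G" "b \<in> carrier ?G" "d \<in> carrier ?G" for a b d
  proof -
    obtain p q r where pqr: "loopin X x p" "loopin X x q" "loopin X x r"
      "a = path_class X p" "b = path_class X q" "d = path_class X r"
      using abd by (auto simp: c)
    have "path_homotopic X (path_join (path_join p q) r) (path_join p (path_join q r))"
      using pqr by (intro path_homotopic_assoc) (auto simp: loopin_def)
    then show ?thesis
      using pqr by (simp add: mult_path_class loopin_join path_class_eq_iff path_homotopic_imp)
  qed
  show "\<one>\<^bsub>?G\<^esub> \<otimes>\<^bsub>?G\<^esub> a = a" if a: "a \<in> carrier ?G" for a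
  proof -
    obtain p where p: "loopin X x p" "a = path_class X p"
      using a unfolding c by blast
    then have "path_homotopic X (path_join (\<lambda>_. x) p) p"
      using path_homotopic_const_join[of X p] by (auto simp: loopin_def)
    then show ?thesis
      using p loop_const by (simp add: c mult_path_class path_class_eq_iff path_homotopic_imp)
  qed
  show "\<exists>b\<in>carrier ?G. b \<otimes>\<^bsub>?G\<^esub> a = \<one>\<^bsub>?G\<^esub>" if a: "a \<in> carrier ?G" for a
  proof -
    obtain p where p: "loopin X x p" "a = path_class X p"
      using a unfolding c by blast
    then have "path_homotopic X (path_join (path_reverse p) p) (\<lambda>_. x)"
      using path_homotopic_reverse_join[of X p] by (auto simp: loopin_def)
    then have "path_class X (path_reverse p) \<otimes>\<^bsub>?G\<^esub> a = \<one>\<^bsub>?G\<^esub>"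
      using p by (simp add: c mult_path_class loopin_reverse path_class_eq_iff path_homotopic_imp)
    moreover have "path_class X (path_reverse p) \<in> carrier ?G"
      using p loopin_reverse[of X x p] unfolding c by blast
    ultimately show ?thesis ..
  qed
qed

lemma inv_path_class:
  assumes "loopin X x p"
  shows "inv\<^bsub>fundamental_group X x\<^esub> path_class X p = path_class X (path_reverse p)"
proof (rule group.inv_equality)
  show "group (fundamental_group X x)"
    using assms by (intro group_fundamental_group) (auto simp: loopin_def dest: path_start_in_topspace)
  have "path_homotopic X (path_join (path_reverse p) p) (\<lambda>_. x)"
    using path_homotopic_reverse_join[of X p] assms by (auto simp: loopin_def)
  then show "path_class X (path_reverse p) \<otimes>\<^bsub>fundamental_group X x\<^esub> path_class X p =
      \<one>\<^bsub>fundamental_group X x\<^esub>"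
    using assms
    by (simp add: one_fundamental_group mult_path_class loopin_reverse path_class_eq_iff path_homotopic_imp)
qed (use assms loopin_reverse[OF assms] in \<open>auto simp: carrier_fundamental_group\<close>)

section \<open>Free reduction of words\<close>

type_synonym letter = "nat \<times> bool"

definition letter_inv :: "letter \<Rightarrow> letter" where
  "letter_inv a = (fst a, \<not> snd a)"

lemma letter_inv_inv [simp]: "letter_inv (letter_inv a) = a"
  and fst_letter_inv [simp]: "fst (letter_inv a) = fst a"
  and letter_inv_neq [simp]: "letter_inv a \<noteq> a" "a \<noteq> letter_inv a"
  by (auto simp: letter_inv_def prod_eq_iff)

text \<open>Reduced words are represented as stacks: the last letter of the word is the head of the list.\<close>

fun push :: "letter \<Rightarrow> letter list \<Rightarrow> letter list" where
  "push a [] = [a]"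
| "push a (b # s) = (if b = letter_inv a then s else a # b # s)"

fun reduced :: "letter list \<Rightarrow> bool" where
  "reduced (a # b # s) \<longleftrightarrow> b \<noteq> letter_inv a \<and> reduced (b # s)"
| "reduced _ \<longleftrightarrow> True"

lemma reduced_Cons: "reduced (a # s) \<Longrightarrow> reduced s"
  by (cases s) auto

lemma reduced_push: "reduced s \<Longrightarrow> reduced (push a s)"
  by (cases s) (auto dest: reduced_Cons)

lemma reduced_fold_push: "reduced s \<Longrightarrow> reduced (fold push w s)"
  by (induction w arbitrary: s) (auto intro: reduced_push)

text \<open>A letter acts on reduced stacks as a permutation, inverse to that of its inverse letter.
  Reducedness matters: on \<open>[letter_inv a, a]\<close>, pushing \<open>a\<close> uncovers
  another \<open>a\<close>, which the second push then removes.\<close>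

lemma push_push_inv: "reduced s \<Longrightarrow> push (letter_inv a) (push a s) = s"
  by (cases s rule: reduced.cases) auto

text \<open>Equality in the free group, expressed by van der Waerden's action on reduced words. It
  is a congruence almost by definition, and evaluation at the empty stack tells whether a word
  cancels completely.\<close>

definition word_eq :: "letter list \<Rightarrow> letter list \<Rightarrow> bool" where
  "word_eq u v \<longleftrightarrow> (\<forall>s. reduced s \<longrightarrow> fold push u s = fold push v s)"

lemma word_eq_refl [simp]: "word_eq u u"
  and word_eq_sym: "word_eq u v \<Longrightarrow> word_eq v u"
  and word_eq_trans [trans]: "word_eq u v \<Longrightarrow> word_eq v w \<Longrightarrow> word_eq u w"
  by (auto simp: word_eq_def)

lemma word_eq_append: "word_eq u u' \<Longrightarrow> word_eq v v' \<Longrightarrow> word_eq (u @ v) (u' @ v')"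
  by (auto simp: word_eq_def reduced_fold_push)

lemma word_eq_cancel: "word_eq [a, letter_inv a] []"
  by (auto simp: word_eq_def push_push_inv)

text \<open>A reduced word meets no cancellation and ends up reversed on the stack. Hence a nonempty
  word that evaluates to the empty stack is not reduced and contains an adjacent inverse
  pair.\<close>

lemma fold_push_reduced:
  "reduced w \<Longrightarrow> w = [] \<or> s = [] \<or> hd s \<noteq> letter_inv (hd w) \<Longrightarrow> fold push w s = rev w @ s"
proof (induction w arbitrary: s)
  case (Cons a w)
  have "push a s = a # s"
    using Cons.prems(2) by (cases s) auto
  moreover have "w = [] \<or> hd (a # s) \<noteq> letter_inv (hd w)"
    using Cons.prems(1) by (cases w) auto
  ultimately show ?case
    using Cons.IH[of "a # s"] Cons.prems(1) reduced_Cons by auto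
qed auto

lemma not_reduced_obtains:
  assumes "\<not> reduced w"
  obtains u a v where "w = u @ [a, letter_inv a] @ v"
  using assms
proof (induction w arbitrary: thesis rule: reduced.induct)
  case (1 a b s)
  show ?case
  proof (cases "b = letter_inv a")
    case True
    then show ?thesis using 1(2)[of "[]" a s] by simp
  next
    case False
    then have "\<not> reduced (b # s)" using 1(3) by simp
    then obtain u c v where "b # s = u @ [c, letter_inv c] @ v"
      using 1(1) False by blast
    then show ?thesis using 1(2)[of "a # u" c v] by simp
  qed
qed auto

section \<open>Non-crossing matchings of inverse letters\<close>

definition perfect_matching ::
    "('e \<Rightarrow> real) \<Rightarrow> ('e \<Rightarrow> letter) \<Rightarrow> 'e set \<Rightarrow> ('e \<times> 'e) set \<Rightarrow> bool" where
  "perfect_matching \<tau> l A M \<longleftrightarrow> M \<subseteq> A \<times> A \<and>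
     (\<forall>(a, b)\<in>M. \<tau> a < \<tau> b \<and> l b = letter_inv (l a)) \<and>
     (\<forall>a\<in>A. \<exists>!p. p \<in> M \<and> (a = fst p \<or> a = snd p)) \<and>
     (\<forall>(a, b)\<in>M. \<forall>(c, d)\<in>M. \<not> (\<tau> a < \<tau> c \<and> \<tau> c < \<tau> b \<and> \<tau> b < \<tau> d))"

lemma perfect_matchingD:
  assumes "perfect_matching \<tau> l A M"
  shows "(a, b) \<in> M \<Longrightarrow> a \<in> A" "(a, b) \<in> M \<Longrightarrow> b \<in> A"
    "(a, b) \<in> M \<Longrightarrow> \<tau> a < \<tau> b" "(a, b) \<in> M \<Longrightarrow> l b = letter_inv (l a)"
    "a \<in> A \<Longrightarrow> \<exists>!p. p \<in> M \<and> (a = fst p \<or> a = snd p)"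
    "(a, b) \<in> M \<Longrightarrow> (c, d) \<in> M \<Longrightarrow> \<tau> a < \<tau> c \<Longrightarrow> \<tau> c < \<tau> b \<Longrightarrow> \<not> \<tau> b < \<tau> d"
  using assms unfolding perfect_matching_def by blast+

lemma perfect_matchingI:
  assumes "\<And>a b. (a, b) \<in> M \<Longrightarrow> a \<in> A \<and> b \<in> A \<and> \<tau> a < \<tau> b \<and> l b = letter_inv (l a)"
    and "\<And>a. a \<in> A \<Longrightarrow> \<exists>!p. p \<in> M \<and> (a = fst p \<or> a = snd p)"
    and "\<And>a b c d. (a, b) \<in> M \<Longrightarrow> (c, d) \<in> M \<Longrightarrow> \<tau> a < \<tau> c \<Longrightarrow> \<tau> c < \<tau> b \<Longrightarrow> \<not> \<tau> b < \<tau> d"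
  shows "perfect_matching \<tau> l A M"
  unfolding perfect_matching_def
proof (intro conjI ballI)
  show "M \<subseteq> A \<times> A" using assms(1) by auto
  show "case p of (a, b) \<Rightarrow> \<tau> a < \<tau> b \<and> l b = letter_inv (l a)" if "p \<in> M" for p
    using assms(1) that by (cases p) auto
  show "case p of (a, b) \<Rightarrow> \<forall>(c, d)\<in>M. \<not> (\<tau> a < \<tau> c \<and> \<tau> c < \<tau> b \<and> \<tau> b < \<tau> d)" if "p \<in> M" for p
    using assms(3) that by (cases p) blast
qed (rule assms(2))

text \<open>A pair of \<open>M\<close> that crossed the new one would need an end strictly between
  \<open>a\<close> and \<open>b\<close>, and \<open>out\<close> leaves no event there.\<close>

lemma perfect_matching_insert:
  assumes M: "perfect_matching \<tau> l A M" and ab: "\<tau> a < \<tau> b" "l b = letter_inv (l a)"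
    and out: "\<And>c. c \<in> A \<Longrightarrow> \<tau> c < \<tau> a \<or> \<tau> b < \<tau> c"
  shows "perfect_matching \<tau> l (insert a (insert b A)) (insert (a, b) M)"
proof -
  have notin: "a \<notin> A" "b \<notin> A" using out[of a] out[of b] ab(1) by auto
  note D = perfect_matchingD[OF M]
  show ?thesis
  proof (rule perfect_matchingI)
    fix c assume c: "c \<in> insert a (insert b A)"
    show "\<exists>!p. p \<in> insert (a, b) M \<and> (c = fst p \<or> c = snd p)"
    proof (cases "c \<in> A")
      case True
      then have "c \<noteq> a" "c \<noteq> b" using notin by auto
      then have "p \<in> insert (a, b) M \<and> (c = fst p \<or> c = snd p) \<longleftrightarrow> p \<in> M \<and> (c = fst p \<or> c = snd p)" for p
        by auto
      then show ?thesis using D(5)[OF True] by simp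
    next
      case False
      then have "p \<notin> M" if "c = fst p \<or> c = snd p" for p
        using D(1,2)[of "fst p" "snd p"] that by auto
      moreover have "c = a \<or> c = b" using False c by auto
      ultimately show ?thesis
        by (intro ex1I[of _ "(a, b)"]) auto
    qed
  next
    fix c d e f
    assume *: "(c, d) \<in> insert (a, b) M" "(e, f) \<in> insert (a, b) M" "\<tau> c < \<tau> e" "\<tau> e < \<tau> d"
    show "\<not> \<tau> d < \<tau> f"
    proof (cases "(c, d) \<in> M")
      case True
      then show ?thesis using * D(6)[of c d e f] out[OF D(2)[of c d]] by fastforce
    next
      case False
      then show ?thesis using * out[OF D(1)[of e f]] by auto
    qed
  qed (use D ab in auto)
qed

text \<open>Induction on the number of events: two adjacent events with inverse letters are matched; no other
  event lies between them in time, so this pair crosses no other one.\<close>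

lemma perfect_matching_exists:
  assumes "sorted_wrt (\<lambda>a b. \<tau> a < \<tau> b) es" "fold push (map l es) [] = []"
  shows "\<exists>M. perfect_matching \<tau> l (set es) M"
  using assms
proof (induction "length es" arbitrary: es rule: less_induct)
  case less
  show ?case
  proof (cases "es = []")
    case True
    then show ?thesis by (intro exI[of _ "{}"]) (simp add: perfect_matching_def)
  next
    case False
    have "\<not> reduced (map l es)"
      using less.prems(2) False fold_push_reduced[of "map l es" "[]"] by auto
    then obtain u x v where "map l es = u @ [x, letter_inv x] @ v"
      by (rule not_reduced_obtains)
    then obtain us ws where "es = us @ ws" "map l us = u" and ws: "map l ws = x # letter_inv x # v"
      by (auto simp: map_eq_append_conv simp del: split_paired_Ex)
    moreover obtain a b vs where "ws = a # b # vs" "map l vs = v" "l a = x" "l b = letter_inv x"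
      using ws by (cases ws; cases "tl ws") auto
    ultimately have es: "es = us @ [a, b] @ vs" "map l us = u" "map l vs = v"
        "l a = x" "l b = letter_inv x"
      by auto
    have "fold push [x, letter_inv x] (fold push u []) = fold push u []"
      using word_eq_cancel[of x] reduced_fold_push[of "[]" u] by (simp add: word_eq_def)
    then have "fold push (map l (us @ vs)) [] = []"
      using less.prems(2) es by simp
    moreover have "sorted_wrt (\<lambda>a b. \<tau> a < \<tau> b) (us @ vs)" and ord: "\<tau> a < \<tau> b"
        "\<And>c. c \<in> set us \<Longrightarrow> \<tau> c < \<tau> a" "\<And>c. c \<in> set vs \<Longrightarrow> \<tau> b < \<tau> c"
      using less.prems(1) es by (auto simp: sorted_wrt_append)
    ultimately obtain M where "perfect_matching \<tau> l (set (us @ vs)) M"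
      using less.hyps[of "us @ vs"] es by auto
    then have "perfect_matching \<tau> l (insert a (insert b (set (us @ vs)))) (insert (a, b) M)"
      using ord es by (intro perfect_matching_insert) auto
    moreover have "insert a (insert b (set (us @ vs))) = set es" using es by auto
    ultimately show ?thesis by auto
  qed
qed

text \<open>Inverse letters name the same circle, so a set of events that is a union of whole
  circles contains the partner of each of its members.\<close>

lemma perfect_matching_restrict:
  assumes M: "perfect_matching \<tau> l A M"
    and B: "B \<subseteq> A" "\<And>a b. a \<in> A \<Longrightarrow> b \<in> A \<Longrightarrow> fst (l a) = fst (l b) \<Longrightarrow> a \<in> B \<longleftrightarrow> b \<in> B"
  shows "perfect_matching \<tau> l B (M \<inter> B \<times> B)"
proof -
  note D = perfect_matchingD[OF M]
  have iff: "a \<in> B \<longleftrightarrow> b \<in> B" if "(a, b) \<in> M" for a b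
    using B(2)[OF D(1)[OF that] D(2)[OF that]] D(4)[OF that] by simp
  show ?thesis
  proof (rule perfect_matchingI)
    fix a assume a: "a \<in> B"
    have "p \<in> M \<inter> B \<times> B \<and> (a = fst p \<or> a = snd p) \<longleftrightarrow> p \<in> M \<and> (a = fst p \<or> a = snd p)" for p
      using iff[of "fst p" "snd p"] a by (cases p) auto
    then show "\<exists>!p. p \<in> M \<inter> B \<times> B \<and> (a = fst p \<or> a = snd p)"
      using D(5)[of a] a B(1) by auto
  qed (use D in auto)
qed

section \<open>The crossing cocycle\<close>

definition unit_pt :: "nat \<Rightarrow> (nat \<Rightarrow> complex) \<Rightarrow> bool" where
  "unit_pt n x \<longleftrightarrow> (\<forall>m\<in>{1..n}. cmod (x m) = 1) \<and>
     (\<forall>m\<in>{1..n}. \<forall>m'\<in>{1..n}. Re (x m) < 0 \<and> Re (x m') < 0 \<longrightarrow> m = m')"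

definition close_pt :: "nat \<Rightarrow> (nat \<Rightarrow> complex) \<Rightarrow> (nat \<Rightarrow> complex) \<Rightarrow> bool" where
  "close_pt n x y \<longleftrightarrow> (\<forall>m\<in>{1..n}. cmod (x m - y m) < 1/2)"

lemma close_pt_refl [simp]: "close_pt n x x"
  and close_pt_sym: "close_pt n x y \<Longrightarrow> close_pt n y x"
  by (auto simp: close_pt_def norm_minus_commute)

text \<open>A point \<open>x\<close> stands for the coordinates \<open>x m\<close>, \<open>m \<ge> 1\<close>, on the unit circle, of which at most one
  is not the base point \<open>1\<close>. A letter is emitted when a coordinate passes the antipode \<open>-1\<close>. The letter
  is a cocycle on close points, which makes the word of a path a homotopy invariant.\<close>

definition crosses_at :: "(nat \<Rightarrow> complex) \<Rightarrow> (nat \<Rightarrow> complex) \<Rightarrow> nat \<Rightarrow> bool" where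
  "crosses_at x y m \<longleftrightarrow> Re (x m) < 0 \<and> Re (y m) < 0 \<and> (Im (x m) > 0) \<noteq> (Im (y m) > 0)"

text \<open>If \<open>x\<close> is a \<open>unit_pt\<close>, at most one index qualifies, so the
  choice is determined. The flag \<open>True\<close> means that the antipode is passed
  counterclockwise, from above the real axis.\<close>

definition crossing :: "nat \<Rightarrow> (nat \<Rightarrow> complex) \<Rightarrow> (nat \<Rightarrow> complex) \<Rightarrow> letter list" where
  "crossing n x y = (if \<exists>m\<in>{1..n}. crosses_at x y m
     then [let m = (SOME m. m \<in> {1..n} \<and> crosses_at x y m) in (m, Im (x m) > 0)] else [])"

lemma crossing_none: "(\<And>m. m \<in> {1..n} \<Longrightarrow> \<not> crosses_at x y m) \<Longrightarrow> crossing n x y = []"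
  by (auto simp: crossing_def)

lemma crossing_eq:
  assumes "unit_pt n x" "m \<in> {1..n}" "Re (x m) < 0" "Re (y m) < 0"
  shows "crossing n x y = (if (Im (x m) > 0) \<noteq> (Im (y m) > 0) then [(m, Im (x m) > 0)] else [])"
proof -
  have *: "m' = m" if "m' \<in> {1..n}" "crosses_at x y m'" for m'
    using assms that unfolding unit_pt_def crosses_at_def by blast
  show ?thesis
  proof (cases "crosses_at x y m")
    case True
    then have "(SOME m. m \<in> {1..n} \<and> crosses_at x y m) = m"
      using * assms(2) by (intro some_equality conjI) blast+
    moreover have "\<exists>m\<in>{1..n}. crosses_at x y m"
      using True assms(2) by blast
    ultimately have "crossing n x y = [(m, Im (x m) > 0)]"
      unfolding crossing_def Let_def by (simp only: if_True)
    then show ?thesis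
      using True by (simp add: crosses_at_def)
  next
    case False
    then have "crossing n x y = []" using * by (intro crossing_none) auto
    then show ?thesis using False assms by (auto simp: crosses_at_def)
  qed
qed

lemma crossing_refl [simp]: "crossing n x x = []"
  by (rule crossing_none) (simp add: crosses_at_def)

text \<open>Origin of the bound 1/2 in \<open>close_pt\<close>: the imaginary parts lie on different
  sides of 0 and differ by less than 1/2, so the point is so near to \<open>-1\<close> that its real
  part is below -1/2. No point within 1/2 of it can leave the left half plane.\<close>

lemma crosses_at_near:
  assumes "unit_pt n x" "close_pt n x y" "close_pt n x z" "m \<in> {1..n}" "crosses_at x y m"
  shows "Re (z m) < 0"
proof -
  have "cmod (x m - y m) < 1/2" "cmod (x m - z m) < 1/2"
    using assms(2-4) unfolding close_pt_def by auto
  then have d: "\<bar>Im (x m) - Im (y m)\<bar> < 1/2" "\<bar>Re (x m) - Re (z m)\<bar> < 1/2"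
    using abs_Im_le_cmod[of "x m - y m"] abs_Re_le_cmod[of "x m - z m"] by simp_all
  then have "\<bar>Im (x m)\<bar> < 1/2"
    using assms(5) unfolding crosses_at_def by linarith
  then have "\<bar>Im (x m)\<bar>\<^sup>2 < (1/2)\<^sup>2"
    by (intro power_strict_mono) auto
  moreover have "(Re (x m))\<^sup>2 + (Im (x m))\<^sup>2 = 1"
    using assms(1,4) cmod_power2[of "x m"] unfolding unit_pt_def by (metis one_power2)
  ultimately have "(1/2)\<^sup>2 < \<bar>Re (x m)\<bar>\<^sup>2"
    unfolding power2_abs by (simp add: power_divide)
  then have "1/2 < \<bar>Re (x m)\<bar>"
    by (rule power2_less_imp_less) simp
  then show ?thesis
    using assms(5) d(2) unfolding crosses_at_def by linarith
qed

text \<open>As soon as one of the three pairs crosses at \<open>m\<close>, all three points have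
  their \<open>m\<close>-th coordinate in the left half plane. Each letter then depends only on two
  signs of imaginary parts, and the identity is a check of signs.\<close>

lemma crossing_cocycle:
  assumes pts: "unit_pt n x" "unit_pt n y" "unit_pt n z"
    and close: "close_pt n x y" "close_pt n y z" "close_pt n x z"
  shows "word_eq (crossing n x y @ crossing n y z) (crossing n x z)"
proof (cases "\<exists>m\<in>{1..n}. crosses_at x y m \<or> crosses_at y z m \<or> crosses_at x z m")
  case True
  then obtain m where m: "m \<in> {1..n}" "crosses_at x y m \<or> crosses_at y z m \<or> crosses_at x z m"
    by blast
  have "Re (x m) < 0" "Re (y m) < 0" "Re (z m) < 0"
    using m crosses_at_near[of n _ _ _ m] pts close close_pt_sym crosses_at_def by meson+
  then show ?thesis
    using word_eq_cancel[of "(m, True)"] word_eq_cancel[of "(m, False)"]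
    by (auto simp: crossing_eq[OF pts(1) m(1)] crossing_eq[OF pts(2) m(1)] letter_inv_def)
next
  case False
  then have "crossing n x y = []" "crossing n y z = []" "crossing n x z = []"
    by (blast intro: crossing_none)+
  then show ?thesis by simp
qed

section \<open>Words of discrete paths\<close>

definition path_word :: "nat \<Rightarrow> (nat \<Rightarrow> nat \<Rightarrow> complex) \<Rightarrow> nat \<Rightarrow> letter list" where
  "path_word n P k = concat (map (\<lambda>i. crossing n (P i) (P (Suc i))) [0..<k])"

lemma path_word_0 [simp]: "path_word n P 0 = []"
  and path_word_Suc: "path_word n P (Suc k) = path_word n P k @ crossing n (P k) (P (Suc k))"
  by (auto simp: path_word_def)

lemma path_word_Suc_left:
  "path_word n P (Suc k) = crossing n (P 0) (P 1) @ path_word n (\<lambda>i. P (Suc i)) k"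
  by (induction k) (auto simp: path_word_Suc)

lemma path_word_add:
  "path_word n P (j + k) = path_word n P j @ path_word n (\<lambda>i. P (j + i)) k"
  by (induction k) (auto simp: path_word_Suc)

lemma path_word_cong: "(\<And>i. i \<le> k \<Longrightarrow> P i = Q i) \<Longrightarrow> path_word n P k = path_word n Q k"
  by (auto simp: path_word_def intro!: arg_cong[where f = concat])

text \<open>A discrete homotopy between \<open>P\<close> and \<open>Q\<close>: every square is cut
  into two triangles by the diagonal from \<open>P i\<close> to \<open>Q (Suc i)\<close>, and the
  cocycle identity applies to each. This is why closeness along the diagonal is assumed.\<close>

lemma path_word_square:
  assumes "\<And>i. i \<le> k \<Longrightarrow> unit_pt n (P i) \<and> unit_pt n (Q i) \<and> close_pt n (P i) (Q i)"
    and "\<And>i. i < k \<Longrightarrow> close_pt n (P i) (P (Suc i)) \<and> close_pt n (Q i) (Q (Suc i)) \<and>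
      close_pt n (P i) (Q (Suc i))"
  shows "word_eq (path_word n P k @ crossing n (P k) (Q k)) (crossing n (P 0) (Q 0) @ path_word n Q k)"
  using assms
proof (induction k)
  case (Suc k)
  have pts: "unit_pt n (P k)" "unit_pt n (Q k)" "unit_pt n (P (Suc k))" "unit_pt n (Q (Suc k))"
    and cl: "close_pt n (P k) (Q k)" "close_pt n (P (Suc k)) (Q (Suc k))"
       "close_pt n (P k) (P (Suc k))" "close_pt n (Q k) (Q (Suc k))" "close_pt n (P k) (Q (Suc k))"
    using Suc.prems by auto
  have "word_eq (path_word n P k @ (crossing n (P k) (P (Suc k)) @ crossing n (P (Suc k)) (Q (Suc k))))
      (path_word n P k @ crossing n (P k) (Q (Suc k)))"
    by (intro word_eq_append crossing_cocycle word_eq_refl pts cl)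
  also have "word_eq \<dots> (path_word n P k @ (crossing n (P k) (Q k) @ crossing n (Q k) (Q (Suc k))))"
    by (intro word_eq_append word_eq_sym[OF crossing_cocycle] word_eq_refl pts cl)
  also have "\<dots> = (path_word n P k @ crossing n (P k) (Q k)) @ crossing n (Q k) (Q (Suc k))"
    by simp
  also have "word_eq \<dots> ((crossing n (P 0) (Q 0) @ path_word n Q k) @ crossing n (Q k) (Q (Suc k)))"
    using Suc by (intro word_eq_append[OF _ word_eq_refl]) auto
  finally show ?case by (simp add: path_word_Suc)
qed simp

lemma path_word_refine:
  assumes "\<And>i. i \<le> 2 * k \<Longrightarrow> unit_pt n (P i)"
    and "\<And>i j. i \<le> j \<Longrightarrow> j \<le> 2 * k \<Longrightarrow> j \<le> i + 2 \<Longrightarrow> close_pt n (P i) (P j)"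
  shows "word_eq (path_word n P (2 * k)) (path_word n (\<lambda>i. P (2 * i)) k)"
  using assms
proof (induction k)
  case (Suc k)
  have "word_eq (path_word n P (2 * k) @
        (crossing n (P (2 * k)) (P (Suc (2 * k))) @ crossing n (P (Suc (2 * k))) (P (Suc (Suc (2 * k))))))
      (path_word n (\<lambda>i. P (2 * i)) k @ crossing n (P (2 * k)) (P (Suc (Suc (2 * k)))))"
    using Suc.prems by (intro word_eq_append crossing_cocycle Suc.IH) auto
  then show ?case by (simp add: path_word_Suc)
qed simp

lemma path_word_small:
  assumes "\<And>i. i \<le> k \<Longrightarrow> unit_pt n (P i)" "\<And>i j. i \<le> k \<Longrightarrow> j \<le> k \<Longrightarrow> close_pt n (P i) (P j)"
  shows "word_eq (path_word n P k) (crossing n (P 0) (P k))"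
  using assms
proof (induction k)
  case (Suc k)
  have "word_eq (path_word n P k @ crossing n (P k) (P (Suc k)))
      (crossing n (P 0) (P k) @ crossing n (P k) (P (Suc k)))"
    using Suc by (intro word_eq_append) auto
  also have "word_eq \<dots> (crossing n (P 0) (P (Suc k)))"
    using Suc.prems by (intro crossing_cocycle) auto
  finally show ?case by (simp add: path_word_Suc)
qed simp

lemma crossing_inverse:
  assumes "unit_pt n x" "unit_pt n y" "close_pt n x y"
  shows "word_eq (crossing n x y @ crossing n y x) []"
  using crossing_cocycle[of n x y x] assms close_pt_sym by simp

lemma path_word_reverse:
  assumes "\<And>i. i \<le> k \<Longrightarrow> unit_pt n (P i)" "\<And>i. i < k \<Longrightarrow> close_pt n (P i) (P (Suc i))"
  shows "word_eq (path_word n P k @ path_word n (\<lambda>i. P (k - i)) k) []"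
  using assms
proof (induction k)
  case (Suc k)
  have eq: "path_word n P (Suc k) @ path_word n (\<lambda>i. P (Suc k - i)) (Suc k) =
      path_word n P k @ (crossing n (P k) (P (Suc k)) @ crossing n (P (Suc k)) (P k)) @
      path_word n (\<lambda>i. P (k - i)) k"
    unfolding path_word_Suc_left[of n "\<lambda>i. P (Suc k - i)"] by (simp add: path_word_Suc)
  have "word_eq \<dots> (path_word n P k @ [] @ path_word n (\<lambda>i. P (k - i)) k)"
    using Suc.prems by (intro word_eq_append crossing_inverse word_eq_refl) auto
  also have "word_eq \<dots> []"
    using Suc by simp
  finally show ?case unfolding eq .
qed simp

section \<open>Words of paths\<close>

definition coord_pt :: "(nat \<Rightarrow> complex) \<Rightarrow> bool" where
  "coord_pt x \<longleftrightarrow> (\<forall>m\<ge>1. cmod (x m) = 1) \<and> (\<forall>m\<ge>1. \<forall>m'\<ge>1. x m \<noteq> 1 \<and> x m' \<noteq> 1 \<longrightarrow> m = m')"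

text \<open>Coordinatewise continuity is enough: the earring is the part of a countable product of
  circles where at most one coordinate differs from 1 (see
  \<open>continuous_earring_pt\<close>).\<close>

definition coord_map :: "'a::topological_space set \<Rightarrow> ('a \<Rightarrow> nat \<Rightarrow> complex) \<Rightarrow> bool" where
  "coord_map S p \<longleftrightarrow> (\<forall>m\<ge>1. continuous_on S (\<lambda>s. p s m)) \<and> (\<forall>s\<in>S. coord_pt (p s))"

lemma coord_pt_unit: "coord_pt x \<Longrightarrow> unit_pt n x"
proof -
  assume x: "coord_pt x"
  have "x m \<noteq> 1" if "Re (x m) < 0" for m using that by auto
  then show ?thesis
    using x unfolding coord_pt_def unit_pt_def by (metis atLeastAtMost_iff)
qed

lemma coord_map_uniform:
  fixes S :: "'a::metric_space set"
  assumes p: "coord_map S p" and "compact S"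
  obtains \<delta> where "\<delta> > 0" "\<And>s s'. s \<in> S \<Longrightarrow> s' \<in> S \<Longrightarrow> dist s s' < \<delta> \<Longrightarrow> close_pt n (p s) (p s')"
proof -
  have "\<exists>\<delta>>0. \<forall>s\<in>S. \<forall>s'\<in>S. dist s s' < \<delta> \<longrightarrow> cmod (p s m - p s' m) < 1/2" if "m \<in> {1..n}" for m
  proof -
    have "uniformly_continuous_on S (\<lambda>s. p s m)"
      using p that \<open>compact S\<close> by (intro compact_uniformly_continuous) (auto simp: coord_map_def)
    then obtain \<delta> where "\<delta> > 0" "\<And>s s'. s \<in> S \<Longrightarrow> s' \<in> S \<Longrightarrow> dist s s' < \<delta> \<Longrightarrow> dist (p s m) (p s' m) < 1/2"
      unfolding uniformly_continuous_on_def by (metis dist_commute zero_less_divide_1_iff zero_less_numeral)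
    then show ?thesis by (auto simp: dist_norm)
  qed
  then obtain d where d: "\<And>m. m \<in> {1..n} \<Longrightarrow> d m > 0"
    "\<And>m s s'. m \<in> {1..n} \<Longrightarrow> s \<in> S \<Longrightarrow> s' \<in> S \<Longrightarrow> dist s s' < d m \<Longrightarrow> cmod (p s m - p s' m) < 1/2"
    by metis
  define \<delta> where "\<delta> = Min (insert 1 (d ` {1..n}))"
  have "\<delta> > 0" using d(1) by (auto simp: \<delta>_def)
  moreover have "\<delta> \<le> d m" if "m \<in> {1..n}" for m
    unfolding \<delta>_def using that by (intro Min_le) auto
  ultimately show ?thesis
    using that[of \<delta>] d(2) unfolding close_pt_def by (meson less_le_trans)
qed

section \<open>Words on dyadic meshes\<close>

definition mesh_word :: "nat \<Rightarrow> nat \<Rightarrow> (real \<Rightarrow> nat \<Rightarrow> complex) \<Rightarrow> letter list" where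
  "mesh_word n K p = path_word n (\<lambda>i. p (real i / 2 ^ K)) (2 ^ K)"

text \<open>Only meshes with close neighbours read the path faithfully, and how fine they must be
  depends on the path; hence triviality is required from some mesh on.\<close>

definition trivial_word :: "nat \<Rightarrow> (real \<Rightarrow> nat \<Rightarrow> complex) \<Rightarrow> bool" where
  "trivial_word n p \<longleftrightarrow> (\<exists>K0. \<forall>K\<ge>K0. word_eq (mesh_word n K p) [])"

lemma mesh_pt: "i \<le> 2 ^ K \<Longrightarrow> real i / 2 ^ K \<in> {0..1}"
  by (auto simp: field_simps simp flip: of_nat_power)

lemma small_mesh:
  assumes "(\<delta>::real) > 0"
  obtains K0 where "\<And>K. K \<ge> K0 \<Longrightarrow> 2 / 2 ^ K < \<delta>"
proof -
  obtain K0 where K0: "(1/2) ^ K0 < \<delta> / 2"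
    using assms real_arch_pow_inv[of "\<delta>/2" "1/2"] by auto
  have "2 / 2 ^ K < \<delta>" if "K \<ge> K0" for K
  proof -
    have "(1/2 :: real) ^ K \<le> (1/2) ^ K0"
      using that by (intro power_decreasing) auto
    then show ?thesis using K0 by (simp add: power_divide)
  qed
  then show ?thesis using that by blast
qed

lemma mesh_close:
  assumes p: "coord_map {0..1} p"
  obtains K0 where "\<And>K i j. K \<ge> K0 \<Longrightarrow> i \<le> j \<Longrightarrow> j \<le> 2 ^ K \<Longrightarrow> j \<le> i + 2 \<Longrightarrow>
     close_pt n (p (real i / 2 ^ K)) (p (real j / 2 ^ K))"
proof -
  obtain \<delta> where \<delta>: "\<delta> > 0" "\<And>s s'. s \<in> {0..1} \<Longrightarrow> s' \<in> {0..1} \<Longrightarrow> dist s s' < \<delta> \<Longrightarrow> close_pt n (p s) (p s')"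
    using coord_map_uniform[OF p] by (metis compact_Icc)
  obtain K0 where K0: "\<And>K. K \<ge> K0 \<Longrightarrow> 2 / 2 ^ K < \<delta>"
    using small_mesh[OF \<delta>(1)] by blast
  have "close_pt n (p (real i / 2 ^ K)) (p (real j / 2 ^ K))"
    if "K \<ge> K0" "i \<le> j" "j \<le> 2 ^ K" "j \<le> i + 2" for K i j
  proof (rule \<delta>(2))
    have "dist (real i / 2 ^ K) (real j / 2 ^ K) = real (j - i) / 2 ^ K"
      using that(2) by (simp add: dist_real_def of_nat_diff divide_right_mono abs_minus_commute[of "real i / 2 ^ K"] flip: diff_divide_distrib)
    also have "\<dots> \<le> 2 / 2 ^ K"
      using that(4) by (intro divide_right_mono) auto
    finally show "dist (real i / 2 ^ K) (real j / 2 ^ K) < \<delta>"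
      using K0[OF that(1)] by linarith
  qed (use that mesh_pt in auto)
  then show ?thesis using that by blast
qed

text \<open>On a mesh that is fine for the whole square, neighbouring rows are compared by
  \<open>path_word_square\<close>. The crossings at both ends are empty because the homotopy keeps
  the end points fixed.\<close>

lemma mesh_word_homotopy:
  fixes h :: "real \<times> real \<Rightarrow> nat \<Rightarrow> complex"
  assumes h: "coord_map ({0..1} \<times> {0..1}) h"
    and ends: "\<And>s. s \<in> {0..1} \<Longrightarrow> h (s, 0) = h (0, 0)" "\<And>s. s \<in> {0..1} \<Longrightarrow> h (s, 1) = h (0, 1)"
  shows "\<exists>K0. \<forall>K\<ge>K0. word_eq (mesh_word n K (\<lambda>t. h (0, t))) (mesh_word n K (\<lambda>t. h (1, t)))"
proof -
  obtain \<delta> where \<delta>: "\<delta> > 0" "\<And>s s'. s \<in> {0..1} \<times> {0..1} \<Longrightarrow> s' \<in> {0..1} \<times> {0..1} \<Longrightarrow> dist s s' < \<delta> \<Longrightarrow>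
       close_pt n (h s) (h s')"
    using coord_map_uniform[OF h] by (metis compact_Icc compact_Times)
  obtain K0 where K0: "\<And>K. K \<ge> K0 \<Longrightarrow> 2 / 2 ^ K < \<delta>"
    using small_mesh[OF \<delta>(1)] by blast
  have "word_eq (mesh_word n K (\<lambda>t. h (0, t))) (mesh_word n K (\<lambda>t. h (1, t)))" if K: "K \<ge> K0" for K
  proof -
    define g where "g j = (\<lambda>i. h (real j / 2 ^ K, real i / 2 ^ K))" for j :: nat
    have close: "close_pt n (g j i) (g j' i')"
      if "j \<le> j'" "j' \<le> j + 1" "i \<le> i'" "i' \<le> i + 1" "j' \<le> 2 ^ K" "i' \<le> 2 ^ K" for j j' i i'
      unfolding g_def
    proof (rule \<delta>(2))
      have 1: "\<bar>real a / 2 ^ K - real b / 2 ^ K\<bar> \<le> 1 / 2 ^ K" if "a \<le> b" "b \<le> a + 1" for a b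
        using that by (auto simp: le_Suc_eq diff_divide_distrib[symmetric])
      have "dist (real j / 2 ^ K, real i / 2 ^ K) (real j' / 2 ^ K, real i' / 2 ^ K)
          \<le> \<bar>real j / 2 ^ K - real j' / 2 ^ K\<bar> + \<bar>real i / 2 ^ K - real i' / 2 ^ K\<bar>"
        by (simp add: dist_prod_def dist_real_def sqrt_sum_squares_le_sum_abs)
      also have "\<dots> \<le> 2 / 2 ^ K"
        using 1[OF that(1,2)] 1[OF that(3,4)] by simp
      finally show "dist (real j / 2 ^ K, real i / 2 ^ K) (real j' / 2 ^ K, real i' / 2 ^ K) < \<delta>"
        using K0[OF K] by linarith
    qed (use that mesh_pt in auto)
    have unit: "unit_pt n (g j i)" if "j \<le> 2 ^ K" "i \<le> 2 ^ K" for i j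
      using that h mesh_pt unfolding g_def coord_map_def by (intro coord_pt_unit) auto
    have e: "h (real a / 2 ^ K, 0) = h (0, 0)" "h (real a / 2 ^ K, 1) = h (0, 1)" if "a \<le> 2 ^ K" for a
      using ends mesh_pt[OF that] by blast+
    have "word_eq (path_word n (g 0) (2 ^ K)) (path_word n (g j) (2 ^ K))" if "j \<le> 2 ^ K" for j
      using that
    proof (induction j)
      case (Suc j)
      have "g j 0 = g (Suc j) 0" "g j (2 ^ K) = g (Suc j) (2 ^ K)"
        unfolding g_def using e[of j] e[of "Suc j"] Suc.prems by simp_all
      moreover have "word_eq (path_word n (g j) (2 ^ K) @ crossing n (g j (2 ^ K)) (g (Suc j) (2 ^ K)))
          (crossing n (g j 0) (g (Suc j) 0) @ path_word n (g (Suc j)) (2 ^ K))"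
        using Suc.prems by (intro path_word_square conjI unit close) auto
      ultimately have "word_eq (path_word n (g j) (2 ^ K)) (path_word n (g (Suc j)) (2 ^ K))"
        by simp
      then show ?case
        using Suc word_eq_trans by (meson Suc_leD)
    qed simp
    from this[of "2 ^ K"] show ?thesis
      by (simp add: mesh_word_def g_def)
  qed
  then show ?thesis by blast
qed

lemma trivial_word_homotopy:
  fixes h :: "real \<times> real \<Rightarrow> nat \<Rightarrow> complex"
  assumes h: "coord_map ({0..1} \<times> {0..1}) h"
    and "\<And>s. s \<in> {0..1} \<Longrightarrow> h (s, 0) = h (0, 0)" "\<And>s. s \<in> {0..1} \<Longrightarrow> h (s, 1) = h (0, 1)"
    and "trivial_word n (\<lambda>t. h (0, t))"
  shows "trivial_word n (\<lambda>t. h (1, t))"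
proof -
  obtain K0 K1 where "\<And>K. K \<ge> K0 \<Longrightarrow> word_eq (mesh_word n K (\<lambda>t. h (0, t))) (mesh_word n K (\<lambda>t. h (1, t)))"
    "\<And>K. K \<ge> K1 \<Longrightarrow> word_eq (mesh_word n K (\<lambda>t. h (0, t))) []"
    using mesh_word_homotopy[OF assms(1-3)] assms(4) unfolding trivial_word_def by metis
  then have "\<forall>K\<ge>max K0 K1. word_eq (mesh_word n K (\<lambda>t. h (1, t))) []"
    by (meson max.bounded_iff word_eq_sym word_eq_trans)
  then show ?thesis unfolding trivial_word_def by blast
qed

lemma trivial_word_cong:
  assumes "\<And>t. t \<in> {0..1} \<Longrightarrow> p t = q t" "trivial_word n p"
  shows "trivial_word n q"
proof -
  have "mesh_word n K p = mesh_word n K q" for K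
    unfolding mesh_word_def using assms(1) mesh_pt by (intro path_word_cong) auto
  then show ?thesis using assms(2) by (simp add: trivial_word_def)
qed

text \<open>The cocycle identity removes the odd mesh points. This is needed where a path and its
  reverse occur in one concatenation at different speeds.\<close>

lemma mesh_word_refine:
  assumes p: "coord_map {0..1} p"
  shows "\<exists>K0. \<forall>K\<ge>K0. word_eq (mesh_word n (Suc K) p) (mesh_word n K p)"
proof -
  obtain K0 where K0: "\<And>K i j. K \<ge> K0 \<Longrightarrow> i \<le> j \<Longrightarrow> j \<le> 2 ^ K \<Longrightarrow> j \<le> i + 2 \<Longrightarrow>
     close_pt n (p (real i / 2 ^ K)) (p (real j / 2 ^ K))"
    using mesh_close[OF p] by metis
  have "word_eq (mesh_word n (Suc K) p) (mesh_word n K p)" if "K \<ge> K0" for K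
  proof -
    have "word_eq (path_word n (\<lambda>i. p (real i / 2 ^ Suc K)) (2 * 2 ^ K))
        (path_word n (\<lambda>i. p (real (2 * i) / 2 ^ Suc K)) (2 ^ K))"
    proof (rule path_word_refine)
      show "unit_pt n (p (real i / 2 ^ Suc K))" if "i \<le> 2 * 2 ^ K" for i
        using p mesh_pt[of i "Suc K"] that unfolding coord_map_def by (intro coord_pt_unit) auto
      show "close_pt n (p (real i / 2 ^ Suc K)) (p (real j / 2 ^ Suc K))"
        if "i \<le> j" "j \<le> 2 * 2 ^ K" "j \<le> i + 2" for i j
        using K0[of "Suc K" i j] that \<open>K \<ge> K0\<close> by simp
    qed
    then show ?thesis by (simp add: mesh_word_def)
  qed
  then show ?thesis by blast
qed

text \<open>The reason for dyadic meshes: the midpoint of a concatenation is a mesh point, so the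
  identity is one of lists and not merely up to \<open>word_eq\<close>.\<close>

lemma mesh_word_join:
  assumes "p 1 = q 0"
  shows "mesh_word n (Suc K) (path_join p q) = mesh_word n K p @ mesh_word n K q"
proof -
  let ?P = "\<lambda>i. path_join p q (real i / 2 ^ Suc K)"
  have "?P i = p (real i / 2 ^ K)" if "i \<le> 2 ^ K" for i
    using mesh_pt[OF that] by (auto simp: path_join_def field_simps)
  moreover have "?P (2 ^ K + i) = q (real i / 2 ^ K)" for i
  proof (cases "i = 0")
    case True
    then show ?thesis using assms by (simp add: path_join_def)
  next
    case False
    then show ?thesis by (auto simp: path_join_def field_simps)
  qed
  ultimately show ?thesis
    unfolding mesh_word_def power_Suc mult_2[of "2 ^ K :: nat"] path_word_add
    by (intro arg_cong2[where f = append] path_word_cong) (auto simp: field_simps)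
qed

lemma mesh_word_reverse:
  assumes p: "coord_map {0..1} p"
  shows "\<exists>K0. \<forall>K\<ge>K0. word_eq (mesh_word n K p @ mesh_word n K (path_reverse p)) []"
proof -
  obtain K0 where K0: "\<And>K i j. K \<ge> K0 \<Longrightarrow> i \<le> j \<Longrightarrow> j \<le> 2 ^ K \<Longrightarrow> j \<le> i + 2 \<Longrightarrow>
     close_pt n (p (real i / 2 ^ K)) (p (real j / 2 ^ K))"
    using mesh_close[OF p] by metis
  have "word_eq (mesh_word n K p @ mesh_word n K (path_reverse p)) []" if "K \<ge> K0" for K
  proof -
    let ?P = "\<lambda>i. p (real i / 2 ^ K)"
    have "word_eq (path_word n ?P (2 ^ K) @ path_word n (\<lambda>i. ?P (2 ^ K - i)) (2 ^ K)) []"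
    proof (rule path_word_reverse)
      show "unit_pt n (?P i)" if "i \<le> 2 ^ K" for i
        using p mesh_pt[OF that] unfolding coord_map_def by (intro coord_pt_unit) auto
      show "close_pt n (?P i) (?P (Suc i))" if "i < 2 ^ K" for i
        using K0[of K i "Suc i"] that \<open>K \<ge> K0\<close> by simp
    qed
    moreover have "path_word n (\<lambda>i. ?P (2 ^ K - i)) (2 ^ K) = mesh_word n K (path_reverse p)"
      unfolding mesh_word_def
      by (intro path_word_cong) (auto simp: path_reverse_def of_nat_diff diff_divide_distrib)
    ultimately show ?thesis by (simp add: mesh_word_def)
  qed
  then show ?thesis by blast
qed

lemma trivial_word_const: "trivial_word n (\<lambda>_. x)"
proof -
  have "mesh_word n K (\<lambda>_. x) = []" for K
    by (simp add: mesh_word_def path_word_def)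
  then show ?thesis by (simp add: trivial_word_def)
qed

lemma trivial_word_join:
  assumes "p 1 = q 0" "trivial_word n p" "trivial_word n q"
  shows "trivial_word n (path_join p q)"
proof -
  obtain K0 K1 where K: "\<And>K. K \<ge> K0 \<Longrightarrow> word_eq (mesh_word n K p) []"
    "\<And>K. K \<ge> K1 \<Longrightarrow> word_eq (mesh_word n K q) []"
    using assms(2,3) unfolding trivial_word_def by metis
  have "word_eq (mesh_word n K (path_join p q)) []" if "K \<ge> Suc (max K0 K1)" for K
  proof -
    obtain K' where K': "K = Suc K'" "K' \<ge> K0" "K' \<ge> K1"
      using \<open>K \<ge> Suc (max K0 K1)\<close> by (cases K) auto
    then show ?thesis
      using word_eq_append[OF K] assms(1) by (auto simp: mesh_word_join)
  qed
  then show ?thesis unfolding trivial_word_def by blast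
qed

lemma trivial_word_reverse:
  assumes p: "coord_map {0..1} p" and "trivial_word n p"
  shows "trivial_word n (path_reverse p)"
proof -
  obtain K0 K1 where K: "\<And>K. K \<ge> K0 \<Longrightarrow> word_eq (mesh_word n K p) []"
    "\<And>K. K \<ge> K1 \<Longrightarrow> word_eq (mesh_word n K p @ mesh_word n K (path_reverse p)) []"
    using assms(2) mesh_word_reverse[OF p] unfolding trivial_word_def by metis
  have "word_eq (mesh_word n K (path_reverse p)) []" if "K \<ge> max K0 K1" for K
  proof -
    have "word_eq ([] @ mesh_word n K (path_reverse p)) (mesh_word n K p @ mesh_word n K (path_reverse p))"
      using K(1)[of K] that by (intro word_eq_append word_eq_refl) (simp add: word_eq_sym)
    also have "word_eq \<dots> []" using K(2) that by auto
    finally show ?thesis by simp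
  qed
  then show ?thesis unfolding trivial_word_def by blast
qed

text \<open>With this bracketing \<open>g\<close> and \<open>d\<close> take a quarter of the
  interval each and the reverse of \<open>g\<close> takes half, so the two copies of
  \<open>g\<close> are read on neighbouring meshes; refinement brings them to the same one. The word
  of \<open>d\<close> collapses to the crossing from its start to its end, which coincide.\<close>

lemma trivial_word_conjugate:
  assumes g: "coord_map {0..1} g" and d: "coord_map {0..1} d"
    and ends: "d 0 = g 1" "d 1 = g 1"
    and small: "\<And>s t. s \<in> {0..1} \<Longrightarrow> t \<in> {0..1} \<Longrightarrow> close_pt n (d s) (d t)"
  shows "trivial_word n (path_join (path_join g d) (path_reverse g))"
proof -
  obtain K0 K1 where K: "\<And>K. K \<ge> K0 \<Longrightarrow> word_eq (mesh_word n (Suc K) g) (mesh_word n K g)"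
    "\<And>K. K \<ge> K1 \<Longrightarrow> word_eq (mesh_word n K g @ mesh_word n K (path_reverse g)) []"
    using mesh_word_refine[OF g] mesh_word_reverse[OF g] unfolding trivial_word_def by metis
  have d0: "word_eq (mesh_word n K d) []" for K
  proof -
    have "word_eq (path_word n (\<lambda>i. d (real i / 2 ^ K)) (2 ^ K)) (crossing n (d (real 0 / 2 ^ K)) (d (real (2 ^ K) / 2 ^ K)))"
    proof (rule path_word_small)
      show "unit_pt n (d (real i / 2 ^ K))" if "i \<le> 2 ^ K" for i
        using d mesh_pt[OF that] unfolding coord_map_def by (intro coord_pt_unit) auto
    qed (use small mesh_pt in auto)
    then show ?thesis using ends by (simp add: mesh_word_def)
  qed
  have "word_eq (mesh_word n K (path_join (path_join g d) (path_reverse g))) []"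
    if "K \<ge> max K0 K1 + 2" for K
  proof -
    define K' where "K' = K - 2"
    have K': "K = Suc (Suc K')" "K' \<ge> K0" "K' \<ge> K1"
      using that by (auto simp: K'_def)
    have "mesh_word n K (path_join (path_join g d) (path_reverse g)) =
        (mesh_word n K' g @ mesh_word n K' d) @ mesh_word n (Suc K') (path_reverse g)"
      using ends by (simp add: K' mesh_word_join)
    also have "word_eq \<dots> ((mesh_word n (Suc K') g @ []) @ mesh_word n (Suc K') (path_reverse g))"
      using K(1)[of K'] K' d0 by (intro word_eq_append word_eq_refl word_eq_sym[of "mesh_word n (Suc K') g"]) auto
    also have "word_eq \<dots> []" using K(2)[of "Suc K'"] K' by simp
    finally show ?thesis .
  qed
  then show ?thesis unfolding trivial_word_def by blast
qed

section \<open>Events of a path\<close>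

text \<open>Koenig's lemma: there are finitely many matchings at each level, and restricting to lower
  levels preserves them.\<close>

lemma perfect_matching_limit:
  fixes \<tau> :: "'e \<Rightarrow> real" and l :: "'e \<Rightarrow> letter" and A :: "'e set"
  defines "B \<equiv> \<lambda>n. {a \<in> A. fst (l a) \<le> n}"
  assumes pos: "\<And>a. a \<in> A \<Longrightarrow> fst (l a) \<ge> 1"
    and fin: "\<And>n. finite (B n)" and ex: "\<And>n. \<exists>M. perfect_matching \<tau> l (B n) M"
  shows "\<exists>M. perfect_matching \<tau> l A M"
proof -
  define res where "res n M = M \<inter> B n \<times> B n" for n and M :: "('e \<times> 'e) set"
  have restrict: "perfect_matching \<tau> l (B n) (res n M)" if "perfect_matching \<tau> l (B N) M" "n \<le> N" for n N M
    unfolding res_def by (rule perfect_matching_restrict[OF that(1)]) (use that(2) in \<open>auto simp: B_def\<close>)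
  have res_res: "res n (res N M) = res n M" if "n \<le> N" for n N M
    using that by (auto simp: res_def B_def)
  \<comment> \<open>Matchings that extend to every higher level: the nodes of the tree with
    arbitrarily long branches above them.\<close>
  define good where "good n M \<longleftrightarrow> perfect_matching \<tau> l (B n) M \<and>
      (\<forall>N\<ge>n. \<exists>M'. perfect_matching \<tau> l (B N) M' \<and> res n M' = M)" for n M
  have "\<exists>f. \<forall>n. good n (f n) \<and> res n (f (Suc n)) = f n"
  proof (rule dependent_nat_choice)
    have "B 0 = {}" using pos by (force simp: B_def)
    then show "\<exists>M. good 0 M"
      using ex unfolding good_def res_def
      by (intro exI[of _ "{}"]) (auto simp: perfect_matching_def)
  next
    fix M n assume M: "good n M"
    show "\<exists>M'. good (Suc n) M' \<and> res n M' = M"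
    proof (rule ccontr)
      \<comment> \<open>There are only finitely many candidates. If each failed to extend to some
        level \<open>g M'\<close>, a matching at the largest of these levels with restriction
        \<open>M\<close> would restrict to a candidate and thereby extend that very candidate to its
        forbidden level.\<close>
      define F where "F = {M'. perfect_matching \<tau> l (B (Suc n)) M' \<and> res n M' = M}"
      assume "\<not> ?thesis"
      then have "\<forall>M'\<in>F. \<exists>N\<ge>Suc n. \<forall>M''. perfect_matching \<tau> l (B N) M'' \<longrightarrow> res (Suc n) M'' \<noteq> M'"
        unfolding F_def good_def by blast
      then obtain g where g: "\<And>M'. M' \<in> F \<Longrightarrow> g M' \<ge> Suc n"
        "\<And>M' M''. M' \<in> F \<Longrightarrow> perfect_matching \<tau> l (B (g M')) M'' \<Longrightarrow> res (Suc n) M'' \<noteq> M'"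
        by metis
      have "F \<subseteq> Pow (B (Suc n) \<times> B (Suc n))"
        by (auto simp: F_def dest: perfect_matchingD(1,2))
      then have "finite F"
        using fin by (meson finite_Pow_iff finite_SigmaI finite_subset)
      define N where "N = Max (insert (Suc n) (g ` F))"
      have N: "N \<ge> Suc n" "\<And>M'. M' \<in> F \<Longrightarrow> g M' \<le> N"
        using \<open>finite F\<close> by (auto simp: N_def)
      obtain M'' where M'': "perfect_matching \<tau> l (B N) M''" "res n M'' = M"
        using M N(1) unfolding good_def by (meson Suc_leD)
      have F: "res (Suc n) M'' \<in> F"
        using restrict[OF M''(1) N(1)] res_res[of n "Suc n" M''] M''(2) by (simp add: F_def)
      show False
        using g(2)[OF F restrict[OF M''(1) N(2)[OF F]]] res_res[OF g(1)[OF F], of M''] by simp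
    qed
  qed
  then obtain f where f: "\<And>n. perfect_matching \<tau> l (B n) (f n)" "\<And>n. res n (f (Suc n)) = f n"
    unfolding good_def by blast
  have mono: "f n \<subseteq> f N" if "n \<le> N" for n N
    using that
  proof (induction N rule: dec_induct)
    case (step N)
    then show ?case using f(2)[of N] unfolding res_def by blast
  qed simp
  have common: "\<exists>n. p \<in> f n \<and> q \<in> f n" if "p \<in> (\<Union>n. f n)" "q \<in> (\<Union>n. f n)" for p q
    using that mono by (metis UN_E le_cases subsetD)
  show ?thesis
  proof (intro exI perfect_matchingI)
    fix a b assume "(a, b) \<in> (\<Union>n. f n)"
    then show "a \<in> A \<and> b \<in> A \<and> \<tau> a < \<tau> b \<and> l b = letter_inv (l a)"
      using perfect_matchingD(1-4)[OF f(1)] unfolding B_def by blast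
  next
    fix a assume a: "a \<in> A"
    have aB: "a \<in> B n" if "n \<ge> fst (l a)" for n
      using a that by (simp add: B_def)
    obtain p where p: "p \<in> f (fst (l a))" "a = fst p \<or> a = snd p"
      using perfect_matchingD(5)[OF f(1) aB[OF order_refl]] by blast
    show "\<exists>!p. p \<in> (\<Union>n. f n) \<and> (a = fst p \<or> a = snd p)"
    proof (rule ex1I[of _ p])
      fix q assume q: "q \<in> (\<Union>n. f n) \<and> (a = fst q \<or> a = snd q)"
      then obtain n where "q \<in> f n" by blast
      then have "q \<in> f (max n (fst (l a)))" "p \<in> f (max n (fst (l a)))"
        using p mono by (meson max.cobounded1 max.cobounded2 subsetD)+
      then show "q = p"
        using perfect_matchingD(5)[OF f(1) aB, of "max n (fst (l a))"] q p(2) by auto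
    qed (use p in auto)
  next
    fix a b c d assume "(a, b) \<in> (\<Union>n. f n)" "(c, d) \<in> (\<Union>n. f n)" and *: "\<tau> a < \<tau> c" "\<tau> c < \<tau> b"
    then obtain n where "(a, b) \<in> f n" "(c, d) \<in> f n"
      using common by blast
    then show "\<not> \<tau> b < \<tau> d"
      using perfect_matchingD(6)[OF f(1)] * by blast
  qed
qed

section \<open>Antipode passages in terms of angles\<close>

lemma cis_shift:
  fixes a :: real
  defines "u \<equiv> a - of_int \<lfloor>a + 1/2\<rfloor>"
  shows "Re (cis (2 * pi * a)) = cos (2 * pi * u)" "Im (cis (2 * pi * a)) = sin (2 * pi * u)"
    "-1/2 \<le> u" "u < 1/2"
proof -
  have "2 * pi * a = 2 * pi * u + 2 * pi * of_int \<lfloor>a + 1/2\<rfloor>"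
    by (simp add: u_def algebra_simps)
  then have "cis (2 * pi * a) = cis (2 * pi * u)"
    by (metis cis_mult cis_multiple_2pi Ints_of_int mult.right_neutral)
  then show "Re (cis (2 * pi * a)) = cos (2 * pi * u)" "Im (cis (2 * pi * a)) = sin (2 * pi * u)"
    by simp_all
  show "-1/2 \<le> u" "u < 1/2"
    unfolding u_def by linarith+
qed

lemma cos_neg_iff:
  assumes "-1/2 \<le> u" "u < 1/2"
  shows "cos (2 * pi * u) < 0 \<longleftrightarrow> \<bar>u\<bar> > 1/4"
proof (cases "\<bar>u\<bar> > 1/4")
  case True
  have "cos (2 * pi * \<bar>u\<bar>) < 0"
    using assms True by (intro cos_lt_zero_pi) auto
  then show ?thesis using True by (cases "u \<ge> 0") auto
next
  case False
  then have "2 * pi * \<bar>u\<bar> \<le> 2 * pi * (1/4)"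
    by (intro mult_left_mono) auto
  then have "cos (2 * pi * \<bar>u\<bar>) \<ge> 0"
    by (intro cos_ge_zero) (use pi_ge_zero in \<open>auto intro: order_trans[of _ 0]\<close>)
  then have "cos (2 * pi * u) \<ge> 0"
    by (cases "u \<ge> 0") auto
  then show ?thesis using False by simp
qed

lemma sin_pos_iff:
  assumes "-1/2 \<le> u" "u < 1/2"
  shows "sin (2 * pi * u) > 0 \<longleftrightarrow> u > 0"
proof (cases "u > 0")
  case True
  then show ?thesis using assms by (auto intro: sin_gt_zero)
next
  case False
  moreover have "2 * pi * (- u) \<le> 2 * pi * (1/2)"
    using assms by (intro mult_left_mono) auto
  ultimately have "sin (2 * pi * (- u)) \<ge> 0"
    by (intro sin_ge_zero) (auto simp: mult_le_0_iff)
  then show ?thesis using False by simp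
qed

text \<open>As a function of the angle in full turns, \<open>\<lfloor>a + 1/2\<rfloor>\<close> jumps
  exactly at the antipode. For angles less than 1/16 apart it changes by at most 1, and if it
  changes, the two remainders in [-1/2, 1/2) lie at opposite ends, both far inside the left half
  plane.\<close>

lemma cis_crossing:
  assumes "\<bar>a - b\<bar> < 1/16"
  shows "\<lfloor>a + 1/2\<rfloor> = \<lfloor>b + 1/2\<rfloor> \<Longrightarrow> Re (cis (2 * pi * a)) < 0 \<Longrightarrow> Re (cis (2 * pi * b)) < 0 \<Longrightarrow>
      (Im (cis (2 * pi * a)) > 0) = (Im (cis (2 * pi * b)) > 0)"
    and "\<lfloor>a + 1/2\<rfloor> \<noteq> \<lfloor>b + 1/2\<rfloor> \<Longrightarrow> Re (cis (2 * pi * a)) < 0 \<and> Re (cis (2 * pi * b)) < 0 \<and>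
      (Im (cis (2 * pi * a)) > 0 \<longleftrightarrow> \<lfloor>b + 1/2\<rfloor> - \<lfloor>a + 1/2\<rfloor> = 1) \<and>
      (Im (cis (2 * pi * b)) > 0 \<longleftrightarrow> \<lfloor>b + 1/2\<rfloor> - \<lfloor>a + 1/2\<rfloor> \<noteq> 1) \<and> \<bar>\<lfloor>b + 1/2\<rfloor> - \<lfloor>a + 1/2\<rfloor>\<bar> = 1"
proof -
  define u v where "u = a - of_int \<lfloor>a + 1/2\<rfloor>" and "v = b - of_int \<lfloor>b + 1/2\<rfloor>"
  note a = cis_shift[of a, folded u_def] and b = cis_shift[of b, folded v_def]
  note iff = cos_neg_iff[OF a(3,4)] cos_neg_iff[OF b(3,4)] sin_pos_iff[OF a(3,4)] sin_pos_iff[OF b(3,4)]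
  {
    assume "\<lfloor>a + 1/2\<rfloor> = \<lfloor>b + 1/2\<rfloor>"
    then have "\<bar>u - v\<bar> < 1/16" using assms by (simp add: u_def v_def)
    then show "Re (cis (2 * pi * a)) < 0 \<Longrightarrow> Re (cis (2 * pi * b)) < 0 \<Longrightarrow>
        (Im (cis (2 * pi * a)) > 0) = (Im (cis (2 * pi * b)) > 0)"
      unfolding a(1,2) b(1,2) iff by linarith
  }
  assume ne: "\<lfloor>a + 1/2\<rfloor> \<noteq> \<lfloor>b + 1/2\<rfloor>"
  define d where "d = \<lfloor>b + 1/2\<rfloor> - \<lfloor>a + 1/2\<rfloor>"
  have e: "b - a = v - u + of_int d"
    by (simp add: u_def v_def d_def)
  have "of_int \<bar>d\<bar> < (2 :: real)"
    using e a(3,4) b(3,4) assms by (simp add: abs_if split: if_splits)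
  then have "d = 1 \<or> d = -1"
    using ne by (simp add: d_def) linarith
  then have "d = 1 \<and> v - u < -15/16 \<or> d = -1 \<and> v - u > 15/16"
    using e assms by (auto simp: abs_if split: if_splits)
  then show "Re (cis (2 * pi * a)) < 0 \<and> Re (cis (2 * pi * b)) < 0 \<and>
      (Im (cis (2 * pi * a)) > 0 \<longleftrightarrow> \<lfloor>b + 1/2\<rfloor> - \<lfloor>a + 1/2\<rfloor> = 1) \<and>
      (Im (cis (2 * pi * b)) > 0 \<longleftrightarrow> \<lfloor>b + 1/2\<rfloor> - \<lfloor>a + 1/2\<rfloor> \<noteq> 1) \<and> \<bar>\<lfloor>b + 1/2\<rfloor> - \<lfloor>a + 1/2\<rfloor>\<bar> = 1"
    unfolding a(1,2) b(1,2) iff d_def[symmetric] using a(3,4) b(3,4) by (auto simp: abs_if)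
qed

text \<open>\<open>(i + B - 1) div B\<close> is \<open>i / B\<close> rounded up. It increases only
  in the step from a multiple of \<open>B\<close> to its successor, which is what makes the sampling
  below jump at mesh points only.\<close>

lemma ceil_div:
  assumes "(B::nat) > 0"
  shows "i \<le> (i + B - 1) div B * B" "(i + B - 1) div B * B < i + B"
    "i = b * B \<Longrightarrow> (i + B - 1) div B = b" "i = b * B \<Longrightarrow> (Suc i + B - 1) div B = Suc b"
    "\<not> B dvd i \<Longrightarrow> (Suc i + B - 1) div B = (i + B - 1) div B"
proof -
  have "(i + B - 1) div B * B + (i + B - 1) mod B = i + B - 1" "(i + B - 1) mod B < B"
    using assms by simp_all
  then show "i \<le> (i + B - 1) div B * B" "(i + B - 1) div B * B < i + B"
    using assms by linarith+
  show "i = b * B \<Longrightarrow> (i + B - 1) div B = b"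
    using assms by (intro div_nat_eqI) (auto simp: algebra_simps)
  show "i = b * B \<Longrightarrow> (Suc i + B - 1) div B = Suc b"
    using assms by (intro div_nat_eqI) (auto simp: algebra_simps)
  assume "\<not> B dvd i"
  then have "i mod B > 0" by (simp add: dvd_eq_mod_eq_0)
  moreover have "i = i div B * B + i mod B" "i mod B < B" using assms by auto
  ultimately have *: "i div B * B < i" "i < i div B * B + B" by linarith+
  have "(Suc i + B - 1) div B = Suc (i div B)"
    using * by (intro div_nat_eqI) (auto simp: algebra_simps)
  moreover have "(i + B - 1) div B = Suc (i div B)"
    using * by (intro div_nat_eqI) (auto simp: algebra_simps)
  ultimately show "(Suc i + B - 1) div B = (i + B - 1) div B" by simp
qed

text \<open>The angles \<open>\<theta> m\<close> count full turns. The mesh exponent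
  \<open>k m\<close> has to depend on the circle, since a path may run through infinitely many
  circles on ever smaller time scales. The bound in \<open>fine\<close> covers two mesh steps:
  sampling delays a coordinate by up to one step, and passing to a neighbour on a common finer mesh
  costs up to another.\<close>

locale earring_path =
  fixes \<kappa> :: "real \<Rightarrow> nat \<Rightarrow> complex" and \<theta> :: "nat \<Rightarrow> real \<Rightarrow> real" and k :: "nat \<Rightarrow> nat"
  assumes coord: "coord_map {0..1} \<kappa>"
    and lift: "\<And>m t. m \<ge> 1 \<Longrightarrow> t \<in> {0..1} \<Longrightarrow> \<kappa> t m = cis (2 * pi * \<theta> m t)"
    and cont: "\<And>m. m \<ge> 1 \<Longrightarrow> continuous_on {0..1} (\<theta> m)"
    and start: "\<And>m. m \<ge> 1 \<Longrightarrow> \<theta> m 0 = 0"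
    and finish: "\<And>m. m \<ge> 1 \<Longrightarrow> \<kappa> 1 m = 1"
    and fine: "\<And>m s t. m \<ge> 1 \<Longrightarrow> s \<in> {0..1} \<Longrightarrow> t \<in> {0..1} \<Longrightarrow> \<bar>s - t\<bar> \<le> 2 / 2 ^ k m \<Longrightarrow>
       \<bar>\<theta> m s - \<theta> m t\<bar> < 1/16"
begin

text \<open>The integer nearest to the angle. It changes when the antipode is passed, so that
  \<open>jump\<close> is the signed passage within one mesh step.\<close>

definition level :: "nat \<Rightarrow> nat \<Rightarrow> int" where
  "level m b = \<lfloor>\<theta> m (real b / 2 ^ k m) + 1/2\<rfloor>"

definition jump :: "nat \<times> nat \<Rightarrow> int" where
  "jump e = level (fst e) (Suc (snd e)) - level (fst e) (snd e)"

definition events :: "(nat \<times> nat) set" where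
  "events = {e. fst e \<ge> 1 \<and> snd e < 2 ^ k (fst e) \<and> jump e \<noteq> 0}"

definition event_time :: "nat \<times> nat \<Rightarrow> real" where
  "event_time e = real (snd e) / 2 ^ k (fst e)"

definition event_letter :: "nat \<times> nat \<Rightarrow> letter" where
  "event_letter e = (fst e, jump e = 1)"

text \<open>Links the 1/16 for angles with the 1/2 for points: a chord is at most its arc, and
  \<open>2 * pi / 16 < 1/2\<close> follows from \<open>pi < 4\<close>.\<close>

lemma cis_close:
  assumes "m \<ge> 1" "s \<in> {0..1}" "t \<in> {0..1}" "\<bar>s - t\<bar> \<le> 2 / 2 ^ k m"
  shows "cmod (\<kappa> s m - \<kappa> t m) < 1/2"
proof -
  let ?x = "2 * pi * \<theta> m s" and ?y = "2 * pi * \<theta> m t"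
  have "cis ?x - cis ?y = cis ?y * (exp (\<i> * of_real (?x - ?y)) - 1)"
    by (simp add: right_diff_distrib cis_conv_exp flip: exp_add)
  then have "cmod (cis ?x - cis ?y) = cmod (exp (\<i> * of_real (?x - ?y)) - 1)"
    by (metis norm_mult norm_cis mult_1)
  also have "\<dots> = 2 * \<bar>sin ((?x - ?y) / 2)\<bar>"
    by (rule dist_exp_i_1)
  also have "\<dots> \<le> \<bar>?x - ?y\<bar>"
    using abs_sin_x_le_abs_x[of "(?x - ?y) / 2"] by simp
  also have "\<dots> = 2 * pi * \<bar>\<theta> m s - \<theta> m t\<bar>"
    by (simp add: abs_mult flip: right_diff_distrib)
  also have "\<dots> \<le> 2 * pi * (1/16)"
    using fine[OF assms] by (intro mult_left_mono) auto
  also have "\<dots> < 1/2"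
    using pi_less_4 by simp
  finally show ?thesis using lift assms by simp
qed

end

lemma sorted_concat_map:
  assumes "\<And>i x. x \<in> set (f i) \<Longrightarrow> g x = real i / 2 ^ K" "\<And>i. length (f i) \<le> 1"
  shows "sorted_wrt (\<lambda>x y. g x < g y) (concat (map f [0..<N]))"
proof (induction N)
  case (Suc N)
  have "sorted_wrt (\<lambda>x y. g x < g y) (f N)"
    using assms(2)[of N] by (cases "f N") auto
  moreover have "g x < g y" if "x \<in> set (f i)" "i < N" "y \<in> set (f N)" for x y i
    using assms(1)[OF that(1)] assms(1)[OF that(3)] that(2) by (simp add: divide_strict_right_mono)
  ultimately show ?case
    using Suc by (auto simp: sorted_wrt_append)
qed simp

context earring_path
begin

lemma mesh_times:
  assumes "b < 2 ^ k m"
  shows "real b / 2 ^ k m \<in> {0..1}" "real (Suc b) / 2 ^ k m \<in> {0..1}"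
    "\<bar>real b / 2 ^ k m - real (Suc b) / 2 ^ k m\<bar> = 1 / 2 ^ k m"
  using mesh_pt[of b "k m"] mesh_pt[of "Suc b" "k m"] assms
  by (auto simp flip: diff_divide_distrib)

lemma event_crossing:
  assumes e: "(m, b) \<in> events"
  shows "Re (\<kappa> (real b / 2 ^ k m) m) < 0" "Re (\<kappa> (real (Suc b) / 2 ^ k m) m) < 0"
    "Im (\<kappa> (real b / 2 ^ k m) m) > 0 \<longleftrightarrow> jump (m, b) = 1"
    "Im (\<kappa> (real (Suc b) / 2 ^ k m) m) > 0 \<longleftrightarrow> jump (m, b) \<noteq> 1"
    "jump (m, b) = 1 \<or> jump (m, b) = -1"
proof -
  have m: "m \<ge> 1" "b < 2 ^ k m" "jump (m, b) \<noteq> 0" using e by (auto simp: events_def)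
  note t = mesh_times[OF m(2)]
  have "\<bar>\<theta> m (real b / 2 ^ k m) - \<theta> m (real (Suc b) / 2 ^ k m)\<bar> < 1/16"
    by (rule fine[OF m(1) t(1,2)]) (simp only: t(3), simp add: divide_right_mono)
  from cis_crossing(2)[OF this] m(3)
  show "Re (\<kappa> (real b / 2 ^ k m) m) < 0" "Re (\<kappa> (real (Suc b) / 2 ^ k m) m) < 0"
    "Im (\<kappa> (real b / 2 ^ k m) m) > 0 \<longleftrightarrow> jump (m, b) = 1"
    "Im (\<kappa> (real (Suc b) / 2 ^ k m) m) > 0 \<longleftrightarrow> jump (m, b) \<noteq> 1"
    "jump (m, b) = 1 \<or> jump (m, b) = -1"
    unfolding lift[OF m(1) t(1)] lift[OF m(1) t(2)] jump_def level_def fst_conv snd_conv by linarith+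
qed

lemma no_event_crossing:
  assumes "m \<ge> 1" "b < 2 ^ k m" "(m, b) \<notin> events"
  shows "\<not> (Re (\<kappa> (real b / 2 ^ k m) m) < 0 \<and> Re (\<kappa> (real (Suc b) / 2 ^ k m) m) < 0 \<and>
     (Im (\<kappa> (real b / 2 ^ k m) m) > 0) \<noteq> (Im (\<kappa> (real (Suc b) / 2 ^ k m) m) > 0))"
proof -
  note t = mesh_times[OF assms(2)]
  have "\<bar>\<theta> m (real b / 2 ^ k m) - \<theta> m (real (Suc b) / 2 ^ k m)\<bar> < 1/16"
    by (rule fine[OF assms(1) t(1,2)]) (simp only: t(3), simp add: divide_right_mono)
  from cis_crossing(1)[OF this] assms show ?thesis
    unfolding lift[OF assms(1) t(1)] lift[OF assms(1) t(2)]
    by (auto simp: events_def jump_def level_def)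
qed

text \<open>The real part is negative at the start of the mesh step and changes by less than 1/2
  within it, so the coordinate cannot reach 1.\<close>

lemma event_interval:
  assumes e: "e \<in> events" and t: "event_time e \<le> t" "t \<le> event_time e + 1 / 2 ^ k (fst e)"
  shows "t \<in> {0..1}" "\<kappa> t (fst e) \<noteq> 1"
proof -
  obtain m b where [simp]: "e = (m, b)" by (cases e)
  have m: "m \<ge> 1" "b < 2 ^ k m" using e by (auto simp: events_def)
  note times = mesh_times[OF m(2)]
  have t': "real b / 2 ^ k m \<le> t" "t \<le> real (Suc b) / 2 ^ k m"
    using t by (simp_all add: event_time_def add_divide_distrib)
  then show t01: "t \<in> {0..1}"
    using times(1,2) unfolding atLeastAtMost_iff by linarith
  have "cmod (\<kappa> (real b / 2 ^ k m) m - \<kappa> t m) < 1/2"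
  proof (rule cis_close[OF m(1) times(1) t01])
    have "\<bar>real b / 2 ^ k m - t\<bar> \<le> 1 / 2 ^ k m" using t' times(3) by linarith
    also have "\<dots> \<le> 2 / 2 ^ k m" by (simp add: divide_right_mono)
    finally show "\<bar>real b / 2 ^ k m - t\<bar> \<le> 2 / 2 ^ k m" .
  qed
  then have "\<bar>Re (\<kappa> (real b / 2 ^ k m) m) - Re (\<kappa> t m)\<bar> < 1/2"
    using abs_Re_le_cmod[of "\<kappa> (real b / 2 ^ k m) m - \<kappa> t m"] by simp
  then show "\<kappa> t (fst e) \<noteq> 1"
    using event_crossing(1)[of m b] e by auto
qed

text \<open>The time intervals of two events never overlap. On one circle they are distinct mesh
  steps; on two circles a common time would give a point with two coordinates different from 1. Thus
  all events, although taken from different meshes, are linearly ordered.\<close>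

lemma events_order:
  assumes "e \<in> events" "e' \<in> events" "e \<noteq> e'" "event_time e \<le> event_time e'"
  shows "event_time e + 1 / 2 ^ k (fst e) \<le> event_time e'"
proof (cases "fst e = fst e'")
  case True
  then have "snd e \<le> snd e'" "snd e \<noteq> snd e'"
    using assms(3,4) by (auto simp: event_time_def divide_le_cancel prod_eq_iff)
  then have "real (Suc (snd e)) / 2 ^ k (fst e) \<le> real (snd e') / 2 ^ k (fst e)"
    by (intro divide_right_mono) auto
  then show ?thesis using True by (simp add: event_time_def add_divide_distrib)
next
  case False
  show ?thesis
  proof (rule ccontr)
    assume "\<not> ?thesis"
    then have 1: "\<kappa> (event_time e') (fst e) \<noteq> 1" "event_time e' \<in> {0..1}"
      using event_interval[OF assms(1)] assms(4) by auto
    have "\<kappa> (event_time e') (fst e') \<noteq> 1"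
      using event_interval(2)[OF assms(2)] by auto
    moreover have "coord_pt (\<kappa> (event_time e'))"
      using coord 1(2) by (auto simp: coord_map_def)
    ultimately show False
      using 1(1) False assms(1,2) unfolding coord_pt_def events_def by blast
  qed
qed

lemma events_time_less:
  assumes "e \<in> events" "e' \<in> events" "e \<noteq> e'"
  shows "event_time e \<noteq> event_time e'"
proof
  assume "event_time e = event_time e'"
  then have "event_time e + 1 / 2 ^ k (fst e) \<le> event_time e"
    using events_order[OF assms] by simp
  then show False by (simp add: power_le_zero_eq)
qed

section \<open>Sampling every coordinate on its own mesh\<close>

definition sample_time :: "nat \<Rightarrow> nat \<Rightarrow> nat \<Rightarrow> real" where
  "sample_time K m i = real ((i + 2 ^ (K - k m) - 1) div 2 ^ (K - k m)) / 2 ^ k m"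

lemma sample_time_bounds:
  assumes K: "k m \<le> K" and i: "i \<le> 2 ^ K"
  shows "real i / 2 ^ K \<le> sample_time K m i" "sample_time K m i \<le> real i / 2 ^ K + 1 / 2 ^ k m"
    "sample_time K m i \<in> {0..1}"
proof -
  define B :: nat where "B = 2 ^ (K - k m)"
  define c where "c = (i + B - 1) div B"
  have B: "B > 0" "(2::nat) ^ K = 2 ^ k m * B"
    using K by (auto simp: B_def simp flip: power_add)
  then have BR: "(2::real) ^ K = 2 ^ k m * real B"
    by (metis of_nat_mult of_nat_numeral of_nat_power)
  have s: "sample_time K m i = real c / 2 ^ k m" by (simp add: sample_time_def c_def B_def)
  have s': "\<dots> = real (c * B) / 2 ^ K" using B by (simp add: BR)
  have c: "i \<le> c * B" "c * B < i + B"
    unfolding c_def using ceil_div[OF B(1)] by auto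
  have "real i / 2 ^ K \<le> real (c * B) / 2 ^ K"
    using c by (intro divide_right_mono) (linarith, simp)
  then show "real i / 2 ^ K \<le> sample_time K m i" unfolding s s' .
  have "real (c * B) / 2 ^ K \<le> (real i + real B) / 2 ^ K"
    using c by (intro divide_right_mono) (linarith, simp)
  also have "\<dots> = real i / 2 ^ K + 1 / 2 ^ k m"
    using B by (simp add: BR add_divide_distrib)
  finally show "sample_time K m i \<le> real i / 2 ^ K + 1 / 2 ^ k m" unfolding s s' .
  have "c * B < (2 ^ k m + 1) * B" using c i B by (simp add: algebra_simps)
  then have "c < 2 ^ k m + 1" using mult_less_cancel2 by blast
  then have "c \<le> 2 ^ k m" by simp
  then show "sample_time K m i \<in> {0..1}" unfolding s by (rule mesh_pt)
qed

text \<open>Each coordinate is sampled on its own mesh, at the first mesh point not before \<open>i / 2 ^ K\<close>.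
  This sampled path emits a letter exactly at the events.\<close>

definition sample :: "nat \<Rightarrow> nat \<Rightarrow> nat \<Rightarrow> complex" where
  "sample K i m = \<kappa> (sample_time K m i) m"

lemma sample_close:
  assumes "m \<ge> 1" "k m \<le> K" "i \<le> 2 ^ K" "t \<in> {0..1}" "\<bar>sample_time K m i - t\<bar> \<le> 2 / 2 ^ k m"
  shows "cmod (sample K i m - \<kappa> t m) < 1/2"
  unfolding sample_def using cis_close[of m "sample_time K m i" t] sample_time_bounds(3)[of m K i] assms
  by blast

text \<open>The coordinates of a sample belong to different times, so the sample need not be a
  \<open>coord_pt\<close>; this is why \<open>unit_pt\<close> restricts only coordinates in the left
  half plane. Such a coordinate is still different from 1 at the common time
  \<open>i / 2 ^ K\<close>, where only one can be.\<close>

lemma unit_pt_sample: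
  assumes K: "\<And>m. m \<in> {1..n} \<Longrightarrow> k m \<le> K" and i: "i \<le> 2 ^ K"
  shows "unit_pt n (sample K i)"
proof -
  let ?t = "real i / 2 ^ K"
  have t: "?t \<in> {0..1}" using mesh_pt[OF i] .
  have cp: "coord_pt (\<kappa> s)" if "s \<in> {0..1}" for s
    using coord that by (auto simp: coord_map_def)
  have ne: "\<kappa> ?t m \<noteq> 1" if "m \<in> {1..n}" "Re (sample K i m) < 0" for m
  proof -
    have "cmod (sample K i m - \<kappa> ?t m) < 1/2"
    proof (rule sample_close)
      have "\<bar>sample_time K m i - ?t\<bar> \<le> 1 / 2 ^ k m"
        using sample_time_bounds(1,2)[OF K[OF that(1)] i] by (simp add: abs_of_nonneg)
      also have "\<dots> \<le> 2 / 2 ^ k m" by (simp add: divide_right_mono)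
      finally show "\<bar>sample_time K m i - ?t\<bar> \<le> 2 / 2 ^ k m" .
    qed (use that K i t in auto)
    then have "\<bar>Re (sample K i m) - Re (\<kappa> ?t m)\<bar> < 1/2"
      using abs_Re_le_cmod[of "sample K i m - \<kappa> ?t m"] by simp
    then show ?thesis using that(2) by auto
  qed
  have "cmod (sample K i m) = 1" if "m \<in> {1..n}" for m
    using cp[OF sample_time_bounds(3)[OF K[OF that] i]] that by (auto simp: sample_def coord_pt_def)
  moreover have "m = m'" if "m \<in> {1..n}" "m' \<in> {1..n}" "Re (sample K i m) < 0" "Re (sample K i m') < 0" for m m'
    using cp[OF t] ne[of m] ne[of m'] that unfolding coord_pt_def by auto
  ultimately show ?thesis unfolding unit_pt_def by blast
qed

text \<open>The path and its samples bound a thin strip, to which \<open>path_word_square\<close>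
  applies. Every mesh contains 0 and 1, so nothing is emitted at the two ends.\<close>

lemma word_eq_sample:
  assumes K: "\<And>m. m \<in> {1..n} \<Longrightarrow> k m \<le> K"
  shows "word_eq (mesh_word n K \<kappa>) (path_word n (sample K) (2 ^ K))"
proof -
  let ?P = "\<lambda>i. \<kappa> (real i / 2 ^ K)"
  have close: "close_pt n (?P i) (sample K j)" if ij: "i \<le> j" "j \<le> i + 1" "j \<le> 2 ^ K" for i j
  proof -
    have "cmod (sample K j m - ?P i m) < 1/2" if m: "m \<in> {1..n}" for m
    proof (rule sample_close)
      have "(2::real) ^ k m \<le> 2 ^ K" using K[OF m] by (intro power_increasing) auto
      then have "1 / (2::real) ^ K \<le> 1 / 2 ^ k m" by (simp add: divide_left_mono)
      moreover have "real j / 2 ^ K \<le> real i / 2 ^ K + 1 / 2 ^ K" "real i / 2 ^ K \<le> real j / 2 ^ K"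
        using \<open>i \<le> j\<close> \<open>j \<le> i + 1\<close> by (auto simp: divide_right_mono simp flip: add_divide_distrib)
      moreover have "2 / (2::real) ^ k m = 1 / 2 ^ k m + 1 / 2 ^ k m" by simp
      ultimately show "\<bar>sample_time K m j - real i / 2 ^ K\<bar> \<le> 2 / 2 ^ k m"
        using sample_time_bounds(1,2)[OF K[OF m] \<open>j \<le> 2 ^ K\<close>] by linarith
    qed (use ij m K mesh_pt in auto)
    then show ?thesis by (auto simp: close_pt_def norm_minus_commute)
  qed
  have unit: "unit_pt n (?P i)" if "i \<le> 2 ^ K" for i
    using coord mesh_pt[OF that] unfolding coord_map_def by (intro coord_pt_unit) auto
  have ends: "sample K 0 m = \<kappa> 0 m" "sample K (2 ^ K) m = \<kappa> 1 m" if "m \<in> {1..n}" for m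
  proof -
    have "(2::nat) ^ K = 2 ^ k m * 2 ^ (K - k m)"
      using K[OF that] by (simp flip: power_add)
    then have "(2 ^ K + 2 ^ (K - k m) - 1) div 2 ^ (K - k m) = (2::nat) ^ k m"
      by (intro ceil_div(3)) auto
    then show "sample K (2 ^ K) m = \<kappa> 1 m"
      by (simp add: sample_def sample_time_def)
    show "sample K 0 m = \<kappa> 0 m"
      by (simp add: sample_def sample_time_def)
  qed
  have close_P: "close_pt n (?P i) (?P (Suc i))" if "i < 2 ^ K" for i
  proof -
    have "cmod (?P i m - ?P (Suc i) m) < 1/2" if m: "m \<in> {1..n}" for m
    proof (rule cis_close)
      have "(2::real) ^ k m \<le> 2 ^ K" using K[OF m] by (intro power_increasing) auto
      then have "1 / (2::real) ^ K \<le> 2 / 2 ^ k m" by (intro frac_le) auto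
      then show "\<bar>real i / 2 ^ K - real (Suc i) / 2 ^ K\<bar> \<le> 2 / 2 ^ k m"
        by (simp flip: diff_divide_distrib)
    qed (use m \<open>i < 2 ^ K\<close> mesh_pt[of i K] mesh_pt[of "Suc i" K] in auto)
    then show ?thesis by (auto simp: close_pt_def)
  qed
  have close_S: "close_pt n (sample K i) (sample K (Suc i))" if "i < 2 ^ K" for i
  proof -
    have "cmod (sample K i m - sample K (Suc i) m) < 1/2" if m: "m \<in> {1..n}" for m
      unfolding sample_def[of K "Suc i"]
    proof (rule sample_close)
      have "(2::real) ^ k m \<le> 2 ^ K" using K[OF m] by (intro power_increasing) auto
      then have "1 / (2::real) ^ K \<le> 1 / 2 ^ k m" by (simp add: divide_left_mono)
      moreover have "real (Suc i) / 2 ^ K = real i / 2 ^ K + 1 / 2 ^ K"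
        by (simp add: add_divide_distrib)
      moreover have "2 / (2::real) ^ k m = 1 / 2 ^ k m + 1 / 2 ^ k m" "1 / (2::real) ^ K > 0" by auto
      ultimately show "\<bar>sample_time K m i - sample_time K m (Suc i)\<bar> \<le> 2 / 2 ^ k m"
        using sample_time_bounds(1,2)[OF K[OF m] less_imp_le[OF \<open>i < 2 ^ K\<close>]]
          sample_time_bounds(1,2)[OF K[OF m] Suc_leI[OF \<open>i < 2 ^ K\<close>]] by linarith
      show "sample_time K m (Suc i) \<in> {0..1}"
        using sample_time_bounds(3)[OF K[OF m]] \<open>i < 2 ^ K\<close> by simp
    qed (use m K \<open>i < 2 ^ K\<close> in auto)
    then show ?thesis by (auto simp: close_pt_def)
  qed
  have "word_eq (path_word n ?P (2 ^ K) @ crossing n (?P (2 ^ K)) (sample K (2 ^ K)))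
      (crossing n (?P 0) (sample K 0) @ path_word n (sample K) (2 ^ K))"
    using unit unit_pt_sample[OF K] close close_P close_S by (intro path_word_square) auto
  moreover have "crossing n (?P (2 ^ K)) (sample K (2 ^ K)) = []" "crossing n (?P 0) (sample K 0) = []"
    using ends by (auto intro!: crossing_none simp: crosses_at_def)
  ultimately show ?thesis by (simp add: mesh_word_def)
qed

text \<open>A list of length at most one suffices, because distinct events have distinct times
  (\<open>events_time_less\<close>).\<close>

definition events_at :: "nat \<Rightarrow> nat \<Rightarrow> nat \<Rightarrow> (nat \<times> nat) list" where
  "events_at n K i = (let E = {e \<in> events. fst e \<le> n \<and> event_time e = real i / 2 ^ K}
     in if E = {} then [] else [SOME e. e \<in> E])"

lemma event_index:
  assumes "k m \<le> K" "real b / 2 ^ k m = real i / 2 ^ K"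
  shows "i = b * 2 ^ (K - k m)"
proof -
  have "(2::real) ^ K = 2 ^ k m * 2 ^ (K - k m)" using assms(1) by (simp flip: power_add)
  then have "real i = real (b * 2 ^ (K - k m))" using assms(2) by (simp add: field_simps)
  then show ?thesis by (metis of_nat_eq_iff)
qed

lemma set_events_at:
  "set (events_at n K i) = {e \<in> events. fst e \<le> n \<and> event_time e = real i / 2 ^ K}"
proof -
  define E where "E = {e \<in> events. fst e \<le> n \<and> event_time e = real i / 2 ^ K}"
  have "e = e'" if "e \<in> E" "e' \<in> E" for e e'
    using events_time_less[of e e'] that by (auto simp: E_def)
  then have "E = {e}" if "e \<in> E" for e
    using that by blast
  then have "set (if E = {} then [] else [SOME e. e \<in> E]) = E"
    by (metis empty_set insertI1 list.simps(15) some_in_eq)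
  then show ?thesis
    unfolding events_at_def Let_def E_def .
qed

text \<open>Between \<open>i\<close> and \<open>Suc i\<close> the \<open>m\<close>-th sampled
  coordinate stays put unless \<open>i\<close> is a multiple of \<open>2 ^ (K - k m)\<close>; then
  it moves by a whole step of the mesh of \<open>m\<close>, and a letter appears precisely if that
  step is an event.\<close>

lemma crossing_sample:
  assumes K: "\<And>m. m \<in> {1..n} \<Longrightarrow> k m \<le> K" and i: "i < 2 ^ K"
  shows "crossing n (sample K i) (sample K (Suc i)) = map event_letter (events_at n K i)"
proof -
  have at: "sample K i m = \<kappa> (real b / 2 ^ k m) m" "sample K (Suc i) m = \<kappa> (real (Suc b) / 2 ^ k m) m"
    if "i = b * 2 ^ (K - k m)" for m b
    using ceil_div(3,4)[of "2 ^ (K - k m)" i b] that by (simp_all add: sample_def sample_time_def)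
  define E where "E = {e \<in> events. fst e \<le> n \<and> event_time e = real i / 2 ^ K}"
  show ?thesis
  proof (cases "E = {}")
    case False
    define e where "e = (SOME e. e \<in> E)"
    have "e \<in> E" unfolding e_def using False by (auto intro: someI)
    obtain m b where e: "e = (m, b)" by (cases e)
    have m: "m \<in> {1..n}" "(m, b) \<in> events" "real b / 2 ^ k m = real i / 2 ^ K"
      using \<open>e \<in> E\<close> by (auto simp: E_def e events_def event_time_def)
    note at = at[OF event_index[OF K[OF m(1)] m(3)]]
    have "crossing n (sample K i) (sample K (Suc i)) = [(m, jump (m, b) = 1)]"
      using crossing_eq[of n "sample K i" m "sample K (Suc i)"] unit_pt_sample[OF K] i m(1)
        event_crossing[OF m(2)] at by simp
    moreover have "events_at n K i = [e]"
      using False unfolding events_at_def Let_def E_def[symmetric] e_def by simp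
    ultimately show ?thesis by (simp add: event_letter_def e)
  next
    case True
    have "\<not> crosses_at (sample K i) (sample K (Suc i)) m" if m: "m \<in> {1..n}" for m
    proof (cases "2 ^ (K - k m) dvd i")
      case False
      then have "sample K (Suc i) m = sample K i m"
        using ceil_div(5)[of "2 ^ (K - k m)" i] by (simp add: sample_def sample_time_def)
      then show ?thesis by (simp add: crosses_at_def)
    next
      case dvd: True
      then obtain b where b: "i = b * 2 ^ (K - k m)" by (metis dvd_def mult.commute)
      have *: "(2::nat) ^ K = 2 ^ k m * 2 ^ (K - k m)" using K[OF m] by (simp flip: power_add)
      then have "b < 2 ^ k m" using i b by simp
      moreover have "(m, b) \<notin> events"
      proof
        assume "(m, b) \<in> events"
        moreover have "real b / 2 ^ k m = real i / 2 ^ K"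
          using arg_cong[OF *, of real] b by simp
        ultimately show False using True m by (auto simp: E_def event_time_def)
      qed
      ultimately show ?thesis
        using no_event_crossing[of m b] m unfolding crosses_at_def at[OF b] by auto
    qed
    then have "crossing n (sample K i) (sample K (Suc i)) = []" by (rule crossing_none)
    moreover have "events_at n K i = []"
      using True unfolding events_at_def Let_def E_def[symmetric] by simp
    ultimately show ?thesis by simp
  qed
qed

lemma level_matching:
  assumes "trivial_word n \<kappa>"
  shows "\<exists>M. perfect_matching event_time event_letter {e \<in> events. fst e \<le> n} M"
proof -
  obtain K0 where K0: "\<And>K. K \<ge> K0 \<Longrightarrow> word_eq (mesh_word n K \<kappa>) []"
    using assms unfolding trivial_word_def by blast
  define K where "K = Max (insert K0 (k ` {1..n}))"
  have "x \<le> K" if "x \<in> insert K0 (k ` {1..n})" for x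
    unfolding K_def using that by (intro Max_ge) auto
  then have "K \<ge> K0" and K: "\<And>m. m \<in> {1..n} \<Longrightarrow> k m \<le> K"
    by blast+
  define es where "es = concat (map (events_at n K) [0..<2 ^ K])"
  have "path_word n (sample K) (2 ^ K) = map event_letter es"
    unfolding path_word_def es_def map_concat map_map comp_def
    by (intro arg_cong[where f = concat] map_cong) (auto intro: crossing_sample K)
  then have "word_eq (map event_letter es) []"
    using word_eq_sample[of n K] K K0[OF \<open>K \<ge> K0\<close>] word_eq_sym word_eq_trans by metis
  then have "fold push (map event_letter es) [] = []"
    by (simp add: word_eq_def)
  moreover have "sorted_wrt (\<lambda>x y. event_time x < event_time y) es"
    unfolding es_def
  proof (rule sorted_concat_map)
    show "event_time x = real i / 2 ^ K" if "x \<in> set (events_at n K i)" for x i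
      using that by (simp add: set_events_at)
  qed (simp add: events_at_def Let_def)
  ultimately obtain M where M: "perfect_matching event_time event_letter (set es) M"
    using perfect_matching_exists by blast
  have "\<exists>i\<in>{0..<2 ^ K}. event_time e = real i / 2 ^ K" if "e \<in> events" "fst e \<le> n" for e
  proof -
    have m: "fst e \<in> {1..n}" "snd e < 2 ^ k (fst e)" using that by (auto simp: events_def)
    have *: "(2::nat) ^ K = 2 ^ k (fst e) * 2 ^ (K - k (fst e))"
      using K[OF m(1)] by (simp flip: power_add)
    show ?thesis
    proof (intro bexI[of _ "snd e * 2 ^ (K - k (fst e))"])
      show "snd e * 2 ^ (K - k (fst e)) \<in> {0..<2 ^ K}" using m * by simp
      have "(2::real) ^ K = 2 ^ k (fst e) * 2 ^ (K - k (fst e))"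
        using K[OF m(1)] by (simp flip: power_add)
      then show "event_time e = real (snd e * 2 ^ (K - k (fst e))) / 2 ^ K"
        by (simp add: event_time_def)
    qed
  qed
  then have "set es = {e \<in> events. fst e \<le> n}"
    by (auto simp: es_def set_events_at)
  then show ?thesis using M by auto
qed

lemma matching:
  assumes "\<And>n. trivial_word n \<kappa>"
  shows "\<exists>M. perfect_matching event_time event_letter events M"
proof (rule perfect_matching_limit)
  show "finite {e \<in> events. fst (event_letter e) \<le> n}" for n
  proof (rule finite_subset)
    show "{e \<in> events. fst (event_letter e) \<le> n} \<subseteq> (SIGMA m:{..n}. {..<2 ^ k m})"
      by (auto simp: events_def event_letter_def)
  qed auto
  show "\<exists>M. perfect_matching event_time event_letter {e \<in> events. fst (event_letter e) \<le> n} M" for n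
    using level_matching[OF assms] by (simp add: event_letter_def)
qed (simp add: events_def event_letter_def)

end

section \<open>Contracting a path along a matching\<close>

lemma cis_eq_1_iff: "cis (2 * pi * a) = 1 \<longleftrightarrow> a \<in> \<int>"
proof
  assume "cis (2 * pi * a) = 1"
  then have "cos (2 * pi * a) = 1" by (metis cis.sel(1) one_complex.sel(1))
  then obtain n :: int where "2 * pi * a = of_int n * 2 * pi"
    by (auto simp: cos_one_2pi_int)
  then have "a = of_int n" by simp
  then show "a \<in> \<int>" by simp
qed (auto simp: cis_multiple_2pi)

context earring_path
begin

definition ramp :: "nat \<times> nat \<Rightarrow> real \<Rightarrow> real" where
  "ramp e t = max 0 (min 1 (2 ^ k (fst e) * (t - event_time e)))"

lemma ramp_bounds: "0 \<le> ramp e t" "ramp e t \<le> 1"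
  by (auto simp: ramp_def)

lemma ramp_eq_0: "t \<le> event_time e \<Longrightarrow> ramp e t = 0"
proof -
  assume "t \<le> event_time e"
  then have "2 ^ k (fst e) * (t - event_time e) \<le> 0"
    by (intro mult_nonneg_nonpos) auto
  then show ?thesis by (simp add: ramp_def)
qed

lemma ramp_eq_1: "event_time e + 1 / 2 ^ k (fst e) \<le> t \<Longrightarrow> ramp e t = 1"
  by (auto simp: ramp_def max_def min_def field_simps)

lemma continuous_ramp [continuous_intros]:
  "continuous_on S f \<Longrightarrow> continuous_on S (\<lambda>z. ramp e (f z))"
  unfolding ramp_def by (intro continuous_intros)

text \<open>A substitute for \<open>\<theta> m\<close> that moves only during events, by one turn at
  a time. Unlike \<open>\<theta> m\<close> it is a sum of contributions of single events, which a
  matching can cancel in pairs.\<close>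

definition interp :: "nat \<Rightarrow> real \<Rightarrow> real" where
  "interp m t = (\<Sum>b<2 ^ k m. of_int (jump (m, b)) * ramp (m, b) t)"

lemma interp_block:
  assumes "m \<ge> 1" "b < 2 ^ k m" "real b / 2 ^ k m \<le> t" "t \<le> real (Suc b) / 2 ^ k m"
  shows "interp m t = of_int (level m b) + of_int (jump (m, b)) * ramp (m, b) t"
proof -
  have "ramp (m, j) t = 1" if "j < b" for j
  proof (rule ramp_eq_1)
    have "real (Suc j) / 2 ^ k m \<le> real b / 2 ^ k m"
      using that by (intro divide_right_mono) auto
    then show "event_time (m, j) + 1 / 2 ^ k (fst (m, j)) \<le> t"
      using assms(3) by (simp add: event_time_def add_divide_distrib)
  qed
  then have "(\<Sum>j<b. of_int (jump (m, j)) * ramp (m, j) t) = (\<Sum>j<b. of_int (level m (Suc j)) - of_int (level m j))"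
    by (intro sum.cong) (auto simp: jump_def)
  also have "\<dots> = of_int (level m b) - of_int (level m 0)"
    by (rule sum_lessThan_telescope)
  also have "level m 0 = 0"
    using start[OF assms(1)] by (simp add: level_def)
  finally have 1: "(\<Sum>j<b. of_int (jump (m, j)) * ramp (m, j) t) = of_int (level m b)" by simp
  have "ramp (m, j) t = 0" if "j > b" for j
  proof (rule ramp_eq_0)
    have "real (Suc b) / 2 ^ k m \<le> real j / 2 ^ k m"
      using that by (intro divide_right_mono) auto
    then show "t \<le> event_time (m, j)"
      using assms(4) by (simp add: event_time_def)
  qed
  then have 2: "(\<Sum>j\<in>{Suc b..<2 ^ k m}. of_int (jump (m, j)) * ramp (m, j) t) = 0"
    by (intro sum.neutral) auto
  have "{..<2 ^ k m} = insert b ({..<b} \<union> {Suc b..<2 ^ k m})"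
    using assms(2) by auto
  then have "interp m t = of_int (jump (m, b)) * ramp (m, b) t +
      (\<Sum>j\<in>{..<b} \<union> {Suc b..<2 ^ k m}. of_int (jump (m, j)) * ramp (m, j) t)"
    unfolding interp_def by simp
  also have "(\<Sum>j\<in>{..<b} \<union> {Suc b..<2 ^ k m}. of_int (jump (m, j)) * ramp (m, j) t) = of_int (level m b)"
    by (subst sum.union_disjoint) (use 1 2 in auto)
  finally show ?thesis by simp
qed

text \<open>If the angle is an integer at \<open>t\<close>, then at both ends of the mesh step
  around \<open>t\<close> it is within 1/16 of that integer; the step is no event and
  \<open>interp\<close> rests at this value. Hence the linear homotopy from
  \<open>\<theta> m\<close> to \<open>interp m\<close> fixes every time at which the coordinate is
  1, and so never leaves the earring.\<close>

lemma interp_integer: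
  assumes "m \<ge> 1" "t \<in> {0..1}" "\<theta> m t \<in> \<int>"
  shows "interp m t = \<theta> m t"
proof -
  obtain b where b: "b < 2 ^ k m" "real b / 2 ^ k m \<le> t" "t \<le> real (Suc b) / 2 ^ k m"
  proof (cases "t = 1")
    case True
    then show ?thesis
      using that[of "2 ^ k m - 1"] by (simp add: of_nat_diff field_simps)
  next
    case False
    define b where "b = nat \<lfloor>t * 2 ^ k m\<rfloor>"
    have rb: "real b = of_int \<lfloor>t * 2 ^ k m\<rfloor>"
      using assms(2) by (simp add: b_def)
    then have "real b \<le> t * 2 ^ k m" "t * 2 ^ k m \<le> real b + 1" by linarith+
    moreover have "t * 2 ^ k m < 1 * 2 ^ k m"
      using False assms(2) by (intro mult_strict_right_mono) auto
    ultimately have "real b < 2 ^ k m" unfolding mult_1 by linarith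
    then have "b < 2 ^ k m"
      by (metis of_nat_less_iff of_nat_numeral of_nat_power)
    then show ?thesis
      using that[of b] \<open>real b \<le> t * 2 ^ k m\<close> \<open>t * 2 ^ k m \<le> real b + 1\<close> by (simp add: field_simps)
  qed
  obtain n :: int where n: "\<theta> m t = of_int n" using assms(3) by (auto elim: Ints_cases)
  note times = mesh_times[OF b(1)]
  have half: "1 / (2::real) ^ k m \<le> 2 / 2 ^ k m" by (simp add: divide_right_mono)
  have "\<bar>\<theta> m (real b / 2 ^ k m) - \<theta> m t\<bar> < 1/16"
    by (rule fine[OF assms(1) times(1) assms(2)]) (use b times(3) half in linarith)
  then have 1: "level m b = n"
    unfolding level_def n by linarith
  have "\<bar>\<theta> m (real (Suc b) / 2 ^ k m) - \<theta> m t\<bar> < 1/16"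
    by (rule fine[OF assms(1) times(2) assms(2)]) (use b times(3) half in linarith)
  then have 2: "level m (Suc b) = n"
    unfolding level_def n by linarith
  have "jump (m, b) = 0" using 1 2 by (simp add: jump_def)
  then show ?thesis
    using interp_block[OF assms(1) b] 1 n by simp
qed

text \<open>Above the diagonal the arc matched with \<open>e\<close>, \<open>e'\<close> is traversed as a function of the smaller
  of the two ramps: this is the path's own angle on the diagonal and constant on both legs of the
  triangle \<open>0 \<le> x \<le> y \<le> 1\<close>.\<close>

definition arc_sum :: "((nat \<times> nat) \<times> nat \<times> nat) set \<Rightarrow> nat \<Rightarrow> real \<Rightarrow> real \<Rightarrow> real" where
  "arc_sum M m x y =
     (\<Sum>p\<in>{p \<in> M. fst (fst p) = m}. of_int (jump (fst p)) * min (ramp (fst p) x) (1 - ramp (snd p) y))"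

lemma continuous_arc_sum [continuous_intros]:
  "continuous_on S f \<Longrightarrow> continuous_on S g \<Longrightarrow> continuous_on S (\<lambda>z. arc_sum M m (f z) (g z))"
  unfolding arc_sum_def by (intro continuous_intros)

section \<open>Disjoint bands above the diagonal\<close>

context
  fixes M assumes M: "perfect_matching event_time event_letter events M"
begin

lemma pair_props:
  assumes "(a, b) \<in> M"
  shows "a \<in> events" "b \<in> events" "fst b = fst a" "jump b = - jump a"
    "event_time a + 1 / 2 ^ k (fst a) \<le> event_time b"
proof -
  note D = perfect_matchingD[OF M]
  show a: "a \<in> events" and b: "b \<in> events" using D(1,2) assms by auto
  have l: "event_letter b = letter_inv (event_letter a)" using D(4) assms by auto
  then show "fst b = fst a" by (simp add: event_letter_def letter_inv_def)
  have "jump a = 1 \<or> jump a = -1" "jump b = 1 \<or> jump b = -1"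
    using event_crossing(5)[of "fst a" "snd a"] event_crossing(5)[of "fst b" "snd b"] a b by auto
  then show "jump b = - jump a"
    using l by (auto simp: event_letter_def letter_inv_def)
  have "event_time a < event_time b" using D(3) assms by auto
  then show "event_time a + 1 / 2 ^ k (fst a) \<le> event_time b"
    using events_order[OF a b] by auto
qed

lemma finite_level: "finite {e \<in> events. fst e = m}"
  by (rule finite_subset[of _ "{m} \<times> {..<2 ^ k m}"]) (auto simp: events_def)

lemma finite_pairs: "finite {p \<in> M. fst (fst p) = m}"
  by (rule finite_subset[of _ "{e \<in> events. fst e = m} \<times> {e \<in> events. fst e = m}"])
    (use pair_props finite_level in auto)

lemma pair_unique:
  assumes "p \<in> M" "q \<in> M" "e = fst p \<or> e = snd p" "e = fst q \<or> e = snd q"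
  shows "p = q"
proof -
  have "e \<in> events" using assms(1,3) pair_props(1,2)[of "fst p" "snd p"] by auto
  then show ?thesis using perfect_matchingD(5)[OF M] assms by blast
qed

text \<open>On the diagonal the first ramp of a pair is complete before the second one starts, so
  the minimum is the difference of the ramps. The jumps of partners are opposite and every event has
  exactly one partner, so the sum over pairs is the sum over events.\<close>

lemma arc_sum_diagonal:
  assumes "m \<ge> 1"
  shows "arc_sum M m t t = interp m t"
proof -
  define A where "A = {p \<in> M. fst (fst p) = m}"
  define E where "E = {e \<in> events. fst e = m}"
  let ?f = "\<lambda>e. of_int (jump e) * ramp e t"
  have "interp m t = sum ?f (Pair m ` {..<2 ^ k m})"
    unfolding interp_def by (simp add: sum.reindex inj_on_def)
  also have "\<dots> = sum ?f E"
    by (rule sum.mono_neutral_right) (use assms in \<open>auto simp: E_def events_def\<close>)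
  also have "E = fst ` A \<union> snd ` A"
  proof
    show "E \<subseteq> fst ` A \<union> snd ` A"
    proof
      fix e assume e: "e \<in> E"
      then obtain p where p: "p \<in> M" "e = fst p \<or> e = snd p"
        using perfect_matchingD(5)[OF M, of e] by (auto simp: E_def)
      then have "p \<in> A"
        using e pair_props(3)[of "fst p" "snd p"] by (auto simp: E_def A_def)
      then show "e \<in> fst ` A \<union> snd ` A" using p(2) by auto
    qed
    show "fst ` A \<union> snd ` A \<subseteq> E"
      using pair_props by (auto simp: A_def E_def)
  qed
  also have "sum ?f (fst ` A \<union> snd ` A) = sum ?f (fst ` A) + sum ?f (snd ` A)"
  proof (rule sum.union_disjoint)
    have "fst p \<noteq> snd q" if "p \<in> A" "q \<in> A" for p q
    proof
      assume eq: "fst p = snd q"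
      then have "p = q" using pair_unique[of p q "fst p"] that by (auto simp: A_def)
      then show False
        using eq that(2) pair_props(5)[of "fst q" "snd q"] by (cases q) (auto simp: A_def power_le_zero_eq)
    qed
    then show "fst ` A \<inter> snd ` A = {}" by blast
  qed (use finite_pairs[of m] in \<open>auto simp: A_def\<close>)
  finally have sum_eq: "interp m t = sum ?f (fst ` A) + sum ?f (snd ` A)" .
  have "inj_on fst A" "inj_on snd A"
    using pair_unique unfolding inj_on_def A_def by blast+
  then have "sum ?f (fst ` A) = (\<Sum>p\<in>A. ?f (fst p))" "sum ?f (snd ` A) = (\<Sum>p\<in>A. ?f (snd p))"
    by (simp_all add: sum.reindex)
  then have "sum ?f (fst ` A) + sum ?f (snd ` A) = (\<Sum>p\<in>A. ?f (fst p)) + (\<Sum>p\<in>A. ?f (snd p))"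
    by simp
  also have "(\<Sum>p\<in>A. ?f (fst p)) + (\<Sum>p\<in>A. ?f (snd p)) = (\<Sum>p\<in>A. ?f (fst p) + ?f (snd p))"
    by (simp add: sum.distrib)
  also have "\<dots> = arc_sum M m t t"
    unfolding arc_sum_def A_def[symmetric]
  proof (rule sum.cong)
    fix p assume "p \<in> A"
    then obtain a b where p: "p = (a, b)" "(a, b) \<in> M" by (cases p) (auto simp: A_def)
    have "min (ramp a t) (1 - ramp b t) = ramp a t - ramp b t"
    proof (cases "t \<le> event_time b")
      case True
      then show ?thesis using ramp_eq_0[of t b] ramp_bounds[of a t] by simp
    next
      case False
      then have "ramp a t = 1" using pair_props(5)[OF p(2)] by (intro ramp_eq_1) simp
      then show ?thesis using ramp_bounds[of b t] by simp
    qed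
    then show "?f (fst p) + ?f (snd p) =
        of_int (jump (fst p)) * min (ramp (fst p) t) (1 - ramp (snd p) t)"
      using pair_props(4)[OF p(2)] by (simp add: p right_diff_distrib)
  qed simp
  finally show ?thesis using sum_eq by simp
qed

lemma arc_sum_0: "arc_sum M m 0 y = 0"
  unfolding arc_sum_def
proof (rule sum.neutral, rule ballI)
  fix p assume "p \<in> {p \<in> M. fst (fst p) = m}"
  have "ramp (fst p) 0 = 0" by (rule ramp_eq_0) (simp add: event_time_def)
  then show "of_int (jump (fst p)) * min (ramp (fst p) 0) (1 - ramp (snd p) y) = 0"
    using ramp_bounds[of "snd p" y] by simp
qed

lemma arc_sum_1: "arc_sum M m x 1 = 0"
  unfolding arc_sum_def
proof (rule sum.neutral, rule ballI)
  fix p assume "p \<in> {p \<in> M. fst (fst p) = m}"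
  then have "snd p \<in> events" using pair_props(2)[of "fst p" "snd p"] by simp
  then have "event_time (snd p) + 1 / 2 ^ k (fst (snd p)) \<in> {0..1}"
    by (intro event_interval(1)) auto
  then have "ramp (snd p) 1 = 1" by (intro ramp_eq_1) auto
  then show "of_int (jump (fst p)) * min (ramp (fst p) x) (1 - ramp (snd p) 1) = 0"
    using ramp_bounds[of "fst p" x] by simp
qed

text \<open>A coordinate different from 1 needs a non-integral summand, which puts
  \<open>(x, y)\<close> into the band of a pair: on its vertical leg, where \<open>x\<close> is in
  the interval of \<open>a\<close>, or on its horizontal leg, where \<open>y\<close> is in that of
  \<open>b\<close>.\<close>

lemma arc_sum_nonint:
  assumes "arc_sum M m x y \<notin> \<int>"
  obtains a b where "(a, b) \<in> M" "fst a = m" "event_time a < x" "y < event_time b + 1 / 2 ^ k (fst b)"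
    "x < event_time a + 1 / 2 ^ k (fst a) \<or> event_time b < y"
proof -
  obtain p where p: "p \<in> M" "fst (fst p) = m"
    "of_int (jump (fst p)) * min (ramp (fst p) x) (1 - ramp (snd p) y) \<notin> \<int>"
  proof (rule ccontr)
    assume "\<not> thesis"
    then have "arc_sum M m x y \<in> \<int>"
      unfolding arc_sum_def using that by (intro Ints_sum) auto
    then show False using assms by simp
  qed
  obtain a b where ab: "p = (a, b)" by (cases p)
  have "min (ramp a x) (1 - ramp b y) \<notin> \<int>"
    using p(3) ab by auto
  then have *: "min (ramp a x) (1 - ramp b y) \<noteq> 0" "min (ramp a x) (1 - ramp b y) \<noteq> 1" by auto
  then have "ramp a x \<noteq> 0" "ramp b y \<noteq> 1" "\<not> (ramp a x = 1 \<and> ramp b y = 0)"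
    using ramp_bounds[of a x] ramp_bounds[of b y] by auto
  then show ?thesis
    using that[of a b] p ab ramp_eq_0[of x a] ramp_eq_1[of b y] ramp_eq_1[of a x] ramp_eq_0[of y b]
    by fastforce
qed

text \<open>Two vertical or two horizontal legs would give overlapping events on different circles.
  A vertical leg meeting a horizontal one would give crossing pairs. So at most one circle is in use
  at each point of the triangle.\<close>

lemma arc_sum_unique:
  assumes "x \<le> y" "arc_sum M m x y \<notin> \<int>" "arc_sum M m' x y \<notin> \<int>"
  shows "m = m'"
proof (rule ccontr)
  assume ne: "m \<noteq> m'"
  define r where "r e = event_time e + 1 / 2 ^ k (fst e)" for e
  have order: "r e \<le> event_time e' \<or> r e' \<le> event_time e"
    if "e \<in> events" "e' \<in> events" "fst e \<noteq> fst e'" for e e'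
    using events_order[of e e'] events_order[of e' e] that by (force simp: r_def)
  have less: "event_time e < r e" for e by (simp add: r_def)
  \<comment> \<open>With \<open>x\<close> in the interval of \<open>a\<close> and \<open>y\<close>
    in that of \<open>d\<close>, the order of the events is forced to be \<open>c\<close>,
    \<open>a\<close>, \<open>d\<close>, \<open>b\<close>.\<close>
  have cross: False
    if ab: "(a, b) \<in> M" "event_time a < x" "y < r b" "x < r a"
      and cd: "(c, d) \<in> M" "event_time c < x" "y < r d" "event_time d < y"
      and ne: "fst a \<noteq> fst c" for a b c d
  proof -
    note ev = pair_props(1,2,3)[OF ab(1)] pair_props(1,2,3)[OF cd(1)]
    have "event_time c < event_time a"
      using order[of a c] ev ne ab cd less[of c] by auto
    moreover have "event_time d < event_time b"
      using order[of b d] ev ne ab cd less[of d] by auto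
    moreover have "event_time a < event_time d"
      using order[of a d] ev ne ab cd less[of a] \<open>x \<le> y\<close> by auto
    ultimately show False
      using perfect_matchingD(6)[OF M cd(1) ab(1)] by auto
  qed
  obtain a b where ab: "(a, b) \<in> M" "fst a = m" "event_time a < x" "y < r b" "x < r a \<or> event_time b < y"
    using arc_sum_nonint[OF assms(2)] unfolding r_def by metis
  obtain c d where cd: "(c, d) \<in> M" "fst c = m'" "event_time c < x" "y < r d" "x < r c \<or> event_time d < y"
    using arc_sum_nonint[OF assms(3)] unfolding r_def by metis
  note ev = pair_props(1,2,3)[OF ab(1)] pair_props(1,2,3)[OF cd(1)]
  have "\<not> (x < r a \<and> x < r c)"
    using order[of a c] ev ne ab cd by auto
  moreover have "\<not> (event_time b < y \<and> event_time d < y)"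
    using order[of b d] ev ne ab cd by auto
  moreover have "\<not> (x < r a \<and> event_time d < y)"
    using cross[of a b c d] ab cd ne by auto
  moreover have "\<not> (x < r c \<and> event_time b < y)"
    using cross[of c d a b] ab cd ne by auto
  ultimately show False using ab(5) cd(5) by blast
qed

end

text \<open>While \<open>u\<close> grows, the angles are straightened to \<open>interp\<close>,
  which is \<open>arc_sum\<close> on the diagonal. While \<open>v\<close> grows, the diagonal point
  \<open>(t, t)\<close> moves straight to the corner \<open>(0, 1)\<close>, where
  \<open>arc_sum\<close> vanishes. The ends \<open>t = 0\<close> and \<open>t = 1\<close> stay on
  the legs of the triangle and hence at the base point.\<close>

lemma nullhomotopy:
  assumes "\<And>n. trivial_word n \<kappa>"
  shows "\<exists>h. coord_map ({0..1} \<times> {0..1}) h \<and>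
    (\<forall>m\<ge>1. \<forall>t\<in>{0..1}. h (0, t) m = \<kappa> t m \<and> h (1::real, t) m = 1) \<and>
    (\<forall>m\<ge>1. \<forall>s\<in>{0..1}. h (s, 0) m = 1 \<and> h (s, 1::real) m = 1)"
proof -
  obtain M where M: "perfect_matching event_time event_letter events M"
    using matching[OF assms] by blast
  define u v :: "real \<Rightarrow> real" where "u s = min 1 (2 * s)" and "v s = max 0 (2 * s - 1)" for s
  define angle where "angle m z = (1 - u (fst z)) * (\<theta> m (snd z) - interp m (snd z)) +
     arc_sum M m (snd z * (1 - v (fst z))) (snd z + v (fst z) * (1 - snd z))" for m z
  define h where "h z m = cis (2 * pi * angle m z)" for z m
  have uv: "s \<le> 1/2 \<Longrightarrow> v s = 0" "1/2 \<le> s \<Longrightarrow> u s = 1" "u 0 = 0" "v 0 = 0" "u 1 = 1" "v 1 = 1" for s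
    by (auto simp: u_def v_def)
  have v01: "0 \<le> v s \<and> v s \<le> 1" if "s \<in> {0..1}" for s
    using that by (auto simp: v_def)
  have low: "angle m (s, t) = (1 - u s) * \<theta> m t + u s * interp m t" if "v s = 0" "m \<ge> 1" for m s t
    using that arc_sum_diagonal[OF M, of m t] by (simp add: angle_def algebra_simps)
  have kappa_int: "\<kappa> t m = 1 \<longleftrightarrow> \<theta> m t \<in> \<int>" if "m \<ge> 1" "t \<in> {0..1}" for m t
    unfolding lift[OF that] cis_eq_1_iff ..
  have fixed: "angle m (s, t) = \<theta> m t" if "\<kappa> t m = 1" "v s = 0" "m \<ge> 1" "t \<in> {0..1}" for m s t
    using that low interp_integer[of m t] kappa_int[of m t] by (simp flip: distrib_right)
  have "continuous_on ({0..1} \<times> {0..1}) (\<lambda>z. h z m)" if "m \<ge> 1" for m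
    unfolding h_def angle_def u_def v_def interp_def
    by (intro continuous_intros continuous_on_compose2[OF cont[OF that]]
      continuous_on_compose2[OF continuous_on_cis]) auto
  moreover have "coord_pt (h z)" if z: "z \<in> {0..1} \<times> {0..1}" for z
  proof -
    obtain s t where z: "z = (s, t)" "s \<in> {0..1}" "t \<in> {0..1}" using z by (cases z) auto
    have "m = m'" if m: "m \<ge> 1" "m' \<ge> 1" "h z m \<noteq> 1" "h z m' \<noteq> 1" for m m'
    proof (cases "s \<le> 1/2")
      case True
      have "\<kappa> t m \<noteq> 1" if "m \<ge> 1" "h z m \<noteq> 1" for m
        using fixed[of t m s] kappa_int[of m t] that uv(1)[OF True] z by (auto simp: h_def cis_eq_1_iff)
      moreover have "coord_pt (\<kappa> t)" using coord z by (auto simp: coord_map_def)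
      ultimately show ?thesis using m unfolding coord_pt_def by blast
    next
      case False
      then have "arc_sum M m (t * (1 - v s)) (t + v s * (1 - t)) \<notin> \<int>"
        "arc_sum M m' (t * (1 - v s)) (t + v s * (1 - t)) \<notin> \<int>"
        using m z uv(2)[of s] by (auto simp: h_def angle_def cis_eq_1_iff)
      moreover have "t * (1 - v s) \<le> t + v s * (1 - t)"
        using v01[OF z(2)] by (simp add: algebra_simps)
      ultimately show ?thesis using arc_sum_unique[OF M] by blast
    qed
    then show ?thesis unfolding coord_pt_def by (auto simp: h_def)
  qed
  moreover have "h (0, t) m = \<kappa> t m" "h (1, t) m = 1" if "m \<ge> 1" "t \<in> {0..1}" for m t
    using low[of 0 m t] that uv lift arc_sum_0[OF M] by (auto simp: h_def angle_def)
  moreover have "h (s, 0) m = 1" "h (s, 1) m = 1" if "m \<ge> 1" "s \<in> {0..1}" for m s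
  proof -
    have "interp m 0 = \<theta> m 0" "interp m 1 = \<theta> m 1"
      using interp_integer[of m 0] interp_integer[of m 1] start finish kappa_int[of m 1] that by auto
    then show "h (s, 0) m = 1" "h (s, 1) m = 1"
      by (simp_all add: h_def angle_def arc_sum_0[OF M] arc_sum_1[OF M])
  qed
  ultimately show ?thesis
    unfolding coord_map_def by (intro exI[of _ h]) blast
qed

end

lemma circle_lift:
  fixes f :: "real \<Rightarrow> complex"
  assumes "continuous_on {0..1} f" "\<And>t. t \<in> {0..1} \<Longrightarrow> cmod (f t) = 1" "f 0 = 1"
  obtains g where "continuous_on {0..1} g" "g 0 = 0" "\<And>t. t \<in> {0..1} \<Longrightarrow> f t = cis (2 * pi * g t)"
proof -
  obtain g where g: "continuous_on {0..1} g" "\<And>t. t \<in> {0..1} \<Longrightarrow> f t = exp (g t)"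
    using continuous_logarithm_on_contractible[of "{0..1}" f] assms
    by (metis convex_imp_contractible convex_real_interval(5) norm_zero zero_neq_one)
  have f: "f t = cis (Im (g t))" if "t \<in> {0..1}" for t
  proof -
    have "exp (Re (g t)) = 1"
      using assms(2)[OF that] g(2)[OF that] norm_exp_eq_Re by metis
    then show ?thesis
      using g(2)[OF that] exp_eq_polar[of "g t"] by simp
  qed
  define G where "G t = (Im (g t) - Im (g 0)) / (2 * pi)" for t
  have "f t = cis (2 * pi * G t)" if "t \<in> {0..1}" for t
    using f[OF that] f[of 0] assms(3) by (simp add: G_def flip: cis_divide)
  moreover have "continuous_on {0..1} G"
    unfolding G_def by (intro continuous_intros g) auto
  ultimately show ?thesis using that[of G] by (simp add: G_def)
qed

theorem coord_nullhomotopy: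
  assumes coord: "coord_map {0..1} \<kappa>"
    and ends: "\<And>m. m \<ge> 1 \<Longrightarrow> \<kappa> 0 m = 1" "\<And>m. m \<ge> 1 \<Longrightarrow> \<kappa> 1 m = 1"
    and triv: "\<And>n. trivial_word n \<kappa>"
  shows "\<exists>h. coord_map ({0..1} \<times> {0..1}) h \<and>
    (\<forall>m\<ge>1. \<forall>t\<in>{0..1}. h (0, t) m = \<kappa> t m \<and> h (1::real, t) m = 1) \<and>
    (\<forall>m\<ge>1. \<forall>s\<in>{0..1}. h (s, 0) m = 1 \<and> h (s, 1::real) m = 1)"
proof -
  have "\<exists>g. continuous_on {0..1} g \<and> g 0 = 0 \<and> (\<forall>t\<in>{0..1}. \<kappa> t m = cis (2 * pi * g t))" if "m \<ge> 1" for m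
    using circle_lift[of "\<lambda>t. \<kappa> t m"] coord ends(1) that unfolding coord_map_def coord_pt_def by metis
  then obtain \<theta> where \<theta>: "\<And>m. m \<ge> 1 \<Longrightarrow> continuous_on {0..1} (\<theta> m)" "\<And>m. m \<ge> 1 \<Longrightarrow> \<theta> m 0 = 0"
    "\<And>m t. m \<ge> 1 \<Longrightarrow> t \<in> {0..1} \<Longrightarrow> \<kappa> t m = cis (2 * pi * \<theta> m t)"
    by metis
  have "\<exists>k. \<forall>s\<in>{0..1}. \<forall>t\<in>{0..1}. \<bar>s - t\<bar> \<le> 2 / 2 ^ k \<longrightarrow> \<bar>\<theta> m s - \<theta> m t\<bar> < 1/16" if "m \<ge> 1" for m
  proof -
    have "uniformly_continuous_on {0..1} (\<theta> m)"
      using \<theta>(1)[OF that] by (intro compact_uniformly_continuous) auto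
    then obtain d where d: "d > 0" "\<And>s t. s \<in> {0..1} \<Longrightarrow> t \<in> {0..1} \<Longrightarrow> dist s t < d \<Longrightarrow> dist (\<theta> m s) (\<theta> m t) < 1/16"
      unfolding uniformly_continuous_on_def by (metis dist_commute zero_less_divide_1_iff zero_less_numeral)
    obtain k where "2 / 2 ^ k < d" using small_mesh[OF d(1)] by blast
    then show ?thesis
      using d(2) unfolding dist_real_def by (meson le_less_trans)
  qed
  then obtain k where k: "\<And>m s t. m \<ge> 1 \<Longrightarrow> s \<in> {0..1} \<Longrightarrow> t \<in> {0..1} \<Longrightarrow> \<bar>s - t\<bar> \<le> 2 / 2 ^ k m \<Longrightarrow>
      \<bar>\<theta> m s - \<theta> m t\<bar> < 1/16"
    by metis
  interpret earring_path \<kappa> \<theta> k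
    by unfold_locales (use coord \<theta> ends k in auto)
  show ?thesis using nullhomotopy[OF triv] .
qed

section \<open>Coordinates on the earring\<close>

text \<open>Normalised so that \<open>earring_loop m t\<close> has \<open>m\<close>-th coordinate
  \<open>cis (2 * pi * t)\<close>. Indices below 1 give the constant 1, so that shifts of the index
  need no case distinction.\<close>

definition circle_coord :: "int \<Rightarrow> real \<times> real \<Rightarrow> complex" where
  "circle_coord k p =
     (if k \<ge> 1 \<and> p \<in> sphere (1 / of_int k, 0) (1 / of_int k)
      then Complex (1 - of_int k * fst p) (of_int k * snd p) else 1)"

lemma circle_coord_nonpos [simp]: "k \<le> 0 \<Longrightarrow> circle_coord k p = 1"
  by (simp add: circle_coord_def)

lemma earring_loop_in_circle_iff:
  assumes "m \<ge> 1" "n \<ge> 1"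
  shows "earring_loop m t \<in> sphere (1 / real n, 0) (1 / real n) \<longleftrightarrow> m = n \<or> earring_loop m t = (0, 0)"
proof -
  obtain x y where p: "earring_loop m t = (x, y)" by (cases "earring_loop m t")
  have m: "x\<^sup>2 + y\<^sup>2 = 2 * x / real m"
    using p earring_loop_circle[of m "2 * pi * t"] by (auto simp: earring_loop_def)
  show ?thesis
    unfolding p mem_earring_circle[OF assms(2)] m
    using assms m by (auto simp: frac_eq_eq sum_power2_eq_zero_iff)
qed

lemma circle_coord_loop:
  assumes "m \<ge> 1"
  shows "circle_coord k (earring_loop m t) = (if k = int m then cis (2 * pi * t) else 1)"
proof (cases "k \<ge> 1")
  case True
  then obtain n where n: "k = int n" "n \<ge> 1"
    by (intro that[of "nat k"]) auto
  have "Complex (1 - real n * fst (0::real \<times> real)) (real n * snd (0::real \<times> real)) = 1"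
    by (simp add: complex_eq_iff)
  then show ?thesis
    using n assms earring_loop_in_circle_iff[OF assms n(2), of t]
    by (auto simp: circle_coord_def earring_loop_def complex_eq_iff)
qed (use assms in auto)

lemma circle_coord_norm: "p \<in> earring \<Longrightarrow> cmod (circle_coord k p) = 1"
  by (erule earring_loop_surj) (simp add: circle_coord_loop)

lemma circle_coord_unique:
  "p \<in> earring \<Longrightarrow> circle_coord j p \<noteq> 1 \<Longrightarrow> circle_coord k p \<noteq> 1 \<Longrightarrow> j = k"
  by (erule earring_loop_surj) (simp add: circle_coord_loop split: if_splits)

lemma circle_coord_origin [simp]: "circle_coord k (0, 0) = 1"
  by (simp add: circle_coord_def complex_eq_iff)

lemma origin_in_earring: "(0, 0) \<in> earring"
  using earring_loop_in[of 1 0] by (simp add: earring_loop_def)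

lemma closedin_circle:
  assumes "m \<ge> 1"
  shows "closedin earring_top (earring \<inter> sphere (1 / real m, 0) (1 / real m))"
  by (rule closedin_closed_Int) simp

lemma openin_circle:
  assumes "m \<ge> 1"
  shows "openin earring_top (earring \<inter> sphere (1 / real m, 0) (1 / real m) - {(0, 0)})"
proof -
  \<comment> \<open>Off the origin a point of the circle with index \<open>n\<close> satisfies
    \<open>x\<^sup>2 + y\<^sup>2 = 2 * x / n\<close>. The two inequalities therefore say that
    \<open>n\<close> lies strictly between \<open>m - 1\<close> and \<open>m + 1\<close>.\<close>
  define U where "U = {p :: real \<times> real. 0 < fst p \<and>
     2 * fst p < ((fst p)\<^sup>2 + (snd p)\<^sup>2) * (real m + 1) \<and> ((fst p)\<^sup>2 + (snd p)\<^sup>2) * (real m - 1) < 2 * fst p}"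
  have "open U"
    unfolding U_def by (intro open_Collect_conj open_Collect_less continuous_intros)
  have "p \<in> earring \<inter> sphere (1 / real m, 0) (1 / real m) - {(0, 0)} \<longleftrightarrow> p \<in> U"
    if pE: "p \<in> earring" for p
  proof -
    obtain n where n: "n \<ge> 1" "p \<in> sphere (1 / real n, 0) (1 / real n)"
      using pE unfolding earring_def by blast
    obtain x y where p: "p = (x, y)" by (cases p)
    have eq: "x\<^sup>2 + y\<^sup>2 = 2 * x / real n"
      using n mem_earring_circle p by blast
    have in_m: "p \<in> sphere (1 / real m, 0) (1 / real m) \<longleftrightarrow> x\<^sup>2 + y\<^sup>2 = 2 * x / real m"
      unfolding p by (rule mem_earring_circle[OF assms])
    show ?thesis
    proof (cases "x = 0")
      case True
      then have "p = (0, 0)" using eq p by simp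
      then show ?thesis by (simp add: U_def)
    next
      case False
      have "x\<^sup>2 + y\<^sup>2 > 0" using False by (simp add: sum_power2_gt_zero_iff)
      then have x: "x > 0" using eq n(1) by (simp add: zero_less_divide_iff)
      have "p \<in> U \<longleftrightarrow> 2 * x < 2 * x / real n * (real m + 1) \<and> 2 * x / real n * (real m - 1) < 2 * x"
        using x by (simp add: U_def p eq)
      also have "\<dots> \<longleftrightarrow> real n < real m + 1 \<and> real m - 1 < real n"
      proof -
        have "2 * x < 2 * x / real n * c \<longleftrightarrow> real n < c" "2 * x / real n * c < 2 * x \<longleftrightarrow> c < real n" for c
          using x n(1) by (simp_all add: field_simps)
        then show ?thesis by simp
      qed
      also have "\<dots> \<longleftrightarrow> n = m" by linarith
      also have "\<dots> \<longleftrightarrow> x\<^sup>2 + y\<^sup>2 = 2 * x / real m"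
        unfolding eq using x n(1) assms by (auto simp: field_simps)
      finally show ?thesis using pE p in_m False by auto
    qed
  qed
  then have "earring \<inter> sphere (1 / real m, 0) (1 / real m) - {(0, 0)} = earring \<inter> U"
    by blast
  then show ?thesis using \<open>open U\<close> by (simp add: openin_open_Int)
qed

text \<open>The circle and the complement of the punctured circle are both closed in the earring;
  they meet in the origin only, where both formulas give 1.\<close>

lemma continuous_circle_coord: "continuous_on earring (circle_coord k)"
proof (cases "k \<ge> 1")
  case True
  define m where "m = nat k"
  have m: "k = int m" "m \<ge> 1" using True by (auto simp: m_def)
  let ?A = "earring \<inter> sphere (1 / real m, 0) (1 / real m)" and ?B = "earring - (earring \<inter> sphere (1 / real m, 0) (1 / real m) - {(0, 0)})"
  have "continuous_on (?A \<union> ?B) (\<lambda>p. if p \<in> sphere (1 / real m, 0) (1 / real m)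
      then Complex (1 - real m * fst p) (real m * snd p) else 1)"
  proof (rule continuous_on_cases_local)
    have eq: "?A \<union> ?B = earring" by blast
    show "closedin (top_of_set (?A \<union> ?B)) ?A"
      unfolding eq by (rule closedin_circle[OF m(2)])
    show "closedin (top_of_set (?A \<union> ?B)) ?B"
      unfolding eq using openin_circle[OF m(2)] closedin_diff by fastforce
    show "continuous_on ?A (\<lambda>p. Complex (1 - real m * fst p) (real m * snd p))"
      by (simp add: Complex_eq continuous_intros)
    show "Complex (1 - real m * fst x) (real m * snd x) = 1"
      if "x \<in> ?A \<and> x \<notin> sphere (1 / real m, 0) (1 / real m) \<or> x \<in> ?B \<and> x \<in> sphere (1 / real m, 0) (1 / real m)" for x
      using that by (auto simp: Complex_eq_1)
  qed auto
  moreover have "?A \<union> ?B = earring" by blast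
  moreover have "circle_coord k = (\<lambda>p. if p \<in> sphere (1 / real m, 0) (1 / real m)
      then Complex (1 - real m * fst p) (real m * snd p) else 1)"
    using m by (auto simp: circle_coord_def)
  ultimately show ?thesis by simp
next
  case False
  then have "circle_coord k = (\<lambda>_. 1)" by auto
  then show ?thesis by simp
qed

section \<open>Points of the earring from their coordinates\<close>

definition circle_pt :: "nat \<Rightarrow> complex \<Rightarrow> real \<times> real" where
  "circle_pt m z = (1 / real m * (1 - Re z), 1 / real m * Im z)"

text \<open>Inverse to the coordinates. For a \<open>coord_pt\<close> the chosen index is the only
  one; if all coordinates with positive index are 1, the point is the origin.\<close>

definition earring_pt :: "(nat \<Rightarrow> complex) \<Rightarrow> real \<times> real" where
  "earring_pt x = (if \<exists>m\<ge>1. x m \<noteq> 1 then let m = (SOME m. m \<ge> 1 \<and> x m \<noteq> 1) in circle_pt m (x m) else (0, 0))"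

lemma circle_pt_1 [simp]: "circle_pt m 1 = (0, 0)"
  by (simp add: circle_pt_def)

lemma circle_pt_cis: "circle_pt m (cis (2 * pi * t)) = earring_loop m t"
  by (simp add: circle_pt_def earring_loop_def)

lemma earring_pt_eq:
  assumes "m \<ge> 1" "\<And>j. j \<ge> 1 \<Longrightarrow> j \<noteq> m \<Longrightarrow> x j = 1"
  shows "earring_pt x = circle_pt m (x m)"
proof (cases "x m = 1")
  case True
  then have ne: "\<not> (\<exists>m\<ge>1. x m \<noteq> 1)" using assms by metis
  show ?thesis unfolding earring_pt_def if_not_P[OF ne] True by simp
next
  case False
  then have "(SOME m. m \<ge> 1 \<and> x m \<noteq> 1) = m"
    using assms by (intro some_equality) auto
  moreover have "\<exists>m\<ge>1. x m \<noteq> 1" using False assms(1) by blast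
  ultimately show ?thesis unfolding earring_pt_def Let_def by (simp only: if_True)
qed

lemma coord_pt_support:
  assumes "coord_pt x"
  obtains m where "m \<ge> 1" "\<And>j. j \<ge> 1 \<Longrightarrow> j \<noteq> m \<Longrightarrow> x j = 1"
  using assms unfolding coord_pt_def by (metis order_refl)

lemma coord_pt_obtain:
  assumes "coord_pt x"
  obtains m t where "m \<ge> 1" "x m = cis (2 * pi * t)" "t \<in> {0..1}"
    "\<And>j. j \<ge> 1 \<Longrightarrow> j \<noteq> m \<Longrightarrow> x j = 1" "earring_pt x = earring_loop m t"
proof -
  obtain m where m: "m \<ge> 1" "\<And>j. j \<ge> 1 \<Longrightarrow> j \<noteq> m \<Longrightarrow> x j = 1"
    by (rule coord_pt_support[OF assms]) blast
  have "cmod (x m) = 1" using assms m(1) by (simp add: coord_pt_def)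
  then have "x m = cis (Arg2pi (x m))"
    using Arg2pi_eq[of "x m"] by (simp add: cis_conv_exp)
  then obtain s where s: "0 \<le> s" "s < 2 * pi" "x m = cis s"
    using Arg2pi_ge_0 Arg2pi_lt_2pi by blast
  define t where "t = s / (2 * pi)"
  have "x m = cis (2 * pi * t)" "t \<in> {0..1}"
    using s by (auto simp: t_def field_simps)
  moreover from this have "earring_pt x = earring_loop m t"
    using earring_pt_eq[of m x] m by (simp add: circle_pt_cis)
  ultimately show ?thesis using that m by blast
qed

lemma earring_pt_in: "coord_pt x \<Longrightarrow> earring_pt x \<in> earring"
  by (erule coord_pt_obtain) (simp add: earring_loop_in)

lemma circle_coord_earring_pt:
  assumes "coord_pt x"
  shows "circle_coord k (earring_pt x) = (if k \<ge> 1 then x (nat k) else 1)"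
proof -
  obtain m t where m: "m \<ge> 1" "x m = cis (2 * pi * t)" "t \<in> {0..1}"
    "\<And>j. j \<ge> 1 \<Longrightarrow> j \<noteq> m \<Longrightarrow> x j = 1" "earring_pt x = earring_loop m t"
    by (rule coord_pt_obtain[OF assms]) blast
  have "x (nat k) = 1" if "k \<noteq> int m" "k \<ge> 1"
    using m(4)[of "nat k"] that by auto
  then show ?thesis using m by (auto simp: circle_coord_loop)
qed

lemma earring_pt_circle_coord:
  assumes "p \<in> earring"
  shows "earring_pt (\<lambda>m. circle_coord (int m) p) = p"
proof -
  obtain m t where p: "m \<ge> 1" "t \<in> {0..1}" "p = earring_loop m t"
    using earring_loop_surj[OF assms] .
  then show ?thesis
    using earring_pt_eq[of m "\<lambda>m. circle_coord (int m) p"] by (simp add: circle_coord_loop circle_pt_cis)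
qed

lemma earring_eqI:
  assumes "p \<in> earring" "q \<in> earring" "\<And>k. k \<ge> 1 \<Longrightarrow> circle_coord k p = circle_coord k q"
  shows "p = q"
proof -
  have "circle_coord k p = circle_coord k q" for k
    by (cases "k \<ge> 1") (rule assms(3), simp_all)
  then have "(\<lambda>m. circle_coord (int m) p) = (\<lambda>m. circle_coord (int m) q)"
    by blast
  then show ?thesis
    using earring_pt_circle_coord[OF assms(1)] earring_pt_circle_coord[OF assms(2)] by metis
qed

lemma earring_pt_cong: "(\<And>m. m \<ge> 1 \<Longrightarrow> x m = y m) \<Longrightarrow> earring_pt x = earring_pt y"
proof -
  assume eq: "\<And>m. m \<ge> 1 \<Longrightarrow> x m = y m"
  then have P: "m \<ge> 1 \<and> x m \<noteq> 1 \<longleftrightarrow> m \<ge> 1 \<and> y m \<noteq> 1" for m by auto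
  show ?thesis
  proof (cases "\<exists>m\<ge>1. x m \<noteq> 1")
    case True
    then have "(SOME m. m \<ge> 1 \<and> x m \<noteq> 1) \<ge> 1" "\<exists>m\<ge>1. y m \<noteq> 1"
      using someI_ex[of "\<lambda>m. m \<ge> 1 \<and> x m \<noteq> 1"] eq by auto
    then show ?thesis
      using True eq unfolding earring_pt_def Let_def P by (simp only: if_True)
  next
    case False
    then have "\<not> (\<exists>m\<ge>1. y m \<noteq> 1)" using eq by auto
    then show ?thesis
      using False unfolding earring_pt_def by (simp only: if_False)
  qed
qed

lemma earring_pt_one: "(\<And>m. m \<ge> 1 \<Longrightarrow> x m = 1) \<Longrightarrow> earring_pt x = (0, 0)"
  by (auto simp: earring_pt_def)

lemma norm_circle_pt:
  assumes "cmod z = 1" "m \<ge> 1"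
  shows "norm (circle_pt m z) \<le> 3 / real m"
proof -
  have "norm (circle_pt m z) \<le> \<bar>1 / real m * (1 - Re z)\<bar> + \<bar>1 / real m * Im z\<bar>"
    unfolding circle_pt_def real_norm_def[symmetric] by (rule norm_Pair_le)
  also have "\<dots> = (\<bar>1 - Re z\<bar> + \<bar>Im z\<bar>) / real m"
    by (simp add: abs_mult add_divide_distrib)
  also have "\<dots> \<le> 3 / real m"
    using abs_Re_le_cmod[of z] abs_Im_le_cmod[of z] assms
    by (intro divide_right_mono) auto
  finally show ?thesis .
qed

text \<open>Here the shrinking of the circles enters. The map is the uniform limit of the finite
  sums of \<open>circle_pt\<close>, in which at most one summand is nonzero; a point on circle
  \<open>m\<close> has norm at most \<open>3 / m\<close>, so the tails are uniformly small.\<close>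

lemma continuous_earring_pt:
  assumes x: "coord_map S x"
  shows "continuous_on S (\<lambda>s. earring_pt (x s))"
proof (rule uniform_limit_theorem)
  let ?f = "\<lambda>n s. \<Sum>m\<in>{1..n}. circle_pt m (x s m)"
  show "\<forall>\<^sub>F n in sequentially. continuous_on S (?f n)"
  proof (intro always_eventually allI continuous_on_sum)
    show "continuous_on S (\<lambda>s. circle_pt m (x s m))" if "m \<in> {1..n}" for m n
      using x that unfolding circle_pt_def coord_map_def by (auto intro!: continuous_intros)
  qed
  show "uniform_limit S ?f (\<lambda>s. earring_pt (x s)) sequentially"
    unfolding uniform_limit_iff
  proof (intro allI impI)
    fix e :: real assume "e > 0"
    obtain N where N: "real N > 3 / e" using reals_Archimedean2 by blast
    have "dist (?f n s) (earring_pt (x s)) < e" if n: "n \<ge> N" and s: "s \<in> S" for n s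
    proof -
      have cs: "coord_pt (x s)" using x s by (simp add: coord_map_def)
      obtain m where m: "m \<ge> 1" "\<And>j. j \<ge> 1 \<Longrightarrow> j \<noteq> m \<Longrightarrow> x s j = 1"
        by (rule coord_pt_support[OF cs]) blast
      have "?f n s = (\<Sum>j\<in>{1..n}. if j = m then circle_pt m (x s m) else 0)"
        using m(2) by (intro sum.cong) (auto simp: zero_prod_def)
      also have "\<dots> = (if m \<le> n then circle_pt m (x s m) else 0)"
        using m(1) by simp
      finally have f: "?f n s = (if m \<le> n then earring_pt (x s) else 0)"
        using earring_pt_eq[of m "x s"] m by simp
      show ?thesis
      proof (cases "m \<le> n")
        case True
        then show ?thesis using f \<open>e > 0\<close> by simp
      next
        case False
        have "norm (earring_pt (x s)) \<le> 3 / real m"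
          using earring_pt_eq[of m "x s"] m norm_circle_pt[of "x s m" m] cs by (simp add: coord_pt_def)
        moreover have "3 / e < real m" using N n False by linarith
        then have "3 / real m < e"
          using \<open>e > 0\<close> m(1) by (simp add: field_simps)
        ultimately show ?thesis using f False by (simp add: dist_norm)
      qed
    qed
    then show "\<forall>\<^sub>F n in sequentially. \<forall>s\<in>S. dist (?f n s) (earring_pt (x s)) < e"
      unfolding eventually_sequentially by blast
  qed
qed simp

text \<open>Circle \<open>m + j\<close> goes to circle \<open>m\<close>. For negative
  \<open>j\<close> this is an iterate of the bonding map; for positive \<open>j\<close> it is a left
  inverse of one and collapses the first \<open>j\<close> circles.\<close>

definition shift_map :: "int \<Rightarrow> real \<times> real \<Rightarrow> real \<times> real" where
  "shift_map j p = earring_pt (\<lambda>m. circle_coord (int m + j) p)"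

lemma coord_pt_shift: "p \<in> earring \<Longrightarrow> coord_pt (\<lambda>m. circle_coord (int m + j) p)"
  using circle_coord_unique unfolding coord_pt_def by (fastforce simp: circle_coord_norm)

lemma shift_map_in: "p \<in> earring \<Longrightarrow> shift_map j p \<in> earring"
  unfolding shift_map_def by (rule earring_pt_in[OF coord_pt_shift])

lemma circle_coord_shift_map:
  "p \<in> earring \<Longrightarrow> circle_coord k (shift_map j p) = (if k \<ge> 1 then circle_coord (k + j) p else 1)"
  unfolding shift_map_def by (simp add: circle_coord_earring_pt[OF coord_pt_shift])

lemma continuous_shift_map: "continuous_on earring (shift_map j)"
  unfolding shift_map_def
  by (rule continuous_earring_pt) (simp add: coord_map_def coord_pt_shift continuous_circle_coord)

lemma earring_shift_in: "p \<in> earring \<Longrightarrow> earring_shift p \<in> earring"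
  using is_earring_shift_earring_shift by (auto simp: is_earring_shift_def)

lemma circle_coord_earring_shift:
  assumes "p \<in> earring"
  shows "circle_coord k (earring_shift p) = circle_coord (k - 1) p"
proof -
  obtain m t where p: "m \<ge> 1" "t \<in> {0..1}" "p = earring_loop m t"
    using earring_loop_surj[OF assms] .
  then have "earring_shift p = earring_loop (m + 1) t"
    using is_earring_shift_earring_shift by (auto simp: is_earring_shift_def)
  then show ?thesis using p by (auto simp: circle_coord_loop)
qed

section \<open>Coordinates on the telescope\<close>

abbreviation tel_sum :: "(int \<times> (real \<times> real) \<times> real) topology" where
  "tel_sum \<equiv> telescope_sum (\<lambda>_. earring_top)"

definition tel_proj :: "int \<Rightarrow> real \<times> real \<Rightarrow> real \<Rightarrow> (int \<times> (real \<times> real) \<times> real) set" where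
  "tel_proj i x t = telescope_proj (\<lambda>_. earring_top) (\<lambda>_. earring_shift) (i, x, t)"

lemma topspace_tel_sum: "topspace tel_sum = UNIV \<times> earring \<times> {0..1}"
  by (auto simp: telescope_sum_def)

lemma quotient_map_tel:
  "quotient_map tel_sum earring_telescope (\<lambda>a. tel_proj (fst a) (fst (snd a)) (snd (snd a)))"
  using quotient_map_quotient_topology[of tel_sum]
  by (simp add: earring_telescope_def mapping_telescope_def tel_proj_def telescope_proj_def)

lemma topspace_tel:
  "topspace earring_telescope =
     (\<lambda>a. tel_proj (fst a) (fst (snd a)) (snd (snd a))) ` (UNIV \<times> earring \<times> {0..1})"
  using quotient_imp_surjective_map[OF quotient_map_tel] by (simp only: topspace_tel_sum)

lemma tel_proj_in: "x \<in> earring \<Longrightarrow> t \<in> {0..1} \<Longrightarrow> tel_proj i x t \<in> topspace earring_telescope"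
  unfolding topspace_tel by (rule image_eqI[of _ _ "(i, x, t)"]) auto

lemma tel_proj_cases:
  assumes "z \<in> topspace earring_telescope"
  obtains i x t where "x \<in> earring" "t \<in> {0..1}" "z = tel_proj i x t"
proof -
  obtain a where "a \<in> UNIV \<times> earring \<times> {0..1::real}" "z = tel_proj (fst a) (fst (snd a)) (snd (snd a))"
    using assms unfolding topspace_tel by blast
  then show ?thesis using that[of "fst (snd a)" "snd (snd a)" "fst a"] by (simp add: mem_Times_iff)
qed

lemma tel_proj_glue:
  assumes "x \<in> earring"
  shows "tel_proj i x 1 = tel_proj (i + 1) (earring_shift x) 0"
proof -
  have "((i, x, 1), (i + 1, earring_shift x, 0)) \<in> telescope_rel (\<lambda>_. earring_top) (\<lambda>_. earring_shift)"
    using assms earring_shift_in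
    by (auto simp: telescope_rel_def topspace_tel_sum telescope_glue_def intro!: r_into_equivclp)
  then show ?thesis
    unfolding tel_proj_def telescope_proj_def using equiv_telescope_rel by (rule equiv_class_eq[rotated])
qed

lemma continuous_map_tel_component:
  "continuous_map (top_of_set (earring \<times> {0..1})) earring_telescope (\<lambda>z. tel_proj i (fst z) (snd z))"
proof -
  have "continuous_map (prod_topology earring_top (top_of_set {0..1})) tel_sum (\<lambda>z. (i, z))"
    unfolding telescope_sum_def by (rule continuous_map_component_injection) auto
  from continuous_map_compose[OF this quotient_imp_continuous_map[OF quotient_map_tel]] show ?thesis
    by (simp add: o_def)
qed

lemma continuous_map_tel_proj:
  assumes "continuous_on S f" "continuous_on S g" "f ` S \<subseteq> earring" "g ` S \<subseteq> {0..1}"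
  shows "continuous_map (top_of_set S) earring_telescope (\<lambda>s. tel_proj i (f s) (g s))"
proof -
  have "continuous_map (top_of_set S) (top_of_set (earring \<times> {0..1})) (\<lambda>s. (f s, g s))"
    using assms by (auto intro!: continuous_on_Pair)
  from continuous_map_compose[OF this continuous_map_tel_component[of i]] show ?thesis
    by (simp add: o_def)
qed

lemma tel_lift:
  fixes h :: "int \<Rightarrow> real \<times> real \<Rightarrow> real \<Rightarrow> 'b::topological_space"
  assumes cont: "\<And>i. continuous_on (earring \<times> {0..1}) (\<lambda>z. h i (fst z) (snd z))"
    and glue: "\<And>i x. x \<in> earring \<Longrightarrow> h i x 1 = h (i + 1) (earring_shift x) 0"
  shows "\<exists>g. continuous_map earring_telescope euclidean g \<and>
     (\<forall>i. \<forall>x\<in>earring. \<forall>t\<in>{0..1}. g (tel_proj i x t) = h i x t)"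
proof -
  let ?H = "\<lambda>a. h (fst a) (fst (snd a)) (snd (snd a))"
  have "continuous_map tel_sum euclidean ?H"
    unfolding continuous_map_def
  proof (intro conjI allI impI)
    fix U :: "'b set" assume "openin euclidean U"
    have "openin (prod_topology earring_top (top_of_set {0..1})) {z. (i, z) \<in> {a \<in> topspace tel_sum. ?H a \<in> U}}" for i
    proof -
      have "openin (top_of_set (earring \<times> {0..1})) ((earring \<times> {0..1}) \<inter> (\<lambda>z. h i (fst z) (snd z)) -` U)"
        using cont \<open>openin euclidean U\<close> by (auto simp: continuous_on_open_vimage intro: continuous_openin_preimage_gen)
      moreover have "{z. (i, z) \<in> {a \<in> topspace tel_sum. ?H a \<in> U}} = (earring \<times> {0..1}) \<inter> (\<lambda>z. h i (fst z) (snd z)) -` U"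
        by (auto simp: topspace_tel_sum)
      ultimately show ?thesis by simp
    qed
    then show "openin tel_sum {a \<in> topspace tel_sum. ?H a \<in> U}"
      unfolding telescope_sum_def openin_sum_topology by auto
  qed auto
  moreover have "?H a = ?H b" if "tel_proj (fst a) (fst (snd a)) (snd (snd a)) = tel_proj (fst b) (fst (snd b)) (snd (snd b))"
    "a \<in> topspace tel_sum" "b \<in> topspace tel_sum" for a b
  proof -
    have "(a, b) \<in> telescope_rel (\<lambda>_. earring_top) (\<lambda>_. earring_shift)"
      by (rule eq_equiv_class[OF _ equiv_telescope_rel])
        (use that in \<open>simp_all add: tel_proj_def telescope_proj_def\<close>)
    then have "equivclp (telescope_glue (\<lambda>_. earring_top) (\<lambda>_. earring_shift)) a b"
      by (simp add: telescope_rel_def)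
    then show ?thesis
    proof (induction rule: equivclp_induct)
      case (step b c)
      then show ?case using glue by (auto simp: telescope_glue_def)
    qed simp
  qed
  ultimately obtain g where "continuous_map earring_telescope euclidean g"
    "\<And>a. a \<in> topspace tel_sum \<Longrightarrow> g (tel_proj (fst a) (fst (snd a)) (snd (snd a))) = ?H a"
    by (rule quotient_map_lift_exists[OF quotient_map_tel, where h = ?H]) blast+
  then show ?thesis
    by (intro exI[of _ g]) (force simp: topspace_tel_sum)
qed

text \<open>Adding the piece number to the index makes the coordinate compatible with the gluing:
  the bonding map raises the index of a circle by one, as does the step to the next piece.\<close>

lemma tel_coord_exists:
  "\<exists>g. continuous_map earring_telescope euclidean g \<and>
     (\<forall>i. \<forall>x\<in>earring. \<forall>t\<in>{0..1}. g (tel_proj i x t) = circle_coord (k + i) x)"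
proof (rule tel_lift)
  show "continuous_on (earring \<times> {0..1}) (\<lambda>z. circle_coord (k + i) (fst z))" for i
    by (intro continuous_on_compose2[OF continuous_circle_coord] continuous_intros) auto
qed (simp add: circle_coord_earring_shift)

lemma tel_height_exists:
  "\<exists>g. continuous_map earring_telescope euclideanreal g \<and>
     (\<forall>i. \<forall>x\<in>earring. \<forall>t\<in>{0..1}. g (tel_proj i x t) = of_int i + t)"
  by (rule tel_lift) (auto intro!: continuous_intros)

text \<open>Coordinate \<open>k\<close> collapses every cylinder of the telescope but the one that starts as the
  outermost circle of \<open>X\<^bsub>1-k\<^esub>\<close>.\<close>

definition tel_coord :: "int \<Rightarrow> (int \<times> (real \<times> real) \<times> real) set \<Rightarrow> complex" where
  "tel_coord k = (SOME g. continuous_map earring_telescope euclidean g \<and>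
     (\<forall>i. \<forall>x\<in>earring. \<forall>t\<in>{0..1}. g (tel_proj i x t) = circle_coord (k + i) x))"

definition tel_height :: "(int \<times> (real \<times> real) \<times> real) set \<Rightarrow> real" where
  "tel_height = (SOME g. continuous_map earring_telescope euclideanreal g \<and>
     (\<forall>i. \<forall>x\<in>earring. \<forall>t\<in>{0..1}. g (tel_proj i x t) = of_int i + t))"

lemma continuous_tel_coord: "continuous_map earring_telescope euclidean (tel_coord k)"
  and tel_coord: "x \<in> earring \<Longrightarrow> t \<in> {0..1} \<Longrightarrow> tel_coord k (tel_proj i x t) = circle_coord (k + i) x"
  using someI_ex[OF tel_coord_exists[of k]] unfolding tel_coord_def by blast+

lemma continuous_tel_height: "continuous_map earring_telescope euclideanreal tel_height"
  and tel_height: "x \<in> earring \<Longrightarrow> t \<in> {0..1} \<Longrightarrow> tel_height (tel_proj i x t) = of_int i + t"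
  using someI_ex[OF tel_height_exists] unfolding tel_height_def by blast+

lemma coord_pt_tel:
  assumes "z \<in> topspace earring_telescope"
  shows "coord_pt (\<lambda>m. tel_coord (int m + j) z)"
proof -
  obtain i x t where "x \<in> earring" "t \<in> {0..1}" "z = tel_proj i x t"
    using tel_proj_cases[OF assms] .
  then show ?thesis
    using coord_pt_shift[of x "j + i"] by (simp add: tel_coord add.assoc)
qed

lemma tel_base: "earring_telescope_base = tel_proj 0 (0, 0) 0"
  by (simp add: earring_telescope_base_def tel_proj_def)

lemma tel_coord_base: "tel_coord k earring_telescope_base = 1"
  and tel_height_base: "tel_height earring_telescope_base = 0"
  and tel_base_in: "earring_telescope_base \<in> topspace earring_telescope"
  by (simp_all add: tel_base tel_coord tel_height tel_proj_in origin_in_earring)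

text \<open>A pair \<open>(u, y)\<close> in piece \<open>i\<close> stands for the point at height \<open>u\<close> that the bonding maps push to \<open>y\<close>
  in \<open>X\<^bsub>L\<^esub>\<close>; the first \<open>L - i\<close> circles are not in the image.\<close>

definition tel_piece :: "int \<Rightarrow> int \<Rightarrow> (real \<times> real \<times> real) set" where
  "tel_piece L i = {of_int i..of_int i + 1} \<times> {y \<in> earring. \<forall>k\<in>{1..L - i}. circle_coord k y = 1}"

text \<open>Only the first coordinate needs the hypothesis: it is 1 in the image of the bonding map,
  while on the right it is coordinate \<open>j\<close> of \<open>y\<close>.\<close>

lemma shift_map_glue:
  assumes y: "y \<in> earring" "\<forall>k\<in>{1..j}. circle_coord k y = 1" and "j \<ge> 1"
  shows "earring_shift (shift_map j y) = shift_map (j - 1) y"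
proof (rule earring_eqI)
  show "circle_coord k (earring_shift (shift_map j y)) = circle_coord k (shift_map (j - 1) y)"
    if "k \<ge> 1" for k
  proof (cases "k = 1")
    case True
    then show ?thesis
      using y \<open>j \<ge> 1\<close> by (simp add: circle_coord_earring_shift shift_map_in circle_coord_shift_map)
  next
    case False
    then show ?thesis
      using y(1) that by (simp add: circle_coord_earring_shift shift_map_in circle_coord_shift_map algebra_simps)
  qed
qed (use y shift_map_in earring_shift_in in auto)

text \<open>A single map from a region in height times earring to the telescope, so that homotopies
  can be built there and not in the quotient. The pieces are closed, and consecutive ones meet at an
  integer height, where the gluing relation makes the formulas agree.\<close>

lemma tel_chart:
  obtains \<psi> where "continuous_map (top_of_set (\<Union>i\<in>{a..L}. tel_piece L i)) earring_telescope \<psi>"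
    "\<And>i u y. i \<in> {a..L} \<Longrightarrow> (u, y) \<in> tel_piece L i \<Longrightarrow> \<psi> (u, y) = tel_proj i (shift_map (L - i) y) (u - of_int i)"
proof -
  let ?K = "\<Union>i\<in>{a..L}. tel_piece L i"
  define F where "F i z = tel_proj i (shift_map (L - i) (snd z)) (fst z - of_int i)" for i and z :: "real \<times> real \<times> real"
  have cont: "continuous_map (top_of_set (tel_piece L i)) earring_telescope (F i)" for i
    unfolding F_def
  proof (rule continuous_map_tel_proj)
    show "continuous_on (tel_piece L i) (\<lambda>z. shift_map (L - i) (snd z))"
      by (rule continuous_on_compose2[OF continuous_shift_map]) (auto simp: tel_piece_def intro!: continuous_intros)
    show "(\<lambda>z. shift_map (L - i) (snd z)) ` tel_piece L i \<subseteq> earring"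
      by (auto simp: tel_piece_def shift_map_in)
  qed (auto simp: tel_piece_def intro!: continuous_intros)
  have step: "F i z = F (i + 1) z" if "z \<in> tel_piece L i" "z \<in> tel_piece L (i + 1)" "i + 1 \<le> L" for i z
  proof -
    obtain u y where z: "z = (u, y)" by (cases z)
    have u: "u = of_int i + 1" and y: "y \<in> earring" "\<forall>k\<in>{1..L - i}. circle_coord k y = 1"
      using that z by (auto simp: tel_piece_def)
    have "F i z = tel_proj i (shift_map (L - i) y) 1"
      by (simp add: F_def z u)
    also have "\<dots> = tel_proj (i + 1) (earring_shift (shift_map (L - i) y)) 0"
      by (rule tel_proj_glue[OF shift_map_in[OF y(1)]])
    also have "\<dots> = F (i + 1) z"
      using shift_map_glue[OF y] that(3) by (simp add: F_def z u algebra_simps)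
    finally show ?thesis .
  qed
  have agree: "F i z = F j z" if "i \<in> {a..L}" "j \<in> {a..L}" "z \<in> tel_piece L i" "z \<in> tel_piece L j" for i j z
  proof -
    have "of_int i \<le> (of_int j + 1 :: real)" "of_int j \<le> (of_int i + 1 :: real)"
      using that(3,4) by (auto simp: tel_piece_def)
    then have "i = j \<or> j = i + 1 \<or> i = j + 1" by linarith
    then show ?thesis using step[of z i] step[of z j] that by auto
  qed
  obtain g where "continuous_map (top_of_set ?K) earring_telescope g"
    "\<And>z i. i \<in> {a..L} \<Longrightarrow> z \<in> topspace (top_of_set ?K) \<inter> tel_piece L i \<Longrightarrow> g z = F i z"
  proof (rule pasting_lemma_exists_closed[of "{a..L}" "top_of_set ?K" "tel_piece L" earring_telescope F])
    show "closedin (top_of_set ?K) (tel_piece L i)" if "i \<in> {a..L}" for i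
    proof -
      define S where "S = {y \<in> earring. \<forall>k\<in>{1..L - i}. circle_coord k y = 1}"
      have "closedin (top_of_set earring) (earring \<inter> circle_coord k -` {1})" for k
        by (rule continuous_closedin_preimage[OF continuous_circle_coord]) simp
      then have "closedin (top_of_set earring) (\<Inter>(insert earring ((\<lambda>k. earring \<inter> circle_coord k -` {1}) ` {1..L - i})))"
        by (intro closedin_Inter) auto
      moreover have "\<Inter>(insert earring ((\<lambda>k. earring \<inter> circle_coord k -` {1}) ` {1..L - i})) = S"
        by (auto simp: S_def)
      ultimately have "closedin (top_of_set earring) S" by simp
      then obtain C where C: "closed C" "S = C \<inter> earring"
        by (auto simp: closedin_closed)
      have "tel_piece L i = ?K \<inter> ({of_int i..of_int i + 1} \<times> C)"
        using that C(2) unfolding S_def tel_piece_def by blast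
      moreover have "closed ({of_int i..of_int i + 1 :: real} \<times> C)"
        using C(1) by (intro closed_Times) auto
      ultimately show ?thesis by (metis closedin_closed_Int)
    qed
    show "continuous_map (subtopology (top_of_set ?K) (tel_piece L i)) earring_telescope (F i)" if "i \<in> {a..L}" for i
    proof -
      have "?K \<inter> tel_piece L i = tel_piece L i" using that by blast
      then show ?thesis using cont[of i] by (simp only: subtopology_subtopology)
    qed
    show "F i z = F j z" if "i \<in> {a..L}" "j \<in> {a..L}" "z \<in> topspace (top_of_set ?K) \<inter> tel_piece L i \<inter> tel_piece L j" for i j z
      using agree that by blast
    show "topspace (top_of_set ?K) \<subseteq> ?K" by simp
  qed simp_all
  note g = this
  show ?thesis
  proof (rule that[OF g(1)])
    fix i u y assume i: "i \<in> {a..L}" and "(u, y) \<in> tel_piece L i"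
    then have "(u, y) \<in> topspace (top_of_set ?K) \<inter> tel_piece L i" by auto
    from g(2)[OF i this] show "g (u, y) = tel_proj i (shift_map (L - i) y) (u - of_int i)"
      by (simp add: F_def)
  qed
qed

text \<open>Pushing forward along the telescope preserves all coordinates, so the loop can be raised
  to a level \<open>L\<close> above it, keeping its coordinates. At that level every point of the
  earring is available and the coordinatewise null homotopy makes sense.\<close>

theorem tel_loop_nullhomotopic:
  assumes loop: "loopin earring_telescope earring_telescope_base \<alpha>"
    and triv: "\<And>n j. trivial_word n (\<lambda>t m. tel_coord (int m + j) (\<alpha> t))"
  shows "path_homotopic earring_telescope \<alpha> (\<lambda>_. earring_telescope_base)"
proof -
  let ?T = earring_telescope
  have \<alpha>: "continuous_map (top_of_set {0..1}) ?T \<alpha>" "\<alpha> 0 = earring_telescope_base" "\<alpha> 1 = earring_telescope_base"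
    using loop by (auto simp: loopin_def pathin_def)
  have in_T: "\<alpha> t \<in> topspace ?T" if "t \<in> {0..1}" for t
    using \<alpha>(1) that by (auto simp: continuous_map_def)
  define p where "p t = tel_height (\<alpha> t)" for t
  have p: "continuous_on {0..1} p" "p 0 = 0" "p 1 = 0"
    using continuous_map_compose[OF \<alpha>(1) continuous_tel_height] \<alpha>(2,3) tel_height_base
    by (auto simp: p_def o_def)
  have "bounded (p ` {0..1})"
    using p(1) by (intro compact_imp_bounded compact_continuous_image) auto
  then obtain B where "\<forall>x\<in>p ` {0..1}. norm x \<le> B"
    unfolding bounded_iff by blast
  then have B: "\<bar>p t\<bar> \<le> B" if "t \<in> {0..1}" for t
    using that by simp
  \<comment> \<open>The extra 1 makes the height stay strictly below \<open>L\<close> and leaves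
    room at the bottom, since a point may be given in a piece whose number is one below its
    height.\<close>
  define L where "L = \<lceil>B\<rceil> + 1"
  have L: "p t < of_int L" "of_int (- L) \<le> p t - 1" if "t \<in> {0..1}" for t
    using B[OF that] unfolding L_def by linarith+
  have "L > 0" using L(1)[of 0] p(2) by simp
  \<comment> \<open>In piece \<open>L\<close> the telescope coordinate \<open>m - L\<close> is the
    \<open>m\<close>-th circle coordinate, so this is the loop as seen after pushing to level
    \<open>L\<close>.\<close>
  define \<kappa> where "\<kappa> t m = tel_coord (int m + (- L)) (\<alpha> t)" for t m
  have \<kappa>: "coord_map {0..1} \<kappa>"
    unfolding coord_map_def
  proof (intro conjI allI impI ballI)
    show "continuous_on {0..1} (\<lambda>t. \<kappa> t m)" for m
      using continuous_map_compose[OF \<alpha>(1) continuous_tel_coord[of "int m + (- L)"]]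
      by (simp add: \<kappa>_def o_def)
    show "coord_pt (\<kappa> t)" if "t \<in> {0..1}" for t
      using coord_pt_tel[OF in_T[OF that], of "- L"] by (simp add: \<kappa>_def[abs_def])
  qed
  have triv': "trivial_word n \<kappa>" for n
    using triv[of n "- L"] by (simp add: \<kappa>_def[abs_def])
  have ends: "\<kappa> 0 m = 1" "\<kappa> 1 m = 1" for m
    using \<alpha>(2,3) tel_coord_base by (simp_all add: \<kappa>_def)
  obtain h where "coord_map ({0..1} \<times> {0..1}) h \<and>
      (\<forall>m\<ge>1. \<forall>t\<in>{0..1}. h (0, t) m = \<kappa> t m \<and> h (1::real, t) m = 1) \<and>
      (\<forall>m\<ge>1. \<forall>s\<in>{0..1}. h (s, 0) m = 1 \<and> h (s, 1::real) m = 1)"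
    using coord_nullhomotopy[OF \<kappa> ends triv'] by (elim exE)
  then have h: "coord_map ({0..1} \<times> {0..1}) h"
    "\<And>m t. m \<ge> 1 \<Longrightarrow> t \<in> {0..1} \<Longrightarrow> h (0, t) m = \<kappa> t m"
    "\<And>m t. m \<ge> 1 \<Longrightarrow> t \<in> {0..1} \<Longrightarrow> h (1::real, t) m = 1"
    "\<And>m s. m \<ge> 1 \<Longrightarrow> s \<in> {0..1} \<Longrightarrow> h (s, 0) m = 1"
    "\<And>m s. m \<ge> 1 \<Longrightarrow> s \<in> {0..1} \<Longrightarrow> h (s, 1::real) m = 1"
    by blast+
  obtain \<psi> where \<psi>: "continuous_map (top_of_set (\<Union>i\<in>{-L..L}. tel_piece L i)) ?T \<psi>"
    "\<And>i u y. i \<in> {-L..L} \<Longrightarrow> (u, y) \<in> tel_piece L i \<Longrightarrow> \<psi> (u, y) = tel_proj i (shift_map (L - i) y) (u - of_int i)"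
    by (rule tel_chart[of L "-L"]) blast
  define y where "y t = earring_pt (\<kappa> t)" for t
  have chart: "\<exists>i\<in>{-L..<L}. (p t, y t) \<in> tel_piece L i \<and> \<psi> (p t, y t) = \<alpha> t" if t: "t \<in> {0..1}" for t
  proof -
    obtain i x \<tau> where z: "x \<in> earring" "\<tau> \<in> {0..1}" "\<alpha> t = tel_proj i x \<tau>"
      using tel_proj_cases[OF in_T[OF t]] .
    have pt: "p t = of_int i + \<tau>" using z by (simp add: p_def tel_height)
    then have "of_int i < (of_int L :: real)" "of_int (- L) \<le> (of_int i :: real)"
      using L[OF t] z(2) by auto
    then have i: "i \<in> {-L..<L}" by simp
    have "\<kappa> t = (\<lambda>m. circle_coord (int m + (i - L)) x)"
      using z by (auto simp: \<kappa>_def tel_coord algebra_simps)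
    then have y: "y t = shift_map (i - L) x" by (simp add: y_def shift_map_def)
    have piece: "(p t, y t) \<in> tel_piece L i"
      using z(1,2) by (auto simp: tel_piece_def pt y shift_map_in circle_coord_shift_map)
    have "shift_map (L - i) (y t) = x"
    proof (rule earring_eqI)
      show "circle_coord k (shift_map (L - i) (y t)) = circle_coord k x" if "k \<ge> 1" for k
        using i z(1) that unfolding y by (simp add: circle_coord_shift_map shift_map_in)
    qed (use z(1) y shift_map_in in auto)
    then have "\<psi> (p t, y t) = \<alpha> t"
      using \<psi>(2)[OF _ piece] i z pt by simp
    then show ?thesis using i piece by blast
  qed
  define u v :: "real \<Rightarrow> real" where "u s = min 1 (2 * s)" and "v s = max 0 (2 * s - 1)" for s
  have uv: "u 0 = 0" "v 0 = 0" "v 1 = 1"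
    by (simp_all add: u_def v_def)
  have v01: "v s \<in> {0..1}" and u01: "u s \<in> {0..1}" if "s \<in> {0..1}" for s
    using that by (simp_all add: u_def v_def)
  have v_or_u: "v s = 0 \<or> u s = 1" for s
    by (cases "s \<le> 1/2") (simp_all add: u_def v_def)
  \<comment> \<open>First \<open>u\<close> raises the height with the earring point fixed; only at
    height \<open>L\<close> does \<open>v\<close> start the null homotopy, since lower pieces
    exclude the first circles.\<close>
  define G where "G z = (p (snd z) + u (fst z) * (of_int L - p (snd z)), earring_pt (h (v (fst z), snd z)))" for z
  define H where "H = \<psi> \<circ> G"
  let ?I = "{0..1} \<times> {0..1} :: (real \<times> real) set"
  have "continuous_on ?I G"
  proof -
    have "continuous_on ?I (\<lambda>z. (v (fst z), snd z))"
      unfolding v_def by (intro continuous_intros)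
    moreover have "(\<lambda>z. (v (fst z), snd z)) ` ?I \<subseteq> {0..1} \<times> {0..1}"
    proof (rule image_subsetI)
      fix z assume "z \<in> ?I"
      then show "(v (fst z), snd z) \<in> {0..1} \<times> {0..1}"
        using v01[of "fst z"] by (cases z) (simp only: mem_Times_iff fst_conv snd_conv)
    qed
    ultimately have "continuous_on ?I (\<lambda>z. earring_pt (h (v (fst z), snd z)))"
      using continuous_on_compose2[OF continuous_earring_pt[OF h(1)]] by blast
    then show ?thesis
      unfolding G_def u_def
      by (intro continuous_intros continuous_on_compose2[OF p(1)]) auto
  qed
  have y0: "earring_pt (h (0, t)) = y t" if "t \<in> {0..1}" for t
    unfolding y_def using h(2) that by (intro earring_pt_cong) auto
  have G_in: "G (s, t) \<in> (\<Union>i\<in>{-L..L}. tel_piece L i)" if st: "s \<in> {0..1}" "t \<in> {0..1}" for s t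
  proof (cases "u s = 1")
    case True
    have "coord_pt (h (v s, t))" using h(1) v01[OF st(1)] st(2) by (auto simp: coord_map_def)
    then have "G (s, t) \<in> tel_piece L L"
      using True by (auto simp: G_def tel_piece_def earring_pt_in)
    then show ?thesis using \<open>L > 0\<close> by auto
  next
    case False
    then have v: "v s = 0" using v_or_u[of s] by auto
    obtain i where i: "i \<in> {-L..<L}" "(p t, y t) \<in> tel_piece L i"
      using chart[OF st(2)] by blast
    define w where "w = p t + u s * (of_int L - p t)"
    have "0 \<le> u s" "u s \<le> 1" using u01[OF st(1)] by auto
    then have "0 \<le> u s * (of_int L - p t)" "u s * (of_int L - p t) \<le> 1 * (of_int L - p t)"
      using L(1)[OF st(2)] by (auto intro!: mult_nonneg_nonneg mult_right_mono)
    then have w: "p t \<le> w" "w \<le> of_int L" by (auto simp: w_def)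
    \<comment> \<open>Rising relaxes the condition on the circles: piece \<open>j\<close> excludes
      the first \<open>L - j\<close> of them, no more than piece \<open>i\<close> does. At height
      \<open>L\<close> the floor is \<open>L\<close> itself, so the chart has to include that
      piece.\<close>
    define j where "j = \<lfloor>w\<rfloor>"
    have "of_int i \<le> w" using i(2) w(1) by (auto simp: tel_piece_def)
    then have "i \<le> j" "j \<le> L" using w(2) by (auto simp: j_def le_floor_iff floor_le_iff) 
    moreover have "of_int j \<le> w" "w \<le> of_int j + 1" unfolding j_def by linarith+
    ultimately have "(w, y t) \<in> tel_piece L j"
      using i(2) by (auto simp: tel_piece_def)
    moreover have "G (s, t) = (w, y t)"
      using y0[OF st(2)] v by (simp add: G_def w_def)
    ultimately show ?thesis using i(1) \<open>i \<le> j\<close> \<open>j \<le> L\<close> by auto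
  qed
  then have "continuous_map (top_of_set ?I) (top_of_set (\<Union>i\<in>{-L..L}. tel_piece L i)) G"
    using \<open>continuous_on ?I G\<close> by auto
  then have H: "continuous_map (top_of_set ?I) ?T H"
    unfolding H_def using \<psi>(1) by (rule continuous_map_compose)
  have H0: "H (0, t) = \<alpha> t" if "t \<in> {0..1}" for t
    using chart[OF that] y0[OF that] uv by (auto simp: H_def G_def)
  \<comment> \<open>The homotopy does not fix the end points, because the base point is raised too.
    But the edge \<open>t = 1\<close> is mapped like the edge \<open>t = 0\<close>, and the edge
    \<open>s = 1\<close> is constant.\<close>
  have side: "H (s, t) = H (s, 0)" if "s \<in> {0..1}" "t = 1 \<or> s = 1 \<and> t \<in> {0..1}" for s t
  proof -
    have "earring_pt (h (v s, t)) = (0, 0)" "earring_pt (h (v s, 0)) = (0, 0)"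
      using h(3-5) uv(3) v01[OF that(1)] that(2) by (auto intro!: earring_pt_one)
    moreover have "p t + u s * (of_int L - p t) = p 0 + u s * (of_int L - p 0)"
      using that(2) p by (auto simp: u_def)
    ultimately show ?thesis by (simp add: H_def G_def)
  qed
  \<comment> \<open>The path \<open>(r, w)\<close> runs along the edge \<open>t = 0\<close>, then
    along \<open>s = 1\<close>, and back along \<open>t = 1\<close>. On these edges \<open>w\<close>
    may be replaced by 0, which leaves a path going out and back the same way.\<close>
  define r w :: "real \<Rightarrow> real" where "r t = max 0 (min 1 (min (3 * t) (3 - 3 * t)))" and "w t = max 0 (min 1 (3 * t - 1))" for t
  have r01: "r t \<in> {0..1}" "w t \<in> {0..1}" for t by (auto simp: r_def w_def)
  have cont_rw: "continuous_on {0..1} r" "continuous_on {0..1} w"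
    unfolding r_def w_def by (intro continuous_intros)+
  have rw_ends: "r 0 = 0" "r 1 = 0" "w 0 = 0" "w 1 = 1"
    by (simp_all add: r_def w_def)
  have cvx: "convex ?I" by (intro convex_Times) auto
  have "path_homotopic ?T \<alpha> (H \<circ> (\<lambda>t. (0, t)))"
    using H0 loop by (intro path_homotopic_eq) (auto simp: loopin_def)
  also have "path_homotopic ?T \<dots> (H \<circ> (\<lambda>t. (r t, w t)))"
    by (rule path_homotopic_convex[OF cvx H])
      (use r01 cont_rw in \<open>auto intro!: continuous_on_Pair continuous_on_const continuous_on_id simp: rw_ends image_subset_iff\<close>)
  also have "H \<circ> (\<lambda>t. (r t, w t)) = H \<circ> (\<lambda>t. (r t, 0))"
  proof
    fix t :: real
    consider "t \<le> 1/3" | "1/3 \<le> t" "t \<le> 2/3" | "2/3 \<le> t" by linarith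
    then show "(H \<circ> (\<lambda>t. (r t, w t))) t = (H \<circ> (\<lambda>t. (r t, 0))) t"
    proof cases
      case 1
      then have "w t = 0" by (simp add: w_def)
      then show ?thesis by simp
    next
      case 2
      then have "r t = 1" by (simp add: r_def)
      then show ?thesis using side[of 1 "w t"] r01[of t] by simp
    next
      case 3
      then have "w t = 1" by (simp add: w_def)
      then show ?thesis using side[of "r t" 1] r01[of t] by simp
    qed
  qed
  also have "path_homotopic ?T \<dots> (H \<circ> (\<lambda>t. (0, 0)))"
    by (rule path_homotopic_convex[OF cvx H])
      (use r01 cont_rw in \<open>auto intro!: continuous_on_Pair continuous_on_const simp: rw_ends image_subset_iff\<close>)
  also have "H \<circ> (\<lambda>t. (0, 0)) = (\<lambda>_. earring_telescope_base)"
    using H0[of 0] \<alpha>(2) by (auto simp: o_def)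
  finally show ?thesis .
qed

section \<open>The Spanier group\<close>

definition tel_coords :: "int \<Rightarrow> (int \<times> (real \<times> real) \<times> real) set \<Rightarrow> nat \<Rightarrow> complex" where
  "tel_coords j z m = tel_coord (int m + j) z"

lemma coord_map_tel:
  assumes "continuous_map (top_of_set S) earring_telescope p"
  shows "coord_map S (\<lambda>t. tel_coords j (p t))"
  unfolding coord_map_def
proof (intro conjI allI impI ballI)
  show "continuous_on S (\<lambda>t. tel_coords j (p t) m)" for m
    using continuous_map_compose[OF assms continuous_tel_coord[of "int m + j"]]
    by (simp add: tel_coords_def o_def)
  show "coord_pt (tel_coords j (p t))" if "t \<in> S" for t
    using coord_pt_tel[of "p t" j] assms that by (auto simp: tel_coords_def[abs_def] continuous_map_def)
qed

lemma trivial_word_path_homotopic: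
  assumes "path_homotopic earring_telescope p q" "trivial_word n (\<lambda>t. tel_coords j (p t))"
  shows "trivial_word n (\<lambda>t. tel_coords j (q t))"
proof -
  obtain h where "continuous_map (top_of_set ({0..1::real} \<times> {0..1::real})) earring_telescope h \<and>
       (\<forall>t\<in>{0..1}. h (0, t) = p t) \<and> (\<forall>t\<in>{0..1}. h (1, t) = q t) \<and>
       (\<forall>s\<in>{0..1}. h (s, 0) = p 0 \<and> h (s, 1) = p 1)"
    using assms(1) unfolding path_homotopic_iff by (elim exE)
  then have h: "continuous_map (top_of_set ({0..1::real} \<times> {0..1::real})) earring_telescope h"
    "\<And>t. t \<in> {0..1} \<Longrightarrow> h (0, t) = p t" "\<And>t. t \<in> {0..1} \<Longrightarrow> h (1, t) = q t"
    "\<And>s. s \<in> {0..1} \<Longrightarrow> h (s, 0) = p 0 \<and> h (s, 1) = p 1"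
    by blast+
  have "trivial_word n (\<lambda>t. tel_coords j (h (0, t)))"
    by (rule trivial_word_cong[OF _ assms(2)]) (simp add: h(2))
  then have "trivial_word n (\<lambda>t. tel_coords j (h (1, t)))"
    using h(4) by (intro trivial_word_homotopy[OF coord_map_tel[OF h(1)]]) auto
  then show ?thesis
    by (rule trivial_word_cong[rotated]) (simp add: h(3))
qed

lemma compose_path_join: "(\<lambda>t. f (path_join p q t)) = path_join (\<lambda>t. f (p t)) (\<lambda>t. f (q t))"
  and compose_path_reverse: "(\<lambda>t. f (path_reverse p t)) = path_reverse (\<lambda>t. f (p t))"
  by (auto simp: path_join_def path_reverse_def)

text \<open>The radius 1/4 makes any two points of a member close in the sense of
  \<open>close_pt\<close>, whose bound is 1/2.\<close>

definition tel_cover :: "nat \<Rightarrow> int \<Rightarrow> (int \<times> (real \<times> real) \<times> real) set set set" where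
  "tel_cover n j = (\<lambda>z. {z' \<in> topspace earring_telescope.
     \<forall>m\<in>{1..n}. dist (tel_coords j z m) (tel_coords j z' m) < 1/4}) ` topspace earring_telescope"

lemma open_cover_tel: "open_cover earring_telescope (tel_cover n j)"
proof -
  let ?U = "\<lambda>z. {z' \<in> topspace earring_telescope.
     \<forall>m\<in>{1..n}. dist (tel_coords j z m) (tel_coords j z' m) < 1/4}"
  have "openin earring_telescope (?U z)" for z
  proof -
    have "openin earring_telescope {z' \<in> topspace earring_telescope. tel_coord (int m + j) z' \<in> ball (tel_coords j z m) (1/4)}" for m
      by (rule openin_continuous_map_preimage[OF continuous_tel_coord]) simp
    then have "openin earring_telescope (\<Inter>(insert (topspace earring_telescope)
        ((\<lambda>m. {z' \<in> topspace earring_telescope. tel_coord (int m + j) z' \<in> ball (tel_coords j z m) (1/4)}) ` {1..n})))"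
      by (intro openin_Inter) auto
    also have "\<Inter>(insert (topspace earring_telescope)
        ((\<lambda>m. {z' \<in> topspace earring_telescope. tel_coord (int m + j) z' \<in> ball (tel_coords j z m) (1/4)}) ` {1..n})) = ?U z"
      by (auto simp: tel_coords_def)
    finally show ?thesis .
  qed
  then show ?thesis by (auto simp: open_cover_def tel_cover_def)
qed

text \<open>The loop \<open>\<delta>\<close> of a generator stays in one member of the cover, so the
  conjugate by \<open>\<gamma>\<close> has trivial word. Trivial words persist under products and
  inverses, so every element of the generated group has a representative with trivial word.\<close>

lemma spanier_cover_group_trivial_word:
  assumes A: "A \<in> spanier_cover_group earring_telescope (tel_cover n j) earring_telescope_base"
  shows "\<exists>p. loopin earring_telescope earring_telescope_base p \<and> A = path_class earring_telescope p \<and>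
     trivial_word n (\<lambda>t. tel_coords j (p t))"
proof -
  let ?T = earring_telescope and ?x = earring_telescope_base
  let ?G = "fundamental_group ?T ?x"
  have conj: "\<exists>p. loopin ?T ?x p \<and> A = path_class ?T p \<and> trivial_word n (\<lambda>t. tel_coords j (p t))"
    if A: "A \<in> {path_class ?T (path_join (path_join \<gamma> \<delta>) (path_reverse \<gamma>)) | \<gamma> \<delta>.
          pathin ?T \<gamma> \<and> \<gamma> 0 = ?x \<and> loopin ?T (\<gamma> 1) \<delta> \<and> (\<exists>U\<in>tel_cover n j. \<delta> ` {0..1} \<subseteq> U)}" for A
  proof -
    obtain \<gamma> \<delta> U where g: "A = path_class ?T (path_join (path_join \<gamma> \<delta>) (path_reverse \<gamma>))"
      "pathin ?T \<gamma>" "\<gamma> 0 = ?x" "loopin ?T (\<gamma> 1) \<delta>" "U \<in> tel_cover n j" "\<delta> ` {0..1} \<subseteq> U"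
      using A by blast
    then obtain z where z: "\<And>t. t \<in> {0..1} \<Longrightarrow> \<forall>m\<in>{1..n}. dist (tel_coords j z m) (tel_coords j (\<delta> t) m) < 1/4"
      unfolding tel_cover_def by blast
    have "close_pt n (tel_coords j (\<delta> s)) (tel_coords j (\<delta> t))" if "s \<in> {0..1}" "t \<in> {0..1}" for s t
      unfolding close_pt_def
    proof
      fix m assume "m \<in> {1..n}"
      then show "cmod (tel_coords j (\<delta> s) m - tel_coords j (\<delta> t) m) < 1/2"
        using dist_triangle_half_r[of "tel_coords j z m" "tel_coords j (\<delta> s) m" "1/2" "tel_coords j (\<delta> t) m"]
          z[OF that(1)] z[OF that(2)] by (simp add: dist_norm)
    qed
    then have "trivial_word n (\<lambda>t. tel_coords j (path_join (path_join \<gamma> \<delta>) (path_reverse \<gamma>) t))"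
      unfolding compose_path_join compose_path_reverse
      using g(2,4) by (intro trivial_word_conjugate coord_map_tel) (auto simp: pathin_def loopin_def)
    moreover have "loopin ?T ?x (path_join (path_join \<gamma> \<delta>) (path_reverse \<gamma>))"
      using g(2-4) by (auto simp: loopin_def intro!: pathin_join pathin_reverse)
    ultimately show ?thesis using g(1) by blast
  qed
  show ?thesis
    using A unfolding spanier_cover_group_def
  proof (induction rule: generate.induct)
    case one
    then show ?case
      using tel_base_in trivial_word_const
      by (intro exI[of _ "\<lambda>_. ?x"]) (auto simp: loopin_def one_fundamental_group)
  next
    case (incl A)
    then show ?case by (rule conj)
  next
    case (inv A)
    from conj[OF inv] obtain p where
      p: "loopin ?T ?x p" "A = path_class ?T p" "trivial_word n (\<lambda>t. tel_coords j (p t))"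
      by blast
    have "trivial_word n (\<lambda>t. tel_coords j (path_reverse p t))"
      unfolding compose_path_reverse
      using p by (intro trivial_word_reverse coord_map_tel) (auto simp: loopin_def pathin_def)
    then show ?case
      using p inv_path_class[OF p(1)] loopin_reverse[OF p(1)] by blast
  next
    case (eng A B)
    then obtain p q where p: "loopin ?T ?x p" "A = path_class ?T p" "trivial_word n (\<lambda>t. tel_coords j (p t))"
      and q: "loopin ?T ?x q" "B = path_class ?T q" "trivial_word n (\<lambda>t. tel_coords j (q t))"
      by blast
    have "trivial_word n (\<lambda>t. tel_coords j (path_join p q t))"
      unfolding compose_path_join using p q by (intro trivial_word_join) (auto simp: loopin_def)
    then show ?case
      using p q mult_path_class[OF p(1) q(1)] loopin_join[OF p(1) q(1)] by blast
  qed
qed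

theorem spanier_group_trivial:
  "spanier_group earring_telescope earring_telescope_base =
     {\<one>\<^bsub>fundamental_group earring_telescope earring_telescope_base\<^esub>}"
proof -
  let ?T = earring_telescope and ?x = earring_telescope_base
  have "A = path_class ?T (\<lambda>_. ?x)" if A: "A \<in> spanier_group ?T ?x" for A
  proof -
    have ex: "\<exists>p. loopin ?T ?x p \<and> A = path_class ?T p \<and> trivial_word n (\<lambda>t. tel_coords j (p t))" for n j
      using A open_cover_tel unfolding spanier_group_def by (intro spanier_cover_group_trivial_word) blast
    then obtain \<alpha> where \<alpha>: "loopin ?T ?x \<alpha>" "A = path_class ?T \<alpha>" by blast
    \<comment> \<open>The representative with trivial word varies with \<open>n\<close> and
      \<open>j\<close>, but all of them are homotopic to \<open>\<alpha>\<close>, and triviality is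
      a homotopy invariant.\<close>
    have "trivial_word n (\<lambda>t. tel_coords j (\<alpha> t))" for n j
    proof -
      obtain p where p: "loopin ?T ?x p" "A = path_class ?T p" "trivial_word n (\<lambda>t. tel_coords j (p t))"
        using ex by blast
      then have "path_homotopic ?T p \<alpha>"
        using path_class_eq_iff[of ?T p \<alpha>] \<alpha>(2) by (simp add: loopin_def)
      then show ?thesis using p(3) by (rule trivial_word_path_homotopic)
    qed
    then have "path_homotopic ?T \<alpha> (\<lambda>_. ?x)"
      using \<alpha>(1) by (intro tel_loop_nullhomotopic) (simp_all add: tel_coords_def[abs_def])
    then show ?thesis
      using \<alpha> path_class_eq_iff[of ?T \<alpha>] by (simp add: loopin_def)
  qed
  moreover have "\<one>\<^bsub>fundamental_group ?T ?x\<^esub> \<in> spanier_group ?T ?x"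
    unfolding spanier_group_def spanier_cover_group_def by (intro INT_I generate.one)
  ultimately show ?thesis
    unfolding one_fundamental_group by blast
qed

section \<open>Coverings\<close>

text \<open>The infinite cyclic covering unwinding one cylinder, with a point \<open>(z, w)\<close> over \<open>z\<close> encoded as
  the path that is \<open>z\<close> at time \<open>w\<close> and the non-point \<open>{}\<close> elsewhere.\<close>

definition unwind_code :: "'p set \<times> real \<Rightarrow> (real \<Rightarrow> 'p set) set" where
  "unwind_code p = {\<lambda>s. if s = snd p then fst p else {}}"

definition unwind_pts :: "int \<Rightarrow> ((int \<times> (real \<times> real) \<times> real) set \<times> real) set" where
  "unwind_pts k = {p. fst p \<in> topspace earring_telescope \<and> tel_coord k (fst p) = cis (2 * pi * snd p)}"

definition unwind_decode ::
    "int \<Rightarrow> (real \<Rightarrow> (int \<times> (real \<times> real) \<times> real) set) set \<Rightarrow> (int \<times> (real \<times> real) \<times> real) set \<times> real" where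
  "unwind_decode k = inv_into (unwind_pts k) unwind_code"

definition unwind_top :: "int \<Rightarrow> (real \<Rightarrow> (int \<times> (real \<times> real) \<times> real) set) set topology" where
  "unwind_top k = pullback_topology (unwind_code ` unwind_pts k) (unwind_decode k)
     (prod_topology earring_telescope euclideanreal)"

text \<open>Points of the telescope are equivalence classes, hence never \<open>{}\<close>; this
  makes \<open>{}\<close> a safe filler in \<open>unwind_code\<close> and the code
  injective.\<close>

lemma tel_point_nonempty: "z \<in> topspace earring_telescope \<Longrightarrow> z \<noteq> {}"
  using equiv_telescope_rel[of "\<lambda>_. earring_top" "\<lambda>_. earring_shift"]
  by (auto simp: earring_telescope_def mapping_telescope_def dest: in_quotient_imp_non_empty)

lemma inj_unwind_code: "inj_on unwind_code (unwind_pts k)"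
proof (rule inj_onI)
  fix p q assume pq: "p \<in> unwind_pts k" "q \<in> unwind_pts k" "unwind_code p = unwind_code q"
  then have "(\<lambda>s. if s = snd p then fst p else {}) = (\<lambda>s. if s = snd q then fst q else {})"
    by (simp add: unwind_code_def)
  then have "fst p = (if snd p = snd q then fst q else {})"
    by (metis (full_types))
  then show "p = q"
    using pq tel_point_nonempty by (auto simp: unwind_pts_def prod_eq_iff split: if_splits)
qed

lemma unwind_decode_code: "p \<in> unwind_pts k \<Longrightarrow> unwind_decode k (unwind_code p) = p"
  unfolding unwind_decode_def by (rule inv_into_f_f[OF inj_unwind_code])

lemma topspace_unwind: "topspace (unwind_top k) = unwind_code ` unwind_pts k"
  unfolding unwind_top_def topspace_pullback_topology
  by (auto simp: unwind_decode_code unwind_pts_def)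

lemma unwind_decode_in: "e \<in> topspace (unwind_top k) \<Longrightarrow> unwind_decode k e \<in> unwind_pts k"
  and unwind_code_decode: "e \<in> topspace (unwind_top k) \<Longrightarrow> unwind_code (unwind_decode k e) = e"
  by (auto simp: topspace_unwind unwind_decode_code)

lemma continuous_unwind_decode:
  "continuous_map (unwind_top k) (prod_topology earring_telescope euclideanreal) (unwind_decode k)"
  using continuous_map_pullback[OF continuous_map_id, of "unwind_code ` unwind_pts k" "unwind_decode k"]
  by (simp add: unwind_top_def)

lemma continuous_unwind_fst: "continuous_map (unwind_top k) earring_telescope (\<lambda>e. fst (unwind_decode k e))"
  and continuous_unwind_snd: "continuous_map (unwind_top k) euclideanreal (\<lambda>e. snd (unwind_decode k e))"
  using continuous_unwind_decode[of k] by (auto simp: continuous_map_pairwise o_def)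

lemma continuous_unwind_code:
  assumes "continuous_map X earring_telescope f" "continuous_map X euclideanreal g"
    and "\<And>x. x \<in> topspace X \<Longrightarrow> (f x, g x) \<in> unwind_pts k"
  shows "continuous_map X (unwind_top k) (\<lambda>x. unwind_code (f x, g x))"
  unfolding unwind_top_def
proof (rule continuous_map_pullback')
  have "continuous_map X (prod_topology earring_telescope euclideanreal) (\<lambda>x. (f x, g x))"
    using assms(1,2) by (simp add: continuous_map_pairwise o_def)
  then show "continuous_map X (prod_topology earring_telescope euclideanreal) (unwind_decode k \<circ> (\<lambda>x. unwind_code (f x, g x)))"
    by (rule continuous_map_eq) (simp add: unwind_decode_code assms(3))
qed (use assms(3) in auto)

lemma cos_pos_near_integer:
  assumes "cos (2 * pi * a) > 0"
  shows "\<bar>a - of_int \<lfloor>a + 1/2\<rfloor>\<bar> < 1/4"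
proof (rule ccontr)
  define u where "u = a - of_int \<lfloor>a + 1/2\<rfloor>"
  assume "\<not> ?thesis"
  then consider "\<bar>u\<bar> > 1/4" | "\<bar>u\<bar> = 1/4" unfolding u_def by linarith
  then have "cos (2 * pi * u) \<le> 0"
  proof cases
    case 1
    then show ?thesis
      using cos_neg_iff[of u] cis_shift(3,4)[of a] by (simp add: u_def)
  next
    case 2
    have "2 * pi * \<bar>u\<bar> = pi / 2" unfolding 2 by simp
    then have "cos (2 * pi * \<bar>u\<bar>) = 0" by (simp only: cos_pi_half)
    then show ?thesis by (cases "u \<ge> 0") auto
  qed
  then show False
    using assms cis_shift(1)[of a] by (simp add: u_def)
qed

lemma tel_coord_norm:
  assumes "z \<in> topspace earring_telescope"
  shows "cmod (tel_coord k z) = 1"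
proof -
  obtain i x t where "x \<in> earring" "t \<in> {0..1}" "z = tel_proj i x t"
    using tel_proj_cases[OF assms] .
  then show ?thesis by (simp add: tel_coord circle_coord_norm)
qed

lemma cis_arcsin:
  assumes "cmod \<zeta> = 1" "Re \<zeta> > 0"
  shows "cis (arcsin (Im \<zeta>)) = \<zeta>" "\<bar>arcsin (Im \<zeta>)\<bar> < pi / 2"
proof -
  have sq: "(Re \<zeta>)\<^sup>2 + (Im \<zeta>)\<^sup>2 = 1" using assms(1) cmod_power2[of \<zeta>] by simp
  have "(Im \<zeta>)\<^sup>2 < 1" using sq assms(2) zero_less_power[of "Re \<zeta>" 2] by linarith
  then have im: "-1 < Im \<zeta>" "Im \<zeta> < 1" by (auto simp: abs_square_less_1)
  have "1 - (Im \<zeta>)\<^sup>2 = (Re \<zeta>)\<^sup>2" using sq by linarith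
  then have "cos (arcsin (Im \<zeta>)) = sqrt ((Re \<zeta>)\<^sup>2)"
    using im cos_arcsin[of "Im \<zeta>"] by simp
  then show "cis (arcsin (Im \<zeta>)) = \<zeta>"
    using im assms(2) by (simp add: complex_eq_iff)
  show "\<bar>arcsin (Im \<zeta>)\<bar> < pi / 2"
    unfolding abs_less_iff using arcsin_lt_bounded[OF im] by linarith
qed

lemma covering_unwind: "covering_projection (unwind_top k) earring_telescope (\<lambda>e. fst (unwind_decode k e))"
  unfolding covering_projection_def
proof (intro conjI ballI)
  let ?T = earring_telescope and ?E = "unwind_top k"
  let ?z = "\<lambda>e. fst (unwind_decode k e)" and ?w = "\<lambda>e. snd (unwind_decode k e)"
  show "continuous_map ?E ?T ?z" by (rule continuous_unwind_fst)
  have angle: "\<exists>w. tel_coord k z = cis (2 * pi * w)" if "z \<in> topspace ?T" for z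
  proof -
    have "tel_coord k z = cis (Arg (tel_coord k z))"
      using tel_coord_norm[OF that, of k] by (metis cis_Arg norm_zero sgn_eq div_by_1 of_real_1 zero_neq_one)
    then show ?thesis by (intro exI[of _ "Arg (tel_coord k z) / (2 * pi)"]) simp
  qed
  show "?z ` topspace ?E = topspace ?T"
  proof
    show "?z ` topspace ?E \<subseteq> topspace ?T"
      using unwind_decode_in by (auto simp: unwind_pts_def)
    show "topspace ?T \<subseteq> ?z ` topspace ?E"
    proof
      fix z assume z: "z \<in> topspace ?T"
      obtain w where "tel_coord k z = cis (2 * pi * w)" using angle[OF z] by blast
      then have "(z, w) \<in> unwind_pts k" using z by (simp add: unwind_pts_def)
      then show "z \<in> ?z ` topspace ?E"
        by (intro image_eqI[of _ _ "unwind_code (z, w)"]) (auto simp: unwind_decode_code topspace_unwind)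
    qed
  qed
  fix z0 assume z0: "z0 \<in> topspace ?T"
  obtain w0 where w0: "tel_coord k z0 = cis (2 * pi * w0)" using angle[OF z0] by blast
  \<comment> \<open>The coordinate rotated to be 1 at \<open>z0\<close>. Where its real part is
    positive, \<open>arcsin\<close> of its imaginary part is its angle, which gives the inverse on
    each sheet by a continuous formula.\<close>
  define \<zeta> where "\<zeta> z = tel_coord k z * cis (- (2 * pi * w0))" for z
  have \<zeta>: "continuous_map ?T euclidean \<zeta>"
    using continuous_map_compose[OF continuous_tel_coord, of euclidean "\<lambda>c. c * cis (- (2 * pi * w0))" k]
    by (simp add: \<zeta>_def[abs_def] o_def continuous_intros)
  define U where "U = {z \<in> topspace ?T. \<zeta> z \<in> {c. Re c > 0}}"
  have U: "openin ?T U"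
    unfolding U_def using open_halfspace_Re_gt by (intro openin_continuous_map_preimage[OF \<zeta>]) auto
  have \<zeta>_pt: "\<zeta> (?z e) = cis (2 * pi * (?w e - w0))" if "e \<in> topspace ?E" for e
    using unwind_decode_in[OF that] by (simp add: \<zeta>_def unwind_pts_def cis_mult algebra_simps)
  \<comment> \<open>A positive cosine puts an angle within a quarter turn of exactly one integer, so
    with radius 1/4 the sheets are disjoint and exhaust the preimage of \<open>U\<close>.\<close>
  define V where "V i = {e \<in> topspace ?E. ?z e \<in> U \<and> ?w e \<in> ball (w0 + of_int i) (1/4)}" for i :: int
  define \<sigma> where "\<sigma> i z = unwind_code (z, w0 + of_int i + arcsin (Im (\<zeta> z)) / (2 * pi))" for i :: int and z
  have V_open: "openin ?E (V i)" for i
  proof -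
    have "V i = {e \<in> topspace ?E. ?z e \<in> U} \<inter> {e \<in> topspace ?E. ?w e \<in> ball (w0 + of_int i) (1/4)}"
      by (auto simp: V_def)
    then show ?thesis
      using openin_continuous_map_preimage[OF continuous_unwind_fst U]
        openin_continuous_map_preimage[OF continuous_unwind_snd, of "ball (w0 + of_int i) (1/4)"] by auto
  qed
  have union: "\<Union>(range V) = {e \<in> topspace ?E. ?z e \<in> U}"
  proof
    show "{e \<in> topspace ?E. ?z e \<in> U} \<subseteq> \<Union>(range V)"
    proof
      fix e assume e: "e \<in> {e \<in> topspace ?E. ?z e \<in> U}"
      then have "cos (2 * pi * (?w e - w0)) > 0"
        using \<zeta>_pt[of e] by (simp add: U_def)
      then have "e \<in> V \<lfloor>?w e - w0 + 1/2\<rfloor>"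
        using e cos_pos_near_integer[of "?w e - w0"] by (simp add: V_def dist_real_def abs_minus_commute algebra_simps)
      then show "e \<in> \<Union>(range V)" by blast
    qed
  qed (auto simp: V_def)
  have \<zeta>_U: "cmod (\<zeta> z) = 1" "Re (\<zeta> z) > 0" "z \<in> topspace ?T" if "z \<in> U" for z
    using that tel_coord_norm[of z k] by (auto simp: U_def \<zeta>_def norm_mult)
  have \<sigma>_pts: "(z, w0 + of_int i + arcsin (Im (\<zeta> z)) / (2 * pi)) \<in> unwind_pts k" if "z \<in> U" for z i
  proof -
    have "cis (2 * pi * (w0 + of_int i + arcsin (Im (\<zeta> z)) / (2 * pi))) =
        cis (2 * pi * w0) * cis (2 * pi * of_int i) * cis (arcsin (Im (\<zeta> z)))"
      by (simp add: cis_mult algebra_simps)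
    also have "\<dots> = cis (2 * pi * w0) * \<zeta> z"
      using cis_arcsin(1)[OF \<zeta>_U(1,2)[OF that]] by (simp add: cis_multiple_2pi)
    also have "\<dots> = tel_coord k z"
      by (simp add: \<zeta>_def cis_mult mult.left_commute)
    finally show ?thesis using \<zeta>_U(3)[OF that] by (simp add: unwind_pts_def)
  qed
  have homeo: "homeomorphic_map (subtopology ?E (V i)) (subtopology ?T U) ?z" for i
    unfolding homeomorphic_map_maps homeomorphic_maps_def
  proof (intro exI[of _ "\<sigma> i"] conjI ballI)
    have VE: "V i \<subseteq> topspace ?E" and UT: "U \<subseteq> topspace ?T" by (auto simp: V_def U_def)
    show "continuous_map (subtopology ?E (V i)) (subtopology ?T U) ?z"
      using continuous_unwind_fst
      by (auto simp: continuous_map_in_subtopology continuous_map_from_subtopology V_def)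
    have 1: "continuous_map (subtopology ?T U) (top_of_set {-1..1}) (\<lambda>z. Im (\<zeta> z))"
    proof -
      have "continuous_map (subtopology ?T U) euclideanreal (\<lambda>z. Im (\<zeta> z))"
        using continuous_map_compose[OF continuous_map_from_subtopology[OF \<zeta>], of euclideanreal Im U]
        by (simp add: o_def continuous_on_Im continuous_on_id)
      moreover have "Im (\<zeta> z) \<in> {-1..1}" if "z \<in> U" for z
        using abs_Im_le_cmod[of "\<zeta> z"] \<zeta>_U(1)[OF that] by (auto simp: abs_le_iff)
      ultimately show ?thesis
        using UT by (auto simp: continuous_map_in_subtopology)
    qed
    have 2: "continuous_map (top_of_set {-1..1}) euclideanreal (\<lambda>y. w0 + of_int i + arcsin y / (2 * pi))"
      by (auto intro!: continuous_intros)
    have "continuous_map (subtopology ?T U) euclideanreal (\<lambda>z. w0 + of_int i + arcsin (Im (\<zeta> z)) / (2 * pi))"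
      using continuous_map_compose[OF 1 2] by (simp add: o_def)
    then have "continuous_map (subtopology ?T U) ?E (\<sigma> i)"
      unfolding \<sigma>_def
      by (intro continuous_unwind_code) (use \<sigma>_pts in \<open>auto intro: continuous_map_from_subtopology\<close>)
    moreover have "\<sigma> i z \<in> V i" if "z \<in> U" for z
    proof -
      have "\<bar>arcsin (Im (\<zeta> z)) / (2 * pi)\<bar> < 1/4"
        using cis_arcsin(2)[OF \<zeta>_U(1,2)[OF that]] by (simp add: field_simps)
      then show ?thesis
        using \<sigma>_pts[OF that, of i] that
        by (auto simp: V_def \<sigma>_def topspace_unwind unwind_decode_code dist_real_def)
    qed
    ultimately show "continuous_map (subtopology ?T U) (subtopology ?E (V i)) (\<sigma> i)"
      by (auto simp: continuous_map_in_subtopology)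
    show "\<sigma> i (?z e) = e" if e: "e \<in> topspace (subtopology ?E (V i))" for e
    proof -
      have e': "e \<in> topspace ?E" "e \<in> V i" using e by auto
      define a where "a = ?w e - w0 - of_int i"
      have "\<bar>a\<bar> < 1/4" using e'(2) by (auto simp: V_def a_def dist_real_def abs_minus_commute algebra_simps)
      then have "2 * pi * \<bar>a\<bar> \<le> 2 * pi * (1/4)"
        by (intro mult_left_mono) auto
      then have "\<bar>2 * pi * a\<bar> \<le> pi / 2" by (simp add: abs_mult)
      then have a: "- (pi / 2) \<le> 2 * pi * a" "2 * pi * a \<le> pi / 2"
        by linarith+
      have "\<zeta> (?z e) = cis (2 * pi * a) * cis (2 * pi * of_int i)"
        unfolding \<zeta>_pt[OF e'(1)] by (simp add: a_def cis_mult algebra_simps)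
      then have "Im (\<zeta> (?z e)) = sin (2 * pi * a)"
        by (simp add: cis_multiple_2pi)
      then have "arcsin (Im (\<zeta> (?z e))) = 2 * pi * a"
        using arcsin_sin[OF a] by simp
      then have "\<sigma> i (?z e) = unwind_code (unwind_decode k e)"
        by (simp add: \<sigma>_def a_def)
      then show ?thesis using unwind_code_decode[OF e'(1)] by simp
    qed
    show "?z (\<sigma> i z) = z" if "z \<in> topspace (subtopology ?T U)" for z
      using that \<sigma>_pts[of z i] by (simp add: \<sigma>_def unwind_decode_code)
  qed
  have "z0 \<in> U" using z0 by (simp add: U_def \<zeta>_def w0 cis_mult)
  moreover have "pairwise disjnt (range V)"
  proof (rule pairwiseI)
    fix A B assume "A \<in> range V" "B \<in> range V" "A \<noteq> B"
    then obtain i j where ij: "A = V i" "B = V j" "i \<noteq> j" by auto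
    have "i = j" if "e \<in> V i" "e \<in> V j" for e
    proof -
      have "\<bar>?w e - w0 - of_int i\<bar> < 1/4" "\<bar>?w e - w0 - of_int j\<bar> < 1/4"
        using that by (auto simp: V_def dist_real_def abs_minus_commute algebra_simps)
      then show ?thesis by linarith
    qed
    then show "disjnt A B" using ij by (auto simp: disjnt_def)
  qed
  ultimately show "\<exists>S. z0 \<in> S \<and> openin ?T S \<and>
      (\<exists>\<V>. \<Union>\<V> = {e \<in> topspace ?E. ?z e \<in> S} \<and> (\<forall>V\<in>\<V>. openin ?E V) \<and> pairwise disjnt \<V> \<and>
         (\<forall>V\<in>\<V>. homeomorphic_map (subtopology ?E V) (subtopology ?T S) ?z))"
    using U union V_open homeo by (intro exI[of _ U] conjI exI[of _ "range V"]) auto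
qed

section \<open>Small circles and the nonexistence of a universal covering\<close>

lemma small_loop_in_open:
  assumes N: "openin earring_telescope N" "earring_telescope_base \<in> N"
  obtains m where "m \<ge> 1" "\<And>t. tel_proj 0 (earring_loop m t) 0 \<in> N"
proof -
  have "continuous_map earring_top earring_telescope (\<lambda>x. tel_proj 0 x 0)"
    by (rule continuous_map_tel_proj) (auto intro!: continuous_intros)
  then have "openin earring_top {x \<in> earring. tel_proj 0 x 0 \<in> N}"
    using openin_continuous_map_preimage[OF _ N(1)] by fastforce
  moreover have "(0, 0) \<in> {x \<in> earring. tel_proj 0 x 0 \<in> N}"
    using N(2) origin_in_earring by (simp add: tel_base)
  ultimately obtain e where e: "e > 0" "\<And>x. x \<in> earring \<Longrightarrow> dist x (0, 0) < e \<Longrightarrow> tel_proj 0 x 0 \<in> N"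
    unfolding openin_euclidean_subtopology_iff by blast
  obtain m where m: "real m > 3 / e" using reals_Archimedean2 by blast
  then have "m \<ge> 1" using e(1) by (cases m) (auto simp: divide_less_0_iff)
  have "tel_proj 0 (earring_loop m t) 0 \<in> N" for t
  proof (rule e(2)[OF earring_loop_in[OF \<open>m \<ge> 1\<close>]])
    have "norm (earring_loop m t) \<le> 3 / real m"
      using norm_circle_pt[of "cis (2 * pi * t)" m] \<open>m \<ge> 1\<close> by (simp add: circle_pt_cis)
    also have "\<dots> < e" using m e(1) \<open>m \<ge> 1\<close> by (simp add: field_simps)
    finally show "dist (earring_loop m t) (0, 0) < e"
      by (simp add: dist_norm flip: zero_prod_def)
  qed
  then show ?thesis using that \<open>m \<ge> 1\<close> by blast
qed

theorem no_universal_covering: "\<not> universal_covering_projection Y y earring_telescope u"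
proof
  let ?T = earring_telescope
  assume univ: "universal_covering_projection Y y ?T u"
  then have cov: "covering_projection Y ?T u" and y: "y \<in> topspace Y"
    by (auto simp: universal_covering_projection_def)
  \<comment> \<open>The base point \<open>y\<close> may lie over any point of the telescope.
    Surjectivity supplies a point over the base point where the small circles are, and hence at
    least one sheet over its neighbourhood \<open>N\<close>.\<close>
  have "earring_telescope_base \<in> u ` topspace Y"
    using cov tel_base_in by (simp add: covering_projection_def)
  then obtain y' where y': "y' \<in> topspace Y" "u y' = earring_telescope_base"
    by force
  obtain N \<V> where N: "earring_telescope_base \<in> N" "openin ?T N" "\<Union>\<V> = {e \<in> topspace Y. u e \<in> N}"
    "\<And>V. V \<in> \<V> \<Longrightarrow> homeomorphic_map (subtopology Y V) (subtopology ?T N) u"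
    using cov tel_base_in unfolding covering_projection_def by meson
  have "y' \<in> \<Union>\<V>" unfolding N(3) using N(1) y' by simp
  then obtain V where V: "V \<in> \<V>" by blast
  obtain g where g: "continuous_map (subtopology ?T N) (subtopology Y V) g"
    "\<And>z. z \<in> topspace (subtopology ?T N) \<Longrightarrow> u (g z) = z"
    using N(4)[OF V] unfolding homeomorphic_map_maps homeomorphic_maps_def by blast
  obtain m where m: "m \<ge> 1" "\<And>t. tel_proj 0 (earring_loop m t) 0 \<in> N"
    using small_loop_in_open[OF N(2,1)] by blast
  define l where "l t = tel_proj 0 (earring_loop m t) 0" for t
  have l_in: "l t \<in> topspace (subtopology ?T N)" for t
    using m tel_proj_in[OF earring_loop_in[OF m(1)]] by (simp add: l_def)
  have "continuous_map (top_of_set {0..1}) ?T l"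
    unfolding l_def
  proof (rule continuous_map_tel_proj)
    show "continuous_on {0..1} (earring_loop m)"
      unfolding earring_loop_def by (intro continuous_intros)
  qed (use earring_loop_in[OF m(1)] in auto)
  then have "continuous_map (top_of_set {0..1}) (subtopology ?T N) l"
    using l_in by (auto simp: continuous_map_in_subtopology)
  from continuous_map_compose[OF this g(1)] have gl: "continuous_map (top_of_set {0..1}) Y (g \<circ> l)"
    by (simp add: continuous_map_in_subtopology)
  let ?E = "unwind_top (int m)" and ?d = "unwind_decode (int m)"
  have "u y \<in> topspace ?T" using cov y by (auto simp: covering_projection_def)
  then obtain e where e: "e \<in> topspace ?E" "fst (?d e) = u y"
    using covering_unwind[of "int m"] unfolding covering_projection_def by (metis (no_types, lifting) imageE)
  then obtain s where s: "continuous_map Y ?E s" "\<And>z. z \<in> topspace Y \<Longrightarrow> fst (?d (s z)) = u z"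
    using univ covering_unwind[of "int m"] unfolding universal_covering_projection_def by metis
  \<comment> \<open>The angle along the image of the lifted circle. It has to follow
    \<open>t\<close> up to an integer constant and so gain a full turn; but it is a function of
    \<open>l t\<close>, and \<open>l 1 = l 0\<close>.\<close>
  define w where "w t = snd (?d (s (g (l t))))" for t
  have w: "continuous_on {0..1} w"
    using continuous_map_compose[OF continuous_map_compose[OF gl s(1)] continuous_unwind_snd]
    by (simp add: o_def w_def)
  have "w t - t \<in> \<int>" if t: "t \<in> {0..1}" for t
  proof -
    have Y: "g (l t) \<in> topspace Y" using gl t by (auto simp: continuous_map_def)
    have "s (g (l t)) \<in> topspace ?E" using s(1) Y by (auto simp: continuous_map_def)
    then have "cis (2 * pi * w t) = tel_coord (int m) (fst (?d (s (g (l t)))))"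
      using unwind_decode_in by (auto simp: unwind_pts_def w_def)
    also have "\<dots> = tel_coord (int m) (l t)"
      using s(2)[OF Y] g(2)[OF l_in] by simp
    also have "\<dots> = cis (2 * pi * t)"
      using m(1) earring_loop_in[OF m(1)] by (simp add: l_def tel_coord circle_coord_loop)
    finally have "cis (2 * pi * (w t - t)) = 1"
      by (simp add: right_diff_distrib flip: cis_divide)
    then show ?thesis by (simp only: cis_eq_1_iff)
  qed
  then have "(\<lambda>t. w t - t) constant_on {0..1}"
  proof (intro continuous_discrete_range_constant)
    show "\<exists>e>0. \<forall>t'. t' \<in> {0..1} \<and> w t' - t' \<noteq> w t - t \<longrightarrow> e \<le> norm (w t' - t' - (w t - t))"
      if t: "t \<in> {0..1}" and int: "\<And>t. t \<in> {0..1} \<Longrightarrow> w t - t \<in> \<int>" for t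
    proof (intro exI[of _ 1] conjI allI impI)
      fix t' assume t': "t' \<in> {0..1} \<and> w t' - t' \<noteq> w t - t"
      then have "w t' - t' - (w t - t) \<in> \<int>" using int t by (intro Ints_diff[OF int int]) auto
      then obtain n :: int where "w t' - t' - (w t - t) = of_int n" by (auto elim: Ints_cases)
      moreover from this have "n \<noteq> 0" using t' by auto
      ultimately show "1 \<le> norm (w t' - t' - (w t - t))" by simp
    qed simp
  qed (auto intro!: continuous_intros w)
  then have "w 1 - 1 = w 0 - 0"
    unfolding constant_on_def by (metis atLeastAtMost_iff order_refl zero_le_one)
  moreover have "w 1 = w 0"
    by (simp add: w_def l_def earring_loop_def)
  ultimately show False by simp
qed

theorem corollary4p3:
  shows "spanier_group earring_telescope earring_telescope_base =
           {\<one>\<^bsub>fundamental_group earring_telescope earring_telescope_base\<^esub>}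
       \<and> \<not> (\<exists>(Y :: 'c topology) y u. universal_covering_projection Y y earring_telescope u)"
proof (intro conjI notI)
  assume "\<exists>(Y :: 'c topology) y u. universal_covering_projection Y y earring_telescope u"
  then obtain Y :: "'c topology" and y u where "universal_covering_projection Y y earring_telescope u"
    by (elim exE)
  then show False by (rule notE[OF no_universal_covering])
qed (rule spanier_group_trivial)
end
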